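(* Let $\mathcal{V}$ be a variety in a finite language with a $\mathsf{d}$-cube term ($\mathsf{d}>1$), let $P$ be a $(1,\mathsf{d}-1)$-parallelogram term for $\mathcal{V}$, and let $\mathcal{K}$ be a finite set of finite algebras in $\mathcal{V}$. The problems $\mathrm{SMP}(\mathcal{K})$ and $\mathrm{CompactRep}(\mathcal{K})$ are polynomial time reducible to one another. More precisely, $\mathrm{CompactRep}(\mathcal{K})$ can be solved in polynomial time by an algorithm making repeated calls to $\mathrm{SMP}(\mathcal{K})$, and $\mathrm{SMP}(\mathcal{K})$ restricted to inputs with $n\ge\mathsf{d}$ can be solved in polynomial time by an algorithm making a single call to $\mathrm{CompactRep}(\mathcal{K})$.
   Context: $[m]=\{1,\dots,m\}$, $\binom{S}{k}$ is the set of $k$-element subsets of $S$, and $b|_I$, $B|_I$ denote projections onto the coordinates in $I$. A $\mathsf{d}$-cube term is a term $t$ satisfying identities $t(M)=(y,\dots,y)^T$ with $M$ a matrix with $\mathsf{d}$ rows, entries among the variables $x,y$, each column containing at least one $x$. A $(1,\mathsf{d}-1)$-parallelogram term is a $(\mathsf{d}+3)$-ary term $P$ with $P(x,x,y,z,y,\dots,y)=y$ and, for $j=2,\dots,\mathsf{d}$, $P(y,x,x,y,\dots,y,z,y,\dots,y)=y$ ($z$ in the $j$-th of the last $\mathsf{d}$ positions); such a term exists in $\mathcal{V}$. Let $p(x,u,y):=P(x,u,y,x,y,\dots,y)$ and $x^y:=p(x,y,y)$. For $B\subseteq A_1\times\dots\times A_n$ and $i\in[n]$, $(\gamma,\delta)$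 is a fork in coordinate $i$ of $B$, witnessed by $b,\hat b\in B$, if $b|_{[i-1]}=\hat b|_{[i-1]}$, $b|_i=\gamma$, $\hat b|_i=\delta$; $\operatorname{fork}_i(B)$ is the set of forks and $\operatorname{fork}'_i(B)=\{(\gamma,\delta^\gamma):(\gamma,\delta)\in\operatorname{fork}_i(B)\}$. For a subalgebra $\mathbf{B}$ of $\mathbf{A}_1\times\dots\times\mathbf{A}_n$ ($\mathbf{A}_i\in\mathcal{K}$, $n\ge\mathsf{d}$), a standardized representation for $\mathbf{B}$ is a set $R\subseteq B$ together with designations such that: (1) for every $I\in\binom{[n]}{\mathsf{d}-1}$ and every $\bar b\in B|_I$ an element $r_{I,\bar b}\in R$ with $r_{I,\bar b}|_I=\bar b$ is designated; (2) for every $m$ with $\mathsf{d}\le m\le n$ there is a set $F_m$ with $\operatorname{fork}'_m(B)\subseteq F_m\subseteq\operatorname{fork}_m(R)$, and for every $(\gamma,\delta)\in F_m$ a pair $(u_{m,\gamma,\delta},\hat u_{m,\gamma,\delta})\in R^2$ witnessing $(\gamma,\delta)\in\operatorname{fork}_m(R)$ is designated; (3) every element of $R$ has at least one designation. $\mathrm{CompactRep}(\mathcal{K})$: given $a_1,\dots,a_k\in\mathbf{A}_1\times\dots\times\mathbf{A}_n$ with $\mathbf{A}_i\in\mathcal{K}$ and $n\ge\mathsf{d}$, output a standardized representation (with its designations) for the subalgebra generated by $\{a_1,\dots,a_k\}$. $\mathrm{SMP}(\mathcal{K})$: given $a_1,\dots,a_k,b\in\mathbf{A}_1\times\dots\times\mathbf{A}_n$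 with $\mathbf{A}_i\in\mathcal{K}$, decide whether $b$ is in the subalgebra generated by $\{a_1,\dots,a_k\}$. *)

theory Defs
  imports Main "HOL-Computational_Algebra.Polynomial"
begin

section \<open>Universal algebra\<close>

record 'f language =
  syms :: "'f set"
  arity :: "'f \<Rightarrow> nat"

record ('f, 'a) alg =
  univ :: "'a set"
  interp :: "'f \<Rightarrow> 'a list \<Rightarrow> 'a"

definition is_algebra :: "'f language \<Rightarrow> ('f, 'a) alg \<Rightarrow> bool" where
  "is_algebra L A \<longleftrightarrow> univ A \<noteq> {} \<and>
     (\<forall>f\<in>syms L. \<forall>xs. length xs = arity L f \<and> set xs \<subseteq> univ A \<longrightarrow> interp A f xs \<in> univ A)"

datatype 'f trm = Var nat | Fn 'f "'f trm list"

fun wf_term :: "'f language \<Rightarrow> 'f trm \<Rightarrow> bool" where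
  "wf_term L (Var i) \<longleftrightarrow> True"
| "wf_term L (Fn f ts) \<longleftrightarrow> f \<in> syms L \<and> length ts = arity L f \<and> (\<forall>t\<in>set ts. wf_term L t)"

fun vars :: "'f trm \<Rightarrow> nat set" where
  "vars (Var i) = {i}"
| "vars (Fn f ts) = (\<Union>t\<in>set ts. vars t)"

definition nary_term :: "'f language \<Rightarrow> nat \<Rightarrow> 'f trm \<Rightarrow> bool" where
  "nary_term L k t \<longleftrightarrow> wf_term L t \<and> vars t \<subseteq> {..<k}"

fun eval :: "('f, 'a) alg \<Rightarrow> (nat \<Rightarrow> 'a) \<Rightarrow> 'f trm \<Rightarrow> 'a" where
  "eval A \<sigma> (Var i) = \<sigma> i"
| "eval A \<sigma> (Fn f ts) = interp A f (map (eval A \<sigma>) ts)"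

definition term_op :: "('f, 'a) alg \<Rightarrow> 'f trm \<Rightarrow> 'a list \<Rightarrow> 'a" where
  "term_op A t xs = eval A (\<lambda>i. xs ! i) t"

definition satisfies :: "('f, 'a) alg \<Rightarrow> 'f trm \<times> 'f trm \<Rightarrow> bool" where
  "satisfies A e \<longleftrightarrow> (\<forall>\<sigma>. range \<sigma> \<subseteq> univ A \<longrightarrow> eval A \<sigma> (fst e) = eval A \<sigma> (snd e))"

text \<open>A variety is an equational class; here, the algebras of the class whose universe is a
  subset of the type \<open>'a\<close>. An identity valid in the whole class is in particular valid in these.\<close>

definition variety :: "'f language \<Rightarrow> ('f, 'a) alg set \<Rightarrow> bool" where
  "variety L V \<longleftrightarrow> (\<exists>E. (\<forall>(s, t)\<in>E. wf_term L s \<and> wf_term L t) \<and>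
     V = {A. is_algebra L A \<and> (\<forall>e\<in>E. satisfies A e)})"

text \<open>In the \<open>d\<close> by \<open>k\<close> matrix \<open>M\<close> of variables, \<open>True\<close> stands for \<open>x\<close> and \<open>False\<close> for \<open>y\<close>.\<close>

definition cube_term :: "'f language \<Rightarrow> ('f, 'a) alg set \<Rightarrow> nat \<Rightarrow> 'f trm \<Rightarrow> bool" where
  "cube_term L V d t \<longleftrightarrow> (\<exists>k (M :: nat \<Rightarrow> nat \<Rightarrow> bool).
     nary_term L k t \<and>
     (\<forall>j<k. \<exists>i<d. M i j) \<and>
     (\<forall>A\<in>V. \<forall>x\<in>univ A. \<forall>y\<in>univ A. \<forall>i<d.
        term_op A t (map (\<lambda>j. if M i j then x else y) [0..<k]) = y))"

definition parallelogram_term :: "'f language \<Rightarrow> ('f, 'a) alg set \<Rightarrow> nat \<Rightarrow> 'f trm \<Rightarrow> bool" where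
  "parallelogram_term L V d P \<longleftrightarrow> nary_term L (d + 3) P \<and>
     (\<forall>A\<in>V. \<forall>x\<in>univ A. \<forall>y\<in>univ A. \<forall>z\<in>univ A.
        term_op A P ([x, x, y] @ (replicate d y)[0 := z]) = y \<and>
        (\<forall>j\<in>{2..d}. term_op A P ([y, x, x] @ (replicate d y)[j - 1 := z]) = y))"

definition p_op :: "nat \<Rightarrow> 'f trm \<Rightarrow> ('f, 'a) alg \<Rightarrow> 'a \<Rightarrow> 'a \<Rightarrow> 'a \<Rightarrow> 'a" where
  "p_op d P A x u y = term_op A P ([x, u, y] @ (replicate d y)[0 := x])"

definition pow_op :: "nat \<Rightarrow> 'f trm \<Rightarrow> ('f, 'a) alg \<Rightarrow> 'a \<Rightarrow> 'a \<Rightarrow> 'a" where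
  "pow_op d P A x y = p_op d P A x y y"

definition prod_alg :: "('f, 'a) alg list \<Rightarrow> ('f, 'a list) alg" where
  "prod_alg As =
     \<lparr>univ = {xs. length xs = length As \<and> (\<forall>i<length As. xs ! i \<in> univ (As ! i))},
      interp = (\<lambda>f xss. map (\<lambda>i. interp (As ! i) f (map (\<lambda>xs. xs ! i) xss)) [0..<length As])\<rparr>"

inductive_set Sg :: "'f language \<Rightarrow> ('f, 'a) alg \<Rightarrow> 'a set \<Rightarrow> 'a set"
  for L :: "'f language" and A :: "('f, 'a) alg" and X :: "'a set" where
  gen: "x \<in> X \<Longrightarrow> x \<in> Sg L A X"
| op: "f \<in> syms L \<Longrightarrow> length xs = arity L f \<Longrightarrow> (\<And>x. x \<in> set xs \<Longrightarrow> x \<in> Sg L A X) \<Longrightarrow>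
       interp A f xs \<in> Sg L A X"


section \<open>Standardized representations\<close>

text \<open>Coordinates are numbered from 1, so coordinate \<open>i\<close> of a tuple \<open>b\<close> is \<open>b ! (i - 1)\<close>.\<close>

definition proj :: "nat set \<Rightarrow> 'a list \<Rightarrow> 'a list" where
  "proj I b = map (\<lambda>i. b ! (i - 1)) (sorted_list_of_set I)"

definition witnesses_fork :: "nat \<Rightarrow> 'a list \<times> 'a list \<Rightarrow> 'a \<times> 'a \<Rightarrow> bool" where
  "witnesses_fork i w g \<longleftrightarrow>
     take (i - 1) (fst w) = take (i - 1) (snd w) \<and>
     fst w ! (i - 1) = fst g \<and> snd w ! (i - 1) = snd g"

definition fork :: "nat \<Rightarrow> 'a list set \<Rightarrow> ('a \<times> 'a) set" where
  "fork i B = {g. \<exists>b\<in>B. \<exists>b'\<in>B. witnesses_fork i (b, b') g}"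

definition fork' ::
  "nat \<Rightarrow> 'f trm \<Rightarrow> ('f, 'a) alg list \<Rightarrow> nat \<Rightarrow> 'a list set \<Rightarrow> ('a \<times> 'a) set" where
  "fork' d P As i B = {(\<gamma>, pow_op d P (As ! (i - 1)) \<delta> \<gamma>) | \<gamma> \<delta>. (\<gamma>, \<delta>) \<in> fork i B}"

definition local_indices :: "nat \<Rightarrow> nat \<Rightarrow> 'a list set \<Rightarrow> (nat set \<times> 'a list) set" where
  "local_indices d n B = {(I, c). I \<subseteq> {1..n} \<and> card I = d - 1 \<and> c \<in> proj I ` B}"

definition fork_indices :: "nat \<Rightarrow> nat \<Rightarrow> (nat \<Rightarrow> ('a \<times> 'a) set) \<Rightarrow> (nat \<times> 'a \<times> 'a) set" where
  "fork_indices d n F = {(m, \<gamma>, \<delta>). d \<le> m \<and> m \<le> n \<and> (\<gamma>, \<delta>) \<in> F m}"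

definition standardized_rep ::
  "nat \<Rightarrow> 'f trm \<Rightarrow> ('f, 'a) alg list \<Rightarrow> 'a list set \<Rightarrow> 'a list set \<Rightarrow>
   (nat set \<times> 'a list \<Rightarrow> 'a list) \<Rightarrow> (nat \<Rightarrow> ('a \<times> 'a) set) \<Rightarrow>
   (nat \<times> 'a \<times> 'a \<Rightarrow> 'a list \<times> 'a list) \<Rightarrow> bool" where
  "standardized_rep d P As B R r F u \<longleftrightarrow>
     R \<subseteq> B \<and>
     (\<forall>(I, c)\<in>local_indices d (length As) B. r (I, c) \<in> R \<and> proj I (r (I, c)) = c) \<and>
     (\<forall>m. d \<le> m \<and> m \<le> length As \<longrightarrow> fork' d P As m B \<subseteq> F m \<and> F m \<subseteq> fork m R) \<and>
     (\<forall>(m, g)\<in>fork_indices d (length As) F. u (m, g) \<in> R \<times> R \<and> witnesses_fork m (u (m, g)) g) \<and>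
     (\<forall>e\<in>R. (\<exists>l\<in>local_indices d (length As) B. e = r l) \<or>
            (\<exists>h\<in>fork_indices d (length As) F. e = fst (u h) \<or> e = snd (u h)))"


section \<open>Oracle algorithms and polynomial time\<close>

text \<open>Algorithms are deterministic while programs over binary trees. The size of every tree that is
  read, built, sent to the oracle or received from the oracle is charged to the running time, so
  trees of superpolynomial size cannot be produced in polynomial time by sharing, and polynomial
  time means the same as for (oracle) Turing machines.\<close>

datatype val = Leaf | Node val val

fun vsize :: "val \<Rightarrow> nat" where
  "vsize Leaf = 1"
| "vsize (Node a b) = vsize a + vsize b + 1"

fun left :: "val \<Rightarrow> val" where
  "left Leaf = Leaf"
| "left (Node a b) = a"

fun right :: "val \<Rightarrow> val" where
  "right Leaf = Leaf"
| "right (Node a b) = b"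

fun enc_bool :: "bool \<Rightarrow> val" where
  "enc_bool False = Leaf"
| "enc_bool True = Node Leaf Leaf"

fun enc_list :: "val list \<Rightarrow> val" where
  "enc_list [] = Leaf"
| "enc_list (x # xs) = Node x (enc_list xs)"

text \<open>Natural numbers are encoded in unary; they only occur as coordinate numbers.\<close>

definition enc_nat :: "nat \<Rightarrow> val" where
  "enc_nat n = enc_list (replicate n Leaf)"

type_synonym state = "nat \<Rightarrow> val"

datatype exp = EVar nat | ELeaf | ENode exp exp | ELeft exp | ERight exp | EEq exp exp

fun aval :: "exp \<Rightarrow> state \<Rightarrow> val" where
  "aval (EVar x) s = s x"
| "aval ELeaf s = Leaf"
| "aval (ENode e1 e2) s = Node (aval e1 s) (aval e2 s)"
| "aval (ELeft e) s = left (aval e s)"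
| "aval (ERight e) s = right (aval e s)"
| "aval (EEq e1 e2) s = enc_bool (aval e1 s = aval e2 s)"

fun acost :: "exp \<Rightarrow> state \<Rightarrow> nat" where
  "acost (EVar x) s = vsize (s x)"
| "acost ELeaf s = 1"
| "acost (ENode e1 e2) s = acost e1 s + acost e2 s + 1"
| "acost (ELeft e) s = acost e s + 1"
| "acost (ERight e) s = acost e s + 1"
| "acost (EEq e1 e2) s = acost e1 s + acost e2 s + 1"

datatype com =
    Skip
  | Assign nat exp
  | Query nat exp
  | Seq com com
  | If exp com com
  | While exp com

text \<open>\<open>exec f c s t qs s'\<close>: started in state \<open>s\<close> with oracle \<open>f\<close>, the program \<open>c\<close> halts in state \<open>s'\<close>
  after time \<open>t\<close>, and \<open>qs\<close> is the list of the oracle queries it made.\<close>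

inductive exec :: "(val \<Rightarrow> val) \<Rightarrow> com \<Rightarrow> state \<Rightarrow> nat \<Rightarrow> val list \<Rightarrow> state \<Rightarrow> bool"
  for f :: "val \<Rightarrow> val" where
  Skip: "exec f Skip s 1 [] s"
| Assign: "exec f (Assign x e) s (acost e s + 1) [] (s(x := aval e s))"
| Query: "exec f (Query x e) s (acost e s + vsize (f (aval e s)) + 1) [aval e s]
            (s(x := f (aval e s)))"
| Seq: "exec f c1 s t1 qs1 s1 \<Longrightarrow> exec f c2 s1 t2 qs2 s2 \<Longrightarrow>
        exec f (Seq c1 c2) s (t1 + t2 + 1) (qs1 @ qs2) s2"
| IfTrue: "aval e s \<noteq> Leaf \<Longrightarrow> exec f c1 s t qs s' \<Longrightarrow>
        exec f (If e c1 c2) s (acost e s + t + 1) qs s'"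
| IfFalse: "aval e s = Leaf \<Longrightarrow> exec f c2 s t qs s' \<Longrightarrow>
        exec f (If e c1 c2) s (acost e s + t + 1) qs s'"
| WhileFalse: "aval e s = Leaf \<Longrightarrow> exec f (While e c) s (acost e s + 1) [] s"
| WhileTrue: "aval e s \<noteq> Leaf \<Longrightarrow> exec f c s t1 qs1 s1 \<Longrightarrow> exec f (While e c) s1 t2 qs2 s2 \<Longrightarrow>
        exec f (While e c) s (acost e s + t1 + t2 + 1) (qs1 @ qs2) s2"

record problem =
  instances :: "val set"
  solutions :: "val \<Rightarrow> val set"

text \<open>An oracle for a problem may return any solution, and is unconstrained off the instances.\<close>

definition solves :: "(val \<Rightarrow> val) \<Rightarrow> problem \<Rightarrow> bool" where
  "solves f Q \<longleftrightarrow> (\<forall>x\<in>instances Q. f x \<in> solutions Q x)"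

text \<open>Input and output are held in variable 0. \<open>C\<close> is the set of admissible numbers of oracle calls.\<close>

definition poly_time_solvable_with_calls :: "nat set \<Rightarrow> problem \<Rightarrow> problem \<Rightarrow> bool" where
  "poly_time_solvable_with_calls C S Q \<longleftrightarrow> (\<exists>(c :: com) (q :: nat poly).
     \<forall>f. solves f Q \<longrightarrow> (\<forall>x\<in>instances S. \<exists>t qs s'.
       exec f c ((\<lambda>_. Leaf)(0 := x)) t qs s' \<and>
       s' 0 \<in> solutions S x \<and>
       t \<le> poly q (vsize x) \<and>
       set qs \<subseteq> instances Q \<and>
       length qs \<in> C))"

abbreviation poly_time_reducible :: "problem \<Rightarrow> problem \<Rightarrow> bool" where
  "poly_time_reducible S Q \<equiv> poly_time_solvable_with_calls UNIV S Q"


section \<open>The two problems\<close>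

text \<open>Since \<open>K\<close> is a fixed finite set of finite algebras, its members and their elements are encoded
  by arbitrary fixed codes \<open>ca\<close> and \<open>ce\<close>.\<close>

definition enc_tuple :: "('a \<Rightarrow> val) \<Rightarrow> 'a list \<Rightarrow> val" where
  "enc_tuple ce xs = enc_list (map ce xs)"

definition enc_gens ::
  "(('f, 'a) alg \<Rightarrow> val) \<Rightarrow> ('a \<Rightarrow> val) \<Rightarrow> ('f, 'a) alg list \<Rightarrow> 'a list list \<Rightarrow> val" where
  "enc_gens ca ce As as = Node (enc_list (map ca As)) (enc_list (map (enc_tuple ce) as))"

definition valid_gens :: "('f, 'a) alg set \<Rightarrow> ('f, 'a) alg list \<Rightarrow> 'a list list \<Rightarrow> bool" where
  "valid_gens K As as \<longleftrightarrow>
     As \<noteq> [] \<and> set As \<subseteq> K \<and> as \<noteq> [] \<and> set as \<subseteq> univ (prod_alg As)"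

definition SMP_from ::
  "nat \<Rightarrow> 'f language \<Rightarrow> ('f, 'a) alg set \<Rightarrow> (('f, 'a) alg \<Rightarrow> val) \<Rightarrow> ('a \<Rightarrow> val) \<Rightarrow> problem" where
  "SMP_from n0 L K ca ce =
     \<lparr>instances = {Node (enc_gens ca ce As as) (enc_tuple ce b) | As as b.
        valid_gens K As as \<and> b \<in> univ (prod_alg As) \<and> n0 \<le> length As},
      solutions = (\<lambda>x. {enc_bool (b \<in> Sg L (prod_alg As) (set as)) | As as b.
        x = Node (enc_gens ca ce As as) (enc_tuple ce b) \<and>
        valid_gens K As as \<and> b \<in> univ (prod_alg As) \<and> n0 \<le> length As})\<rparr>"

abbreviation SMP ::
  "'f language \<Rightarrow> ('f, 'a) alg set \<Rightarrow> (('f, 'a) alg \<Rightarrow> val) \<Rightarrow> ('a \<Rightarrow> val) \<Rightarrow> problem" where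
  "SMP \<equiv> SMP_from 1"

text \<open>A standardized representation is written down as the two lists (in any order, without
  repetition) of its designations; \<open>R\<close> is the set of all designated elements.\<close>

definition encodes_rep ::
  "('a \<Rightarrow> val) \<Rightarrow> nat \<Rightarrow> nat \<Rightarrow> 'a list set \<Rightarrow> (nat set \<times> 'a list \<Rightarrow> 'a list) \<Rightarrow>
   (nat \<Rightarrow> ('a \<times> 'a) set) \<Rightarrow> (nat \<times> 'a \<times> 'a \<Rightarrow> 'a list \<times> 'a list) \<Rightarrow> val \<Rightarrow> bool" where
  "encodes_rep ce d n B r F u v \<longleftrightarrow> (\<exists>ls fs.
     distinct ls \<and> set ls = local_indices d n B \<and>
     distinct fs \<and> set fs = fork_indices d n F \<and>
     v = Node
       (enc_list (map (\<lambda>(I, c). enc_list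
          [enc_list (map enc_nat (sorted_list_of_set I)), enc_tuple ce c, enc_tuple ce (r (I, c))]) ls))
       (enc_list (map (\<lambda>(m, \<gamma>, \<delta>). enc_list
          [enc_nat m, ce \<gamma>, ce \<delta>,
           enc_tuple ce (fst (u (m, \<gamma>, \<delta>))), enc_tuple ce (snd (u (m, \<gamma>, \<delta>)))]) fs)))"

definition CompactRep ::
  "nat \<Rightarrow> 'f trm \<Rightarrow> 'f language \<Rightarrow> ('f, 'a) alg set \<Rightarrow> (('f, 'a) alg \<Rightarrow> val) \<Rightarrow> ('a \<Rightarrow> val) \<Rightarrow>
   problem" where
  "CompactRep d P L K ca ce =
     \<lparr>instances = {enc_gens ca ce As as | As as. valid_gens K As as \<and> d \<le> length As},
      solutions = (\<lambda>x. {v. \<exists>As as R r F u.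
        x = enc_gens ca ce As as \<and> valid_gens K As as \<and> d \<le> length As \<and>
        standardized_rep d P As (Sg L (prod_alg As) (set as)) R r F u \<and>
        encodes_rep ce d (length As) (Sg L (prod_alg As) (set as)) r F u v})\<rparr>"

end

theory Submission imports Defs begin

text \<open>Polynomial-time functions are closed under pairing, case distinction and iteration along lists
  with a bound on the size of the intermediate results, so algorithms can be written as list
  functions.

  To decide \<open>b \<in> B\<close> from a standardized representation, one builds for \<open>m = d, \<dots>, n\<close> an element
  of \<open>B\<close> that agrees with \<open>b\<close> on the first \<open>m\<close> coordinates. Suppose that \<open>c \<in> B\<close> agrees with \<open>b\<close>
  on the coordinates before \<open>m\<close>, and let \<open>v\<^sub>2, \<dots>, v\<^sub>d \<in> B\<close> agree with \<open>b\<close> on \<open>I\<close> and \<open>m\<close>, where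
  \<open>v\<^sub>j\<close> may differ from \<open>b\<close> in the coordinate \<open>i\<^sub>j \<in> I\<close>. With \<open>\<gamma>\<close>, \<open>\<delta>\<close> the entries of \<open>c\<close>, \<open>b\<close>
  at \<open>m\<close>, let \<open>(u, u')\<close> be the designated witnesses of the fork \<open>(\<delta>, \<gamma>\<^sup>\<delta>)\<close>. Writing
  \<open>q(x) = P(x, v\<^sub>2, v\<^sub>2, x, v\<^sub>2, \<dots>, v\<^sub>d)\<close>, the element
  \<open>P(q(q(c)), p(u', u, v\<^sub>2), v\<^sub>2, c, v\<^sub>2, \<dots>, v\<^sub>d)\<close> agrees with \<open>b\<close> on \<open>I\<close> and \<open>m\<close>.
  It suffices to run through the polynomially many sets \<open>I\<close> that consist of \<open>d - 2\<close> arbitrary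
  coordinates and an interval ending before \<open>m\<close>; inputs with few coordinates are padded by
  repeating the first one.

  Conversely, membership queries on projections extend a partial tuple coordinate by coordinate to
  an element of \<open>B\<close>. If \<open>r \<in> B\<close> has entry \<open>\<gamma>\<close> at \<open>m\<close> and \<open>(b, b')\<close> witnesses a fork \<open>(\<gamma>, \<delta>)\<close>,
  then \<open>p(b', b, r)\<close> agrees with \<open>r\<close> before \<open>m\<close> and has entry \<open>\<delta>\<^sup>\<gamma>\<close> at \<open>m\<close>; so it is enough to
  record, for one such \<open>r\<close> per \<open>\<gamma>\<close>, all possible entries at \<open>m\<close> after the prefix of \<open>r\<close>.\<close>

section \<open>Programs with resource bounds\<close>

fun shift_exp :: "nat \<Rightarrow> exp \<Rightarrow> exp" where
  "shift_exp k (EVar x) = EVar (x + k)"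
| "shift_exp k ELeaf = ELeaf"
| "shift_exp k (ENode a b) = ENode (shift_exp k a) (shift_exp k b)"
| "shift_exp k (ELeft a) = ELeft (shift_exp k a)"
| "shift_exp k (ERight a) = ERight (shift_exp k a)"
| "shift_exp k (EEq a b) = EEq (shift_exp k a) (shift_exp k b)"

fun shift :: "nat \<Rightarrow> com \<Rightarrow> com" where
  "shift k Skip = Skip"
| "shift k (Assign x e) = Assign (x + k) (shift_exp k e)"
| "shift k (Query x e) = Query (x + k) (shift_exp k e)"
| "shift k (Seq c1 c2) = Seq (shift k c1) (shift k c2)"
| "shift k (If e c1 c2) = If (shift_exp k e) (shift k c1) (shift k c2)"
| "shift k (While e c) = While (shift_exp k e) (shift k c)"

definition merge_state :: "nat \<Rightarrow> state \<Rightarrow> state \<Rightarrow> state" where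
  "merge_state k s0 s = (\<lambda>v. if v < k then s0 v else s (v - k))"

lemma aval_shift [simp]: "aval (shift_exp k e) (merge_state k s0 s) = aval e s"
  by (induction e) (auto simp: merge_state_def)

lemma acost_shift [simp]: "acost (shift_exp k e) (merge_state k s0 s) = acost e s"
  by (induction e) (auto simp: merge_state_def)

lemma merge_state_upd [simp]:
  "(merge_state k s0 s)(x + k := v) = merge_state k s0 (s(x := v))"
  by (auto simp: merge_state_def fun_eq_iff)

lemma exec_shift:
  "exec f c s t qs s' \<Longrightarrow> exec f (shift k c) (merge_state k s0 s) t qs (merge_state k s0 s')"
proof (induction rule: exec.induct)
  case (Assign x e s)
  show ?case using exec.Assign[of f "x + k" "shift_exp k e" "merge_state k s0 s"]
    by (simp del: fun_upd_apply)
next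
  case (Query x e s)
  show ?case using exec.Query[of f "x + k" "shift_exp k e" "merge_state k s0 s"]
    by (simp del: fun_upd_apply)
next
  case (IfTrue e s c1 t qs s' c2)
  then show ?case using exec.IfTrue[of "shift_exp k e" "merge_state k s0 s" f "shift k c1"] by simp
next
  case (IfFalse e s c2 t qs s' c1)
  then show ?case using exec.IfFalse[of "shift_exp k e" "merge_state k s0 s" f "shift k c2"] by simp
next
  case (WhileFalse e s c)
  then show ?case
    using exec.WhileFalse[of "shift_exp k e" "merge_state k s0 s" f "shift k c"] by simp
next
  case (WhileTrue e s c t1 qs1 s1 t2 qs2 s2)
  then show ?case
    using exec.WhileTrue[of "shift_exp k e" "merge_state k s0 s" f "shift k c"] by simp
next
  case (Skip s)
  show ?case using exec.Skip by simp
next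
  case (Seq c1 s t1 qs1 s1 c2 t2 qs2 s2)
  then show ?case using exec.Seq by simp
qed

definition exec_within ::
  "(val \<Rightarrow> val) \<Rightarrow> val set \<Rightarrow> com \<Rightarrow> state \<Rightarrow> nat \<Rightarrow> (state \<Rightarrow> bool) \<Rightarrow> bool" where
  "exec_within f X c s n R \<longleftrightarrow> (\<exists>t qs s'. exec f c s t qs s' \<and> t \<le> n \<and> set qs \<subseteq> X \<and> R s')"

lemma exec_withinI:
  "exec f c s t qs s' \<Longrightarrow> t \<le> n \<Longrightarrow> set qs \<subseteq> X \<Longrightarrow> R s' \<Longrightarrow> exec_within f X c s n R"
  unfolding exec_within_def by blast

lemma exec_withinE:
  assumes "exec_within f X c s n R"
  obtains t qs s' where "exec f c s t qs s'" "t \<le> n" "set qs \<subseteq> X" "R s'"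
  using assms unfolding exec_within_def by blast

lemma exec_within_mono:
  "exec_within f X c s n R \<Longrightarrow> n \<le> n' \<Longrightarrow> (\<And>s'. R s' \<Longrightarrow> R' s') \<Longrightarrow> exec_within f X c s n' R'"
  unfolding exec_within_def using le_trans by metis

lemma exec_within_Assign:
  "acost e s + 1 \<le> n \<Longrightarrow> R (s(x := aval e s)) \<Longrightarrow> exec_within f X (Assign x e) s n R"
  by (rule exec_withinI[OF exec.Assign]) auto

lemma exec_within_Query:
  "acost e s + vsize (f (aval e s)) + 1 \<le> n \<Longrightarrow> aval e s \<in> X \<Longrightarrow> R (s(x := f (aval e s))) \<Longrightarrow>
   exec_within f X (Query x e) s n R"
  by (rule exec_withinI[OF exec.Query]) auto

lemma exec_within_Seq:
  assumes "exec_within f X c1 s m M" and "\<And>s'. M s' \<Longrightarrow> exec_within f X c2 s' k R"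
    and "m + k + 1 \<le> n"
  shows "exec_within f X (Seq c1 c2) s n R"
proof -
  obtain t1 qs1 s1 where c1: "exec f c1 s t1 qs1 s1" "t1 \<le> m" "set qs1 \<subseteq> X" "M s1"
    by (rule exec_withinE[OF assms(1)])
  obtain t2 qs2 s2 where c2: "exec f c2 s1 t2 qs2 s2" "t2 \<le> k" "set qs2 \<subseteq> X" "R s2"
    by (rule exec_withinE[OF assms(2)[OF c1(4)]])
  show ?thesis
    by (rule exec_withinI[OF exec.Seq[OF c1(1) c2(1)]]) (use c1 c2 assms(3) in auto)
qed

lemma exec_within_If:
  assumes "aval e s \<noteq> Leaf \<Longrightarrow> exec_within f X c1 s m R"
    and "aval e s = Leaf \<Longrightarrow> exec_within f X c2 s m R"
    and "acost e s + m + 1 \<le> n"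
  shows "exec_within f X (If e c1 c2) s n R"
proof (cases "aval e s = Leaf")
  case True
  obtain t qs s' where c2: "exec f c2 s t qs s'" "t \<le> m" "set qs \<subseteq> X" "R s'"
    by (rule exec_withinE[OF assms(2)[OF True]])
  show ?thesis
    by (rule exec_withinI[OF exec.IfFalse[OF True c2(1)]]) (use c2 assms(3) in auto)
next
  case False
  obtain t qs s' where c1: "exec f c1 s t qs s'" "t \<le> m" "set qs \<subseteq> X" "R s'"
    by (rule exec_withinE[OF assms(1)[OF False]])
  show ?thesis
    by (rule exec_withinI[OF exec.IfTrue[OF False c1(1)]]) (use c1 assms(3) in auto)
qed

lemma exec_within_While_Leaf:
  "aval e s = Leaf \<Longrightarrow> acost e s + 1 \<le> n \<Longrightarrow> R s \<Longrightarrow> exec_within f X (While e c) s n R"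
  by (rule exec_withinI[OF exec.WhileFalse]) auto

lemma exec_within_While_step:
  assumes "aval e s \<noteq> Leaf" and "exec_within f X c s m M"
    and "\<And>s'. M s' \<Longrightarrow> exec_within f X (While e c) s' k R"
    and "acost e s + m + k + 1 \<le> n"
  shows "exec_within f X (While e c) s n R"
proof -
  obtain t1 qs1 s1 where body: "exec f c s t1 qs1 s1" "t1 \<le> m" "set qs1 \<subseteq> X" "M s1"
    by (rule exec_withinE[OF assms(2)])
  obtain t2 qs2 s2 where rest: "exec f (While e c) s1 t2 qs2 s2" "t2 \<le> k" "set qs2 \<subseteq> X" "R s2"
    by (rule exec_withinE[OF assms(3)[OF body(4)]])
  show ?thesis
    by (rule exec_withinI[OF exec.WhileTrue[OF assms(1) body(1) rest(1)]])
      (use body rest assms(4) in auto)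
qed

lemma exec_within_shift:
  assumes "exec_within f X c (\<lambda>v. s (v + k)) n R"
  shows "exec_within f X (shift k c) s n (\<lambda>s'. R (\<lambda>v. s' (v + k)) \<and> (\<forall>v<k. s' v = s v))"
proof -
  obtain t qs s' where c: "exec f c (\<lambda>v. s (v + k)) t qs s'" "t \<le> n" "set qs \<subseteq> X" "R s'"
    by (rule exec_withinE[OF assms])
  have "merge_state k s (\<lambda>v. s (v + k)) = s" by (auto simp: merge_state_def)
  then have "exec f (shift k c) s t qs (merge_state k s s')"
    using exec_shift[OF c(1), of k s] by simp
  then show ?thesis by (rule exec_withinI) (use c in \<open>auto simp: merge_state_def\<close>)
qed

lemma vsize_pos: "vsize v > 0"
  by (cases v) auto

lemma vsize_left_le: "vsize (left v) \<le> vsize v" and vsize_right_le: "vsize (right v) \<le> vsize v"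
  by (cases v; simp)+

lemma vsize_enc_bool_le: "vsize (enc_bool b) \<le> 3"
  by (cases b) auto

lemma acost_pos: "acost e s > 0"
  by (induction e) (auto simp: vsize_pos)

lemma vsize_aval_le: "vsize (aval e s) \<le> acost e s"
proof (induction e)
  case (ELeft e)
  then show ?case using vsize_left_le[of "aval e s"] by simp
next
  case (ERight e)
  then show ?case using vsize_right_le[of "aval e s"] by simp
next
  case (EEq e1 e2)
  show ?case
    using vsize_enc_bool_le[of "aval e1 s = aval e2 s"] acost_pos[of e1 s] acost_pos[of e2 s]
    by simp
qed auto

section \<open>Encodings of data types\<close>

class encodable =
  fixes encode :: "'a \<Rightarrow> val"
  assumes encode_inject [simp]: "encode x = encode y \<longleftrightarrow> x = y"

abbreviation esize :: "'a::encodable \<Rightarrow> nat" where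
  "esize x \<equiv> vsize (encode x)"

lemma enc_list_inject [simp]: "enc_list xs = enc_list ys \<longleftrightarrow> xs = ys"
proof (induction xs arbitrary: ys)
  case Nil
  show ?case by (cases ys) auto
next
  case (Cons x xs)
  then show ?case by (cases ys) auto
qed

instantiation val :: encodable
begin

definition encode_val :: "val \<Rightarrow> val" where
  encode_val [simp]: "encode_val v = v"

instance by standard simp

end

instantiation unit :: encodable
begin

definition encode_unit :: "unit \<Rightarrow> val" where
  encode_unit [simp]: "encode_unit u = Leaf"

instance by standard simp

end

instantiation bool :: encodable
begin

definition encode_bool :: "bool \<Rightarrow> val" where
  encode_bool: "encode_bool = enc_bool"

instance
proof
  show "encode a = encode b \<longleftrightarrow> a = b" for a b :: bool
    by (cases a; cases b) (auto simp: encode_bool)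
qed

end

instantiation nat :: encodable
begin

definition encode_nat :: "nat \<Rightarrow> val" where
  encode_nat: "encode_nat = enc_nat"

instance
proof
  show "encode m = encode n \<longleftrightarrow> m = n" for m n :: nat
    by (auto simp: encode_nat enc_nat_def dest: arg_cong[of _ _ length])
qed

end

instantiation prod :: (encodable, encodable) encodable
begin

definition encode_prod :: "'a \<times> 'b \<Rightarrow> val" where
  encode_prod: "encode_prod p = Node (encode (fst p)) (encode (snd p))"

instance by standard (simp add: encode_prod prod_eq_iff)

end

instantiation list :: (encodable) encodable
begin

definition encode_list :: "'a list \<Rightarrow> val" where
  encode_list: "encode_list xs = enc_list (map encode xs)"

instance by standard (simp add: encode_list inj_map_eq_map inj_def)

end

lemma encode_Pair [simp]: "encode (a, b) = Node (encode a) (encode b)"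
  and left_encode [simp]: "left (encode p) = encode (fst p)"
  and right_encode [simp]: "right (encode p) = encode (snd p)"
  by (simp_all add: encode_prod)

lemma encode_Nil [simp]: "encode [] = Leaf"
  and encode_Cons [simp]: "encode (x # xs) = Node (encode x) (encode xs)"
  by (simp_all add: encode_list)

lemma encode_0 [simp]: "encode (0 :: nat) = Leaf"
  and encode_Suc [simp]: "encode (Suc n) = Node Leaf (encode n)"
  by (simp_all add: encode_nat enc_nat_def)

lemma encode_bool_eq_Leaf: "encode b = Leaf \<longleftrightarrow> \<not> b"
  by (cases b) (auto simp: encode_bool)

lemma esize_nat [simp]: "esize (n :: nat) = 2 * n + 1"
  by (induction n) auto

lemma esize_elem_less: "e \<in> set l \<Longrightarrow> esize e < esize l"
  by (induction l) (auto simp: less_Suc_eq trans_less_add1 trans_less_add2)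

lemma length_less_esize: "length l < esize l"
proof (induction l)
  case (Cons a l)
  then show ?case using vsize_pos[of "encode a"] by simp
qed simp

lemma esize_append: "esize (xs @ ys) + 1 = esize xs + esize ys"
  by (induction xs) auto

lemma esize_list_le:
  assumes "\<And>e. e \<in> set l \<Longrightarrow> esize e \<le> m" and "length l \<le> k"
  shows "esize l \<le> k * (m + 1) + 1"
proof -
  have "esize l \<le> length l * (m + 1) + 1" using assms(1)
  proof (induction l)
    case (Cons a l)
    then have "esize a \<le> m" "esize l \<le> length l * (m + 1) + 1" by auto
    then show ?case by simp
  qed simp
  also have "\<dots> \<le> k * (m + 1) + 1" using assms(2) by (intro add_mono mult_le_mono) auto
  finally show ?thesis .
qed

section \<open>Functions computable in polynomial time\<close>

text \<open>Only register 0 is constrained at the start, so that programs can be run one after the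
  other.\<close>

definition computes ::
  "problem \<Rightarrow> 'a::encodable set \<Rightarrow> com \<Rightarrow> ('a \<Rightarrow> nat) \<Rightarrow> ('a \<Rightarrow> 'b::encodable) \<Rightarrow> bool" where
  "computes Q D c T g \<longleftrightarrow> (\<forall>f s x. solves f Q \<longrightarrow> x \<in> D \<longrightarrow> s 0 = encode x \<longrightarrow>
     exec_within f (instances Q) c s (T x) (\<lambda>s'. s' 0 = encode (g x)))"

lemma computesI:
  "(\<And>f s x. solves f Q \<Longrightarrow> x \<in> D \<Longrightarrow> s 0 = encode x \<Longrightarrow>
     exec_within f (instances Q) c s (T x) (\<lambda>s'. s' 0 = encode (g x))) \<Longrightarrow> computes Q D c T g"
  unfolding computes_def by blast

lemma computesD:
  "computes Q D c T g \<Longrightarrow> solves f Q \<Longrightarrow> x \<in> D \<Longrightarrow> s 0 = encode x \<Longrightarrow>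
   exec_within f (instances Q) c s (T x) (\<lambda>s'. s' 0 = encode (g x))"
  unfolding computes_def by blast

lemma computes_subset: "computes Q D c T g \<Longrightarrow> D' \<subseteq> D \<Longrightarrow> computes Q D' c T g"
  unfolding computes_def by blast

definition call :: "nat \<Rightarrow> exp \<Rightarrow> com \<Rightarrow> com" where
  "call k e c = Seq (Assign k e) (shift k c)"

lemma exec_within_call:
  assumes "computes Q D c T g" and "solves f Q" and "aval e s = encode x" and "x \<in> D"
  shows "exec_within f (instances Q) (call k e c) s (acost e s + T x + 2)
    (\<lambda>s'. s' k = encode (g x) \<and> (\<forall>v<k. s' v = s v))"
  unfolding call_def
proof (rule exec_within_Seq)
  show "exec_within f (instances Q) (Assign k e) s (acost e s + 1) (\<lambda>s'. s' = s(k := encode x))"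
    by (rule exec_within_Assign) (auto simp: assms(3))
  fix s' assume s': "s' = s(k := encode x)"
  have "exec_within f (instances Q) c (\<lambda>v. s' (v + k)) (T x) (\<lambda>s'. s' 0 = encode (g x))"
    using computesD[OF assms(1,2,4)] by (simp add: s')
  from exec_within_shift[OF this]
  show "exec_within f (instances Q) (shift k c) s' (T x)
      (\<lambda>s'. s' k = encode (g x) \<and> (\<forall>v<k. s' v = s v))"
    by (rule exec_within_mono) (auto simp: s')
qed simp

lemma exec_within_call_input:
  assumes "computes Q UNIV c T g" and "solves f Q" and "s 0 = encode x"
  shows "exec_within f (instances Q) (call k (EVar 0) c) s (esize x + T x + 2)
    (\<lambda>s'. s' k = encode (g x) \<and> (\<forall>v<k. s' v = s v))"
  using exec_within_call[OF assms(1,2), of "EVar 0" s x k] assms(3) by simp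

lemma poly_nat_mono: "a \<le> b \<Longrightarrow> poly (q :: nat poly) a \<le> poly q b"
  by (induction q) (auto intro!: mult_le_mono)

definition poly_bounded :: "('a::encodable \<Rightarrow> nat) \<Rightarrow> bool" where
  "poly_bounded B \<longleftrightarrow> (\<exists>q :: nat poly. \<forall>x. B x \<le> poly q (esize x))"

named_theorems poly_bounded_intros

lemma poly_bounded_le: "poly_bounded B \<Longrightarrow> (\<And>x. A x \<le> B x) \<Longrightarrow> poly_bounded A"
  unfolding poly_bounded_def using le_trans by metis

lemma poly_bounded_const [poly_bounded_intros]: "poly_bounded (\<lambda>x. n)"
  unfolding poly_bounded_def by (rule exI[of _ "[:n:]"]) auto

lemma poly_bounded_esize [poly_bounded_intros]: "poly_bounded (\<lambda>x. esize x)"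
  unfolding poly_bounded_def by (rule exI[of _ "[:0, 1:]"]) auto

lemma poly_bounded_add [poly_bounded_intros]:
  "poly_bounded A \<Longrightarrow> poly_bounded B \<Longrightarrow> poly_bounded (\<lambda>x. A x + B x)"
  unfolding poly_bounded_def by (metis add_le_mono poly_add)

lemma poly_bounded_mult [poly_bounded_intros]:
  "poly_bounded A \<Longrightarrow> poly_bounded B \<Longrightarrow> poly_bounded (\<lambda>x. A x * B x)"
  unfolding poly_bounded_def by (metis mult_le_mono poly_mult)

lemma poly_bounded_Suc [poly_bounded_intros]: "poly_bounded B \<Longrightarrow> poly_bounded (\<lambda>x. Suc (B x))"
  using poly_bounded_add[OF _ poly_bounded_const[of 1]] by simp

lemma poly_bounded_power [poly_bounded_intros]: "poly_bounded B \<Longrightarrow> poly_bounded (\<lambda>x. B x ^ k)"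
  by (induction k) (auto intro: poly_bounded_intros)

lemma poly_bounded_poly [poly_bounded_intros]:
  "poly_bounded B \<Longrightarrow> poly_bounded (\<lambda>x. poly q (B x))"
  unfolding poly_bounded_def by (metis poly_nat_mono poly_pcompose)

lemma poly_bounded_comp:
  assumes "poly_bounded B" and "poly_bounded (\<lambda>x. esize (g x))"
  shows "poly_bounded (\<lambda>x. B (g x))"
proof -
  obtain q where "\<And>y. B y \<le> poly q (esize y)" using assms(1) by (auto simp: poly_bounded_def)
  then show ?thesis by (intro poly_bounded_le[OF poly_bounded_poly[OF assms(2)]])
qed

text \<open>The size bound does not follow from the existence of the program, since a problem may have no
  solving oracle at all.\<close>

definition poly_time :: "problem \<Rightarrow> ('a::encodable \<Rightarrow> 'b::encodable) \<Rightarrow> bool" where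
  "poly_time Q g \<longleftrightarrow> (\<exists>c q. computes Q UNIV c (\<lambda>x. poly q (esize x)) g) \<and>
     poly_bounded (\<lambda>x. esize (g x))"

lemma poly_timeI:
  assumes "computes Q UNIV c T g" and "poly_bounded T" and "poly_bounded (\<lambda>x. esize (g x))"
  shows "poly_time Q g"
proof -
  obtain q where "\<And>x. T x \<le> poly q (esize x)" using assms(2) by (auto simp: poly_bounded_def)
  then have "computes Q UNIV c (\<lambda>x. poly q (esize x)) g"
    by (intro computesI exec_within_mono[OF computesD[OF assms(1)]])
  then show ?thesis using assms(3) unfolding poly_time_def by blast
qed

lemma poly_timeE:
  assumes "poly_time Q g"
  obtains c q where "computes Q UNIV c (\<lambda>x. poly q (esize x)) g"
  using assms unfolding poly_time_def by blast

lemma poly_bounded_poly_time: "poly_time Q g \<Longrightarrow> poly_bounded (\<lambda>x. esize (g x))"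
  unfolding poly_time_def by blast

named_theorems poly_time_intros

lemma poly_time_exp:
  assumes "\<And>s x. s 0 = encode x \<Longrightarrow> aval e s = encode (g x) \<and> acost e s \<le> T x"
    and "poly_bounded T"
  shows "poly_time Q g"
proof (rule poly_timeI)
  show "computes Q UNIV (Assign 0 e) (\<lambda>x. T x + 1) g"
    by (intro computesI exec_within_Assign) (use assms in auto)
  show "poly_bounded (\<lambda>x. T x + 1)" by (intro poly_bounded_intros assms)
  have "esize (g x) \<le> T x" for x
    using vsize_aval_le[of e "\<lambda>_. encode x"] assms(1)[of "\<lambda>_. encode x" x] by simp
  then show "poly_bounded (\<lambda>x. esize (g x))" by (rule poly_bounded_le[OF assms(2)])
qed

lemma poly_time_id [poly_time_intros]: "poly_time Q (\<lambda>x. x)"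
  by (rule poly_time_exp[of "EVar 0"]) (auto intro: poly_bounded_intros)

lemma poly_time_const [poly_time_intros]: "poly_time Q (\<lambda>x. y)"
proof -
  have "\<exists>e. \<forall>s. aval e s = v \<and> acost e s \<le> vsize v" for v
  proof (induction v)
    case Leaf
    show ?case by (rule exI[of _ ELeaf]) auto
  next
    case (Node v1 v2)
    then obtain e1 e2 where "\<forall>s. aval e1 s = v1 \<and> acost e1 s \<le> vsize v1"
      "\<forall>s. aval e2 s = v2 \<and> acost e2 s \<le> vsize v2" by auto
    then show ?case by (intro exI[of _ "ENode e1 e2"]) (auto intro: add_le_mono)
  qed
  then obtain e where "\<And>s. aval e s = encode y \<and> acost e s \<le> esize y" by blast
  then show ?thesis by (intro poly_time_exp[of e _ "\<lambda>_. esize y"] poly_bounded_const)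
qed

lemma poly_time_same_encoding:
  assumes "poly_time Q g" and "\<And>x. encode (h x) = encode (g x)"
  shows "poly_time Q h"
  using assms unfolding poly_time_def computes_def by simp

lemma poly_time_comp:
  fixes g :: "'a::encodable \<Rightarrow> 'b::encodable" and h :: "'b \<Rightarrow> 'c::encodable"
  assumes "poly_time Q g" and "poly_time Q h"
  shows "poly_time Q (\<lambda>x. h (g x))"
proof -
  note size = assms[THEN poly_bounded_poly_time]
  obtain c1 q1 where c1: "computes Q UNIV c1 (\<lambda>x. poly q1 (esize x)) g"
    by (rule poly_timeE[OF assms(1)])
  obtain c2 q2 where c2: "computes Q UNIV c2 (\<lambda>y. poly q2 (esize y)) h"
    by (rule poly_timeE[OF assms(2)])
  let ?T = "\<lambda>x. poly q1 (esize x) + poly q2 (esize (g x)) + 1"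
  have "computes Q UNIV (Seq c1 c2) ?T (\<lambda>x. h (g x))"
  proof (rule computesI)
    fix f and s :: state and x :: 'a assume f: "solves f Q" and s: "s 0 = encode x"
    show "exec_within f (instances Q) (Seq c1 c2) s (?T x) (\<lambda>s'. s' 0 = encode (h (g x)))"
      by (rule exec_within_Seq[OF computesD[OF c1 f, of x s] computesD[OF c2 f, of "g x"]])
        (simp_all add: s)
  qed
  moreover have "poly_bounded ?T" by (intro poly_bounded_intros size)
  moreover have "poly_bounded (\<lambda>x. esize (h (g x)))"
    by (rule poly_bounded_comp[OF size(2) size(1)])
  ultimately show ?thesis by (rule poly_timeI)
qed

lemma poly_time_fst [poly_time_intros]: "poly_time Q g \<Longrightarrow> poly_time Q (\<lambda>x. fst (g x))"
  by (rule poly_time_comp[of _ g fst], assumption,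
      rule poly_time_exp[of "ELeft (EVar 0)" _ "\<lambda>x. esize x + 1"])
     (auto intro!: poly_bounded_intros)

lemma poly_time_snd [poly_time_intros]: "poly_time Q g \<Longrightarrow> poly_time Q (\<lambda>x. snd (g x))"
  by (rule poly_time_comp[of _ g snd], assumption,
      rule poly_time_exp[of "ERight (EVar 0)" _ "\<lambda>x. esize x + 1"])
     (auto intro!: poly_bounded_intros)

lemma poly_time_Pair [poly_time_intros]:
  fixes g :: "'a::encodable \<Rightarrow> 'b::encodable" and h :: "'a \<Rightarrow> 'c::encodable"
  assumes "poly_time Q g" and "poly_time Q h"
  shows "poly_time Q (\<lambda>x. (g x, h x))"
proof -
  note size = assms[THEN poly_bounded_poly_time]
  obtain c1 q1 where c1: "computes Q UNIV c1 (\<lambda>x. poly q1 (esize x)) g"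
    by (rule poly_timeE[OF assms(1)])
  obtain c2 q2 where c2: "computes Q UNIV c2 (\<lambda>x. poly q2 (esize x)) h"
    by (rule poly_timeE[OF assms(2)])
  let ?c = "Seq (call 1 (EVar 0) c1)
      (Seq (call 2 (EVar 0) c2) (Assign 0 (ENode (EVar 1) (EVar 2))))"
  let ?T = "\<lambda>x. 2 * esize x + poly q1 (esize x) + poly q2 (esize x) + esize (g x) + esize (h x) + 8"
  have "computes Q UNIV ?c ?T (\<lambda>x. (g x, h x))"
  proof (rule computesI)
    fix f and s :: state and x :: 'a assume f: "solves f Q" and s: "s 0 = encode x"
    show "exec_within f (instances Q) ?c s (?T x) (\<lambda>s'. s' 0 = encode (g x, h x))"
      by (rule exec_within_Seq[OF exec_within_call_input[OF c1 f, of s x 1, OF s]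
            exec_within_Seq[OF exec_within_call_input[OF c2 f, of _ x 2] exec_within_Assign]])
        (use s in auto)
  qed
  moreover have "poly_bounded ?T" by (intro poly_bounded_intros size)
  moreover have "poly_bounded (\<lambda>x. esize (g x, h x))"
    by (auto intro!: poly_bounded_intros size)
  ultimately show ?thesis by (rule poly_timeI)
qed

lemma poly_time_eq [poly_time_intros]:
  fixes g h :: "'a::encodable \<Rightarrow> 'b::encodable"
  assumes "poly_time Q g" and "poly_time Q h"
  shows "poly_time Q (\<lambda>x. g x = h x)"
proof -
  have "poly_time Q (\<lambda>z :: 'b \<times> 'b. fst z = snd z)"
    by (rule poly_time_exp[of "EEq (ELeft (EVar 0)) (ERight (EVar 0))" _ "\<lambda>x. 2 * esize x + 3"])
      (auto simp: encode_bool intro!: poly_bounded_intros)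
  from poly_time_comp[OF poly_time_Pair[OF assms] this] show ?thesis by simp
qed

lemma computes_If:
  fixes g h :: "'a::encodable \<Rightarrow> 'b::encodable"
  assumes c: "computes Q UNIV c T b"
    and c1: "computes Q {x. b x} c1 T1 g" and c2: "computes Q {x. \<not> b x} c2 T2 h"
  shows "computes Q UNIV (Seq (call 1 (EVar 0) c) (If (EVar 1) c1 c2))
    (\<lambda>x. esize x + T x + T1 x + T2 x + 7) (\<lambda>x. if b x then g x else h x)"
    (is "computes _ _ ?c ?T ?g")
proof (rule computesI)
  fix f and s :: state and x :: 'a assume f: "solves f Q" and s: "s 0 = encode x"
  have branch: "exec_within f (instances Q) (If (EVar 1) c1 c2) s' (T1 x + T2 x + 4)
      (\<lambda>s'. s' 0 = encode (?g x))" if s': "s' 1 = encode (b x)" "s' 0 = encode x" for s'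
  proof (rule exec_within_If[where m = "T1 x + T2 x"])
    assume "aval (EVar 1) s' \<noteq> Leaf"
    then have b: "b x" using s' by (simp add: encode_bool_eq_Leaf)
    show "exec_within f (instances Q) c1 s' (T1 x + T2 x) (\<lambda>s'. s' 0 = encode (?g x))"
      by (rule exec_within_mono[OF computesD[OF c1 f]]) (use b s' in auto)
  next
    assume "aval (EVar 1) s' = Leaf"
    then have b: "\<not> b x" using s' encode_bool_eq_Leaf by (metis aval.simps(1))
    show "exec_within f (instances Q) c2 s' (T1 x + T2 x) (\<lambda>s'. s' 0 = encode (?g x))"
      by (rule exec_within_mono[OF computesD[OF c2 f]]) (use b s' in auto)
  qed (use vsize_enc_bool_le[of "b x"] s' in \<open>simp add: encode_bool\<close>)
  show "exec_within f (instances Q) ?c s (?T x) (\<lambda>s'. s' 0 = encode (?g x))"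
    by (rule exec_within_Seq[OF exec_within_call_input[OF c f, of s x 1, OF s] branch])
      (use s in auto)
qed

lemma poly_time_if [poly_time_intros]:
  assumes "poly_time Q b" and "poly_time Q g" and "poly_time Q h"
  shows "poly_time Q (\<lambda>x. if b x then g x else h x)"
proof -
  note size = assms(2,3)[THEN poly_bounded_poly_time]
  obtain c q where c: "computes Q UNIV c (\<lambda>x. poly q (esize x)) b" by (rule poly_timeE[OF assms(1)])
  obtain c1 q1 where c1: "computes Q UNIV c1 (\<lambda>x. poly q1 (esize x)) g"
    by (rule poly_timeE[OF assms(2)])
  obtain c2 q2 where c2: "computes Q UNIV c2 (\<lambda>x. poly q2 (esize x)) h"
    by (rule poly_timeE[OF assms(3)])
  show ?thesis
  proof (rule poly_timeI[OF computes_If[OF c computes_subset[OF c1 subset_UNIV]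
          computes_subset[OF c2 subset_UNIV]]])
    show "poly_bounded (\<lambda>x. esize x + poly q (esize x) + poly q1 (esize x) + poly q2 (esize x) + 7)"
      by (intro poly_bounded_intros)
    have "poly_bounded (\<lambda>x. esize (g x) + esize (h x))" by (intro poly_bounded_intros size)
    then show "poly_bounded (\<lambda>x. esize (if b x then g x else h x))" by (rule poly_bounded_le) simp
  qed
qed

lemma poly_time_query:
  fixes g :: "'a::encodable \<Rightarrow> 'b::encodable"
  assumes "poly_time Q (\<lambda>x :: 'a. encode x \<in> instances Q)"
    and "\<And>f x. solves f Q \<Longrightarrow> encode x \<in> instances Q \<Longrightarrow> f (encode x) = encode (g x)"
    and "poly_bounded (\<lambda>x. esize (g x))"
  shows "poly_time Q (\<lambda>x. if encode x \<in> instances Q then g x else y)"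
proof -
  obtain c q where c:
    "computes Q UNIV c (\<lambda>x :: 'a. poly q (esize x)) (\<lambda>x :: 'a. encode x \<in> instances Q)"
    by (rule poly_timeE[OF assms(1)])
  have c1: "computes Q {x. encode x \<in> instances Q}
      (Query 0 (EVar 0)) (\<lambda>x. esize x + esize (g x) + 1) g"
    by (intro computesI exec_within_Query) (use assms(2) in auto)
  obtain c2 q2 where c2: "computes Q UNIV c2 (\<lambda>x :: 'a. poly q2 (esize x)) (\<lambda>_. y)"
    by (rule poly_timeE[OF poly_time_const])
  show ?thesis
  proof (rule poly_timeI[OF computes_If[OF c c1 computes_subset[OF c2 subset_UNIV]]])
    show "poly_bounded (\<lambda>x :: 'a. esize x + poly q (esize x) + (esize x + esize (g x) + 1) +
        poly q2 (esize x) + 7)"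
      by (intro poly_bounded_intros assms(3))
    have "poly_bounded (\<lambda>x. esize (g x) + esize y)" by (intro poly_bounded_intros assms(3))
    then show "poly_bounded (\<lambda>x. esize (if encode x \<in> instances Q then g x else y))"
      by (rule poly_bounded_le) simp
  qed
qed

lemma poly_time_conj [poly_time_intros]:
  assumes "poly_time Q p" and "poly_time Q q"
  shows "poly_time Q (\<lambda>x. p x \<and> q x)"
proof -
  have "(\<lambda>x. p x \<and> q x) = (\<lambda>x. if p x then q x else False)" by auto
  then show ?thesis using poly_time_if[OF assms poly_time_const[of _ False]] by simp
qed

lemma poly_time_not [poly_time_intros]:
  assumes "poly_time Q p"
  shows "poly_time Q (\<lambda>x. \<not> p x)"
  using poly_time_eq[OF assms poly_time_const[of _ False]] by simp

lemma poly_time_solvableI: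
  assumes g: "poly_time Q g"
    and sol: "\<And>v. v \<in> instances S \<Longrightarrow> \<exists>x. v = encode x \<and> encode (g x) \<in> solutions S v"
  shows "poly_time_reducible S Q"
proof -
  obtain c q where c: "computes Q UNIV c (\<lambda>x. poly q (esize x)) g" by (rule poly_timeE[OF g])
  show ?thesis unfolding poly_time_solvable_with_calls_def
  proof (intro exI[of _ c] exI[of _ q] allI impI ballI)
    fix f v assume f: "solves f Q" and v: "v \<in> instances S"
    obtain x where x: "v = encode x" "encode (g x) \<in> solutions S v" using sol[OF v] by blast
    have "exec_within f (instances Q) c ((\<lambda>_. Leaf)(0 := v)) (poly q (vsize v))
        (\<lambda>s'. s' 0 = encode (g x))"
      using computesD[OF c f, of x "(\<lambda>_. Leaf)(0 := v)"] x(1) by simp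
    then show "\<exists>t qs s'. exec f c ((\<lambda>_. Leaf)(0 := v)) t qs s' \<and> s' 0 \<in> solutions S v \<and>
        t \<le> poly q (vsize v) \<and> set qs \<subseteq> instances Q \<and> length qs \<in> UNIV"
      using x(2) unfolding exec_within_def by (metis UNIV_I)
  qed
qed

lemma poly_time_solvable_with_calls_mono:
  assumes "poly_time_solvable_with_calls C S Q" and "C \<subseteq> C'" and "instances S' \<subseteq> instances S"
    and "\<And>x. x \<in> instances S' \<Longrightarrow> solutions S x \<subseteq> solutions S' x"
  shows "poly_time_solvable_with_calls C' S' Q"
  using assms unfolding poly_time_solvable_with_calls_def by (meson subsetD)

definition trivial_problem :: problem where
  "trivial_problem = \<lparr>instances = {}, solutions = \<lambda>_. {}\<rparr>"

lemma computes_trivial_problemE: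
  assumes "computes trivial_problem UNIV c T g" and "aval e s = encode x"
  obtains t s' where "exec f (call k e c) s t [] s'" "t \<le> acost e s + T x + 2"
    "s' k = encode (g x)" "\<And>v. v < k \<Longrightarrow> s' v = s v"
proof -
  have "solves f trivial_problem" by (simp add: solves_def trivial_problem_def)
  from exec_within_call[OF assms(1) this assms(2) UNIV_I, of k] show ?thesis
    by (rule exec_withinE) (auto simp: trivial_problem_def intro: that)
qed

abbreviation query_between :: "com \<Rightarrow> com \<Rightarrow> com" where
  "query_between c1 c2 \<equiv>
     Seq (call 1 (EVar 0) c1) (Seq (Query 1 (EVar 1)) (call 0 (ENode (EVar 0) (EVar 1)) c2))"

lemma exec_query_between:
  fixes g :: "'a::encodable \<Rightarrow> 'b::encodable" and h :: "'a \<times> 'c::encodable \<Rightarrow> 'd::encodable"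
  assumes c1: "computes trivial_problem UNIV c1 T1 g"
    and c2: "computes trivial_problem UNIV c2 T2 h"
    and s: "s 0 = encode x" and y: "f (encode (g x)) = encode y"
  obtains t s' where "exec f (query_between c1 c2) s t [encode (g x)] s'" "s' 0 = encode (h (x, y))"
    "t \<le> 2 * esize x + T1 x + esize (g x) + 2 * esize y + T2 (x, y) + 8"
proof -
  obtain t1 s1 where run1: "exec f (call 1 (EVar 0) c1) s t1 [] s1"
    and t1: "t1 \<le> esize x + T1 x + 2"
    and s1: "s1 1 = encode (g x)" "s1 0 = encode x"
    by (rule computes_trivial_problemE[OF c1, of "EVar 0" s x f 1]) (auto simp: s)
  have query: "exec f (Query 1 (EVar 1)) s1 (esize (g x) + esize y + 1) [encode (g x)]
      (s1(1 := encode y))"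
    using exec.Query[of f 1 "EVar 1" s1] s1 by (simp add: y)
  let ?e = "ENode (EVar 0) (EVar 1)"
  obtain t2 s2 where run2: "exec f (call 0 ?e c2) (s1(1 := encode y)) t2 [] s2"
    and t2: "t2 \<le> esize x + esize y + 1 + T2 (x, y) + 2" and s2: "s2 0 = encode (h (x, y))"
    by (rule computes_trivial_problemE[OF c2, of ?e "s1(1 := encode y)" "(x, y)" f 0])
      (use s1 in auto)
  show ?thesis
    by (rule that[of "t1 + (esize (g x) + esize y + 1 + t2 + 1) + 1" s2])
      (use exec.Seq[OF run1 exec.Seq[OF query run2]] s2 t1 t2 in simp_all)
qed

lemma poly_time_solvable_with_one_call:
  fixes pre :: "'a::encodable \<Rightarrow> 'b::encodable" and post :: "'a \<times> 'c::encodable \<Rightarrow> 'd::encodable"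
  assumes pre: "poly_time trivial_problem pre" and post: "poly_time trivial_problem post"
    and inst: "\<And>v. v \<in> instances S \<Longrightarrow> \<exists>x. v = encode x \<and> encode (pre x) \<in> instances Q"
    and sol: "\<And>x v. encode x \<in> instances S \<Longrightarrow> v \<in> solutions Q (encode (pre x)) \<Longrightarrow>
      \<exists>y. v = encode y \<and> encode (post (x, y)) \<in> solutions S (encode x)"
    and size: "\<And>v w. v \<in> instances Q \<Longrightarrow> w \<in> solutions Q v \<Longrightarrow> vsize w \<le> poly b (vsize v)"
  shows "poly_time_solvable_with_calls {1} S Q"
proof -
  obtain c1 q1 where c1: "computes trivial_problem UNIV c1 (\<lambda>x. poly q1 (esize x)) pre"
    by (rule poly_timeE[OF pre])
  obtain c2 q2 where c2: "computes trivial_problem UNIV c2 (\<lambda>x. poly q2 (esize x)) post"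
    by (rule poly_timeE[OF post])
  let ?b = "\<lambda>x. poly b (esize (pre x))"
  let ?T = "\<lambda>x. 2 * esize x + poly q1 (esize x) + esize (pre x) + 2 * ?b x +
    poly q2 (esize x + ?b x + 1) + 8"
  have "poly_bounded ?T" by (intro poly_bounded_intros poly_bounded_poly_time[OF pre])
  then obtain q where q: "\<And>x. ?T x \<le> poly q (esize x)" by (auto simp: poly_bounded_def)
  show ?thesis unfolding poly_time_solvable_with_calls_def
  proof (intro exI[of _ "query_between c1 c2"] exI[of _ q] allI impI ballI)
    fix f v assume f: "solves f Q" and v: "v \<in> instances S"
    obtain x where x: "v = encode x" "encode (pre x) \<in> instances Q" using inst[OF v] by blast
    have answer: "f (encode (pre x)) \<in> solutions Q (encode (pre x))"
      using f x(2) by (simp add: solves_def)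
    obtain y where y: "f (encode (pre x)) = encode y" "encode (post (x, y)) \<in> solutions S v"
      using sol[OF v[unfolded x(1)] answer] x(1) by blast
    obtain t s where run: "exec f (query_between c1 c2) ((\<lambda>_. Leaf)(0 := v)) t [encode (pre x)] s"
      and s: "s 0 = encode (post (x, y))"
      and t: "t \<le> 2 * esize x + poly q1 (esize x) + esize (pre x) + 2 * esize y +
        poly q2 (esize (x, y)) + 8"
      by (rule exec_query_between[OF c1 c2, of "(\<lambda>_. Leaf)(0 := v)" x f y]) (use x(1) y(1) in auto)
    have y_size: "esize y \<le> ?b x" using size[OF x(2) answer] y(1) by simp
    then have "poly q2 (esize (x, y)) \<le> poly q2 (esize x + ?b x + 1)" by (intro poly_nat_mono) simp
    then have "t \<le> poly q (vsize v)" using t y_size q[of x] unfolding x(1) by linarith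
    then show "\<exists>t qs s'. exec f (query_between c1 c2) ((\<lambda>_. Leaf)(0 := v)) t qs s' \<and>
        s' 0 \<in> solutions S v \<and> t \<le> poly q (vsize v) \<and> set qs \<subseteq> instances Q \<and> length qs \<in> {1}"
      using run y(2) s x(2) by (intro exI conjI) (assumption | simp)+
  qed
qed

section \<open>Lists and natural numbers in polynomial time\<close>

definition foldl_body :: "com \<Rightarrow> com" where
  "foldl_body c = Seq (call 3 (ENode (EVar 1) (ENode (ELeft (EVar 2)) (EVar 0))) c)
     (Seq (Assign 1 (EVar 3)) (Assign 2 (ERight (EVar 2))))"

lemma exec_within_foldl_body:
  assumes c: "computes Q UNIV c (\<lambda>z. poly q (esize z)) (\<lambda>z. h (fst z) (fst (snd z)) (snd (snd z)))"
    and f: "solves f Q" and s: "s 0 = encode x" "s 1 = encode a" "s 2 = encode (e # l)"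
  shows "exec_within f (instances Q) (foldl_body c) s
    (esize x + esize a + 2 * esize (e # l) + esize (h a e x) + poly q (esize (a, e, x)) + 10)
    (\<lambda>s'. s' 0 = encode x \<and> s' 1 = encode (h a e x) \<and> s' 2 = encode l)"
    (is "exec_within _ _ _ _ _ ?R")
proof -
  let ?e = "ENode (EVar 1) (ENode (ELeft (EVar 2)) (EVar 0))"
  have call: "exec_within f (instances Q) (call 3 ?e c) s
      (acost ?e s + poly q (esize (a, e, x)) + 2)
      (\<lambda>s'. s' 3 = encode (h a e x) \<and> (\<forall>v<3. s' v = s v))"
    using exec_within_call[OF c f, of ?e s "(a, e, x)" 3] s by simp
  have update: "exec_within f (instances Q)
      (Seq (Assign 1 (EVar 3)) (Assign 2 (ERight (EVar 2)))) s'
      (esize (h a e x) + esize (e # l) + 4) ?R"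
    if "s' 3 = encode (h a e x) \<and> (\<forall>v<3. s' v = s v)" for s'
    by (rule exec_within_Seq[where m = "esize (h a e x) + 1" and k = "esize (e # l) + 2"
          and M = "\<lambda>s''. s'' = s'(1 := s' 3)"]; (rule exec_within_Assign)?) (use that s in auto)
  show ?thesis
    unfolding foldl_body_def by (rule exec_within_Seq[OF call update]) (use s in auto)
qed

lemma exec_within_foldl_loop:
  assumes c: "computes Q UNIV c (\<lambda>z. poly q (esize z)) (\<lambda>z. h (fst z) (fst (snd z)) (snd (snd z)))"
    and f: "solves f Q" and s: "s 0 = encode x" "s 1 = encode a" "s 2 = encode l"
    and a_size: "\<And>k. esize (foldl (\<lambda>a e. h a e x) a (take k l)) \<le> B" and l_size: "esize l \<le> N"
  shows "exec_within f (instances Q) (While (EVar 2) (foldl_body c)) s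
    ((esize x + 2 * B + 3 * N + poly q (B + N + esize x + 2) + 11) * length l + 2)
    (\<lambda>s'. s' 1 = encode (foldl (\<lambda>a e. h a e x) a l))"
  using s a_size l_size
proof (induction l arbitrary: s a)
  case Nil
  then show ?case by (intro exec_within_While_Leaf) auto
next
  case (Cons e l)
  have sizes: "esize a \<le> B" "esize (h a e x) \<le> B"
    using Cons.prems(4)[of 0] Cons.prems(4)[of 1] by simp_all
  have time: "poly q (esize (a, e, x)) \<le> poly q (B + N + esize x + 2)"
    using sizes Cons.prems(5) by (intro poly_nat_mono) simp
  show ?case
  proof (rule exec_within_While_step)
    show "aval (EVar 2) s \<noteq> Leaf" using Cons.prems(3) by simp
    show "exec_within f (instances Q) (foldl_body c) s
      (esize x + esize a + 2 * esize (e # l) + esize (h a e x) + poly q (esize (a, e, x)) + 10)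
      (\<lambda>s'. s' 0 = encode x \<and> s' 1 = encode (h a e x) \<and> s' 2 = encode l)"
      by (rule exec_within_foldl_body[OF c f]) (use Cons.prems in auto)
    fix s' :: state assume "s' 0 = encode x \<and> s' 1 = encode (h a e x) \<and> s' 2 = encode l"
    then show "exec_within f (instances Q) (While (EVar 2) (foldl_body c)) s'
      ((esize x + 2 * B + 3 * N + poly q (B + N + esize x + 2) + 11) * length l + 2)
      (\<lambda>s'. s' 1 = encode (foldl (\<lambda>a e. h a e x) a (e # l)))"
      using Cons.IH[of s' "h a e x"] Cons.prems(4)[of "Suc _"] Cons.prems(5) by simp
  qed (use sizes time Cons.prems(3,5) in simp)
qed

lemma poly_time_foldl:
  fixes h :: "'b::encodable \<Rightarrow> 'c::encodable \<Rightarrow> 'a::encodable \<Rightarrow> 'b"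
  assumes i: "poly_time Q i" and l: "poly_time Q l"
    and h: "poly_time Q (\<lambda>z. h (fst z) (fst (snd z)) (snd (snd z)))"
    and B: "poly_bounded B" "\<And>x k. esize (foldl (\<lambda>a e. h a e x) (i x) (take k (l x))) \<le> B x"
  shows "poly_time Q (\<lambda>x. foldl (\<lambda>a e. h a e x) (i x) (l x))" (is "poly_time Q ?g")
proof -
  obtain c1 q1 where c1: "computes Q UNIV c1 (\<lambda>x. poly q1 (esize x)) i" by (rule poly_timeE[OF i])
  obtain c2 q2 where c2: "computes Q UNIV c2 (\<lambda>x. poly q2 (esize x)) l" by (rule poly_timeE[OF l])
  obtain c3 q3 where c3: "computes Q UNIV c3 (\<lambda>z. poly q3 (esize z))
    (\<lambda>z. h (fst z) (fst (snd z)) (snd (snd z)))" by (rule poly_timeE[OF h])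
  let ?c = "Seq (call 1 (EVar 0) c1) (Seq (call 2 (EVar 0) c2)
    (Seq (While (EVar 2) (foldl_body c3)) (Assign 0 (EVar 1))))"
  let ?I = "\<lambda>x. esize x + 2 * B x + 3 * esize (l x)
      + poly q3 (B x + esize (l x) + esize x + 2) + 11"
  let ?T = "\<lambda>x. 2 * esize x + poly q1 (esize x) + poly q2 (esize x) + ?I x * esize (l x) + B x + 10"
  have "computes Q UNIV ?c ?T ?g"
  proof (rule computesI)
    fix f and s :: state and x :: 'a assume f: "solves f Q" and s: "s 0 = encode x"
    have "?I x * length (l x) \<le> ?I x * esize (l x)"
      using length_less_esize[of "l x"] by (intro mult_le_mono) auto
    then have loop: "exec_within f (instances Q) (While (EVar 2) (foldl_body c3)) s'
        (?I x * esize (l x) + 2) (\<lambda>s'. s' 1 = encode (?g x))"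
      if "s' 0 = encode x" "s' 1 = encode (i x)" "s' 2 = encode (l x)" for s'
      by (intro exec_within_mono[OF exec_within_foldl_loop[OF c3 f that B(2) order_refl]]) auto
    have result: "exec_within f (instances Q) (Assign 0 (EVar 1)) s' (B x + 1)
        (\<lambda>s'. s' 0 = encode (?g x))"
      if "s' 1 = encode (?g x)" for s'
      by (rule exec_within_Assign) (use that B(2)[of x "length (l x)"] in auto)
    show "exec_within f (instances Q) ?c s (?T x) (\<lambda>s'. s' 0 = encode (?g x))"
      by (rule exec_within_Seq[OF exec_within_call_input[OF c1 f, of s x 1, OF s]
            exec_within_Seq[OF exec_within_call_input[OF c2 f, of _ x 2]
              exec_within_Seq[OF loop result]]])
        (use s in auto)
  qed
  moreover have "poly_bounded ?T" by (intro poly_bounded_intros B poly_bounded_poly_time[OF l])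
  moreover have "esize (?g x) \<le> B x" for x using B(2)[of x "length (l x)"] by simp
  then have "poly_bounded (\<lambda>x. esize (?g x))" by (rule poly_bounded_le[OF B(1)])
  ultimately show ?thesis by (rule poly_timeI)
qed

lemma poly_time_foldl_additive:
  assumes i: "poly_time Q i" and l: "poly_time Q l"
    and h: "poly_time Q (\<lambda>z. h (fst z) (fst (snd z)) (snd (snd z)))"
    and B: "poly_bounded B" "\<And>x a e. e \<in> set (l x) \<Longrightarrow> esize (h a e x) \<le> esize a + B x"
  shows "poly_time Q (\<lambda>x. foldl (\<lambda>a e. h a e x) (i x) (l x))"
proof (rule poly_time_foldl[OF i l h])
  show "poly_bounded (\<lambda>x. esize (i x) + esize (l x) * B x)"
    by (intro poly_bounded_intros B poly_bounded_poly_time[OF i] poly_bounded_poly_time[OF l])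
  have additive: "esize (foldl (\<lambda>a e. h a e x) a es) \<le> esize a + length es * B x"
    if "set es \<subseteq> set (l x)" for x a es
    using that
  proof (induction es arbitrary: a)
    case (Cons e es)
    then have "esize (foldl (\<lambda>a e. h a e x) (h a e x) es) \<le> esize (h a e x) + length es * B x"
      "esize (h a e x) \<le> esize a + B x" using B(2)[of e x a] by auto
    then show ?case by simp
  qed simp
  show "esize (foldl (\<lambda>a e. h a e x) (i x) (take k (l x))) \<le> esize (i x) + esize (l x) * B x"
    for x k
  proof -
    have "esize (foldl (\<lambda>a e. h a e x) (i x) (take k (l x))) \<le>
        esize (i x) + length (take k (l x)) * B x"
      by (rule additive) (rule set_take_subset)
    also have "\<dots> \<le> esize (i x) + esize (l x) * B x"
      using length_less_esize[of "l x"] by (intro add_left_mono mult_le_mono1) auto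
    finally show ?thesis .
  qed
qed

lemma poly_time_Cons [poly_time_intros]:
  "poly_time Q g \<Longrightarrow> poly_time Q l \<Longrightarrow> poly_time Q (\<lambda>x. g x # l x)"
  by (rule poly_time_same_encoding[OF poly_time_Pair]) auto

lemma poly_time_Suc [poly_time_intros]: "poly_time Q n \<Longrightarrow> poly_time Q (\<lambda>x. Suc (n x))"
  by (rule poly_time_same_encoding[OF poly_time_Pair[OF poly_time_const[of _ "()"]]]) auto

lemma poly_time_tl [poly_time_intros]:
  fixes l :: "'a::encodable \<Rightarrow> 'b::encodable list"
  assumes "poly_time Q l"
  shows "poly_time Q (\<lambda>x. tl (l x))"
proof -
  have "right (encode l) = encode (tl l)" for l :: "'b list" by (cases l) auto
  then have "poly_time Q (\<lambda>l :: 'b list. tl l)"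
    by (intro poly_time_exp[of "ERight (EVar 0)" _ "\<lambda>l. esize l + 1"])
      (auto intro!: poly_bounded_intros)
  then show ?thesis by (rule poly_time_comp[OF assms])
qed

lemma foldl_Cons_eq: "foldl (\<lambda>a e. e # a) a l = rev l @ a"
  by (induction l arbitrary: a) auto

lemma poly_time_rev [poly_time_intros]:
  assumes "poly_time Q l"
  shows "poly_time Q (\<lambda>x. rev (l x))"
proof -
  have "poly_time Q (\<lambda>x. foldl (\<lambda>a e. e # a) [] (l x))"
    by (rule poly_time_foldl_additive[OF poly_time_const assms, where B = "\<lambda>x. esize (l x)"])
      (auto intro!: poly_time_intros poly_bounded_poly_time[OF assms]
          simp: Suc_le_eq esize_elem_less)
  then show ?thesis by (simp add: foldl_Cons_eq)
qed

lemma poly_time_append [poly_time_intros]: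
  assumes "poly_time Q l" and "poly_time Q m"
  shows "poly_time Q (\<lambda>x. l x @ m x)"
proof -
  have "poly_time Q (\<lambda>x. foldl (\<lambda>a e. e # a) (m x) (rev (l x)))"
    by (rule poly_time_foldl_additive[OF assms(2) poly_time_rev[OF assms(1)],
          where B = "\<lambda>x. esize (l x)"])
      (auto intro!: poly_time_intros poly_bounded_poly_time[OF assms(1)]
          simp: Suc_le_eq esize_elem_less)
  then show ?thesis by (simp add: foldl_Cons_eq)
qed

lemma poly_time_concat_map [poly_time_intros]:
  assumes l: "poly_time Q l" and h: "poly_time Q (\<lambda>z. h (fst z) (snd z))"
  shows "poly_time Q (\<lambda>x. concat (map (\<lambda>e. h e x) (l x)))"
proof -
  obtain q where q: "\<And>z. esize (h (fst z) (snd z)) \<le> poly q (esize z)"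
    using poly_bounded_poly_time[OF h] unfolding poly_bounded_def by blast
  have "poly_time Q (\<lambda>x. foldl (\<lambda>a e. a @ h e x) [] (l x))"
  proof (rule poly_time_foldl_additive[OF poly_time_const l,
        where B = "\<lambda>x. poly q (esize (l x) + esize x + 1)"])
    show "poly_time Q (\<lambda>z. fst z @ h (fst (snd z)) (snd (snd z)))"
      by (intro poly_time_intros poly_time_comp[OF _ h])
    show "poly_bounded (\<lambda>x. poly q (esize (l x) + esize x + 1))"
      by (intro poly_bounded_intros poly_bounded_poly_time[OF l])
    fix x a e assume e: "e \<in> set (l x)"
    have "esize (h e x) \<le> poly q (esize (e, x))" using q[of "(e, x)"] by simp
    also have "\<dots> \<le> poly q (esize (l x) + esize x + 1)"
      using esize_elem_less[OF e] by (intro poly_nat_mono) simp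
    finally show "esize (a @ h e x) \<le> esize a + poly q (esize (l x) + esize x + 1)"
      using esize_append[of a "h e x"] by simp
  qed
  moreover have "foldl (\<lambda>a e. a @ h e x) a es = a @ concat (map (\<lambda>e. h e x) es)" for x a es
    by (induction es arbitrary: a) auto
  ultimately show ?thesis by simp
qed

lemma poly_time_map [poly_time_intros]:
  assumes "poly_time Q l" and "poly_time Q (\<lambda>z. h (fst z) (snd z))"
  shows "poly_time Q (\<lambda>x. map (\<lambda>e. h e x) (l x))"
proof -
  have "concat (map (\<lambda>e. [h e x]) es) = map (\<lambda>e. h e x) es" for x es by (induction es) auto
  then show ?thesis
    using poly_time_concat_map[OF assms(1), of "\<lambda>e x. [h e x]"]
      poly_time_Cons[OF assms(2) poly_time_const[of _ "[]"]] by simp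
qed

lemma poly_time_filter [poly_time_intros]:
  assumes "poly_time Q l" and "poly_time Q (\<lambda>z. p (fst z) (snd z))"
  shows "poly_time Q (\<lambda>x. filter (\<lambda>e. p e x) (l x))"
proof -
  have "concat (map (\<lambda>e. if p e x then [e] else []) es) = filter (\<lambda>e. p e x) es" for x es
    by (induction es) auto
  moreover have "poly_time Q (\<lambda>x. concat (map (\<lambda>e. if p e x then [e] else []) (l x)))"
    by (intro poly_time_intros assms)
  ultimately show ?thesis by simp
qed

lemma poly_time_ball [poly_time_intros]:
  assumes "poly_time Q l" and "poly_time Q (\<lambda>z. p (fst z) (snd z))"
  shows "poly_time Q (\<lambda>x. \<forall>e\<in>set (l x). p e x)"
proof -
  have "poly_time Q (\<lambda>x. filter (\<lambda>e. \<not> p e x) (l x) = [])" by (intro poly_time_intros assms)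
  then show ?thesis by (simp add: filter_empty_conv)
qed

lemma poly_time_length [poly_time_intros]:
  assumes "poly_time Q l"
  shows "poly_time Q (\<lambda>x. length (l x))"
proof (rule poly_time_same_encoding)
  show "poly_time Q (\<lambda>x. map (\<lambda>_. ()) (l x))" by (intro poly_time_intros assms)
  show "encode (length (l x)) = encode (map (\<lambda>_. ()) (l x))" for x
    by (induction "l x") (auto simp: map_replicate_const encode_nat encode_list enc_nat_def)
qed

lemma poly_time_replicate_unit:
  "poly_time Q n \<Longrightarrow> poly_time Q (\<lambda>x. replicate (n x) ())"
  by (rule poly_time_same_encoding) (auto simp: encode_nat encode_list enc_nat_def)

lemma poly_time_drop [poly_time_intros]:
  fixes l :: "'a::encodable \<Rightarrow> 'b::encodable list"
  assumes "poly_time Q n" and "poly_time Q l"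
  shows "poly_time Q (\<lambda>x. drop (n x) (l x))"
proof -
  note units = poly_time_replicate_unit[OF assms(1)]
  have "esize (tl l) \<le> esize l" for l :: "'b list" by (cases l) auto
  then have "poly_time Q (\<lambda>x. foldl (\<lambda>a _. tl a) (l x) (replicate (n x) ()))"
    by (intro poly_time_foldl_additive[OF assms(2) units, where B = "\<lambda>_. 0"])
      (auto intro!: poly_time_intros poly_bounded_intros)
  moreover have "foldl (\<lambda>a _. tl a) l (replicate n ()) = drop n l" for n and l :: "'b list"
    by (induction n arbitrary: l) (auto simp: drop_Suc)
  ultimately show ?thesis by simp
qed

lemma poly_time_minus [poly_time_intros]:
  fixes m n :: "'a::encodable \<Rightarrow> nat"
  assumes "poly_time Q m" and "poly_time Q n"
  shows "poly_time Q (\<lambda>x. m x - n x)"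
proof -
  have "poly_time Q (\<lambda>x. length (drop (n x) (replicate (m x) ())))"
    by (intro poly_time_intros poly_time_replicate_unit assms)
  then show ?thesis by simp
qed

lemma poly_time_less [poly_time_intros]:
  fixes m n :: "'a::encodable \<Rightarrow> nat"
  assumes "poly_time Q m" and "poly_time Q n"
  shows "poly_time Q (\<lambda>x. m x < n x)"
proof -
  have "poly_time Q (\<lambda>x. \<not> n x - m x = 0)" by (intro poly_time_intros assms)
  then show ?thesis by (simp add: not_le)
qed

lemma poly_time_take [poly_time_intros]:
  fixes l :: "'a::encodable \<Rightarrow> 'b::encodable list"
  assumes "poly_time Q n" and "poly_time Q l"
  shows "poly_time Q (\<lambda>x. take (n x) (l x))"
proof -
  have "poly_time Q (\<lambda>x. rev (drop (length (l x) - n x) (rev (l x))))"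
    by (intro poly_time_intros assms)
  moreover have "rev (drop (length l - n) (rev l)) = take n l" for n and l :: "'b list"
    by (cases "n \<le> length l") (simp_all add: drop_rev)
  ultimately show ?thesis by simp
qed

lemma poly_time_hd_append [poly_time_intros]:
  fixes y :: "'a::encodable \<Rightarrow> 'b::encodable"
  assumes l: "poly_time Q l" and y: "poly_time Q y"
  shows "poly_time Q (\<lambda>x. hd (l x @ [y x]))"
proof -
  have "poly_time Q (\<lambda>x. foldl (\<lambda>_ e. e) (y x) (rev (l x)))"
    by (rule poly_time_foldl_additive[OF y poly_time_rev[OF l], where B = "\<lambda>x. esize (l x)"])
      (auto intro!: poly_time_intros poly_bounded_poly_time[OF l]
          simp: trans_le_add2 esize_elem_less less_imp_le)
  moreover have "foldl (\<lambda>_ e. e) y (rev l) = hd (l @ [y])" for y :: 'b and l by (cases l) auto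
  ultimately show ?thesis by simp
qed

lemma poly_time_hd:
  assumes "poly_time Q l" and "\<And>x. l x \<noteq> []"
  shows "poly_time Q (\<lambda>x. hd (l x))"
  using poly_time_hd_append[OF assms(1) poly_time_const] assms(2) by (simp add: hd_append)

lemma poly_time_nth_default [poly_time_intros]:
  fixes l :: "'a::encodable \<Rightarrow> 'b::encodable list"
  assumes "poly_time Q l" and "poly_time Q n"
  shows "poly_time Q (\<lambda>x. nth_default y (l x) (n x))"
proof -
  have "hd (drop n l @ [y]) = nth_default y l n" for n and l :: "'b list"
    by (cases "n < length l") (auto simp: nth_default_def hd_drop_conv_nth hd_append)
  then show ?thesis
    using poly_time_hd_append[OF poly_time_drop[OF assms(2,1)] poly_time_const[of _ y]] by simp
qed

lemma poly_time_upt_0: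
  assumes "poly_time Q n"
  shows "poly_time Q (\<lambda>x. [0..<n x])"
proof -
  let ?h = "\<lambda>(a :: nat list) (_ :: unit). hd (map Suc a @ [0]) # a"
  have downto: "foldl ?h [] (replicate k ()) = rev [0..<k]" for k
  proof (induction k)
    case (Suc k)
    have "replicate (Suc k) () = replicate k () @ [()]" by (simp add: replicate_append_same)
    then have "foldl ?h [] (replicate (Suc k) ()) = ?h (rev [0..<k]) ()"
      by (simp only: foldl_append Suc foldl.simps)
    then show ?case by (cases k) (auto simp: hd_append)
  qed simp
  note units = poly_time_replicate_unit[OF assms]
  have "poly_time Q (\<lambda>x. foldl ?h [] (replicate (n x) ()))"
  proof (rule poly_time_foldl[OF poly_time_const units,
        where B = "\<lambda>x. esize (n x) * (esize (n x) + 1) + 1"])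
    show "poly_bounded (\<lambda>x. esize (n x) * (esize (n x) + 1) + 1)"
      by (intro poly_bounded_intros poly_bounded_poly_time[OF assms])
    show "esize (foldl ?h [] (take k (replicate (n x) ()))) \<le> esize (n x) * (esize (n x) + 1) + 1"
      for x k
      unfolding take_replicate downto by (rule esize_list_le) auto
  qed (intro poly_time_intros)
  then have "poly_time Q (\<lambda>x. rev (rev [0..<n x]))" unfolding downto by (rule poly_time_rev)
  then show ?thesis by simp
qed

lemma poly_time_upt [poly_time_intros]:
  assumes "poly_time Q m" and "poly_time Q n"
  shows "poly_time Q (\<lambda>x. [m x..<n x])"
  using poly_time_drop[OF assms(1) poly_time_upt_0[OF assms(2)]] by (simp add: drop_upt)

lemma poly_time_replicate [poly_time_intros]:
  assumes "poly_time Q n" and "poly_time Q g"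
  shows "poly_time Q (\<lambda>x. replicate (n x) (g x))"
proof -
  have "poly_time Q (\<lambda>x. map (\<lambda>_. g x) [0..<n x])"
    by (intro poly_time_intros assms poly_time_comp[OF _ assms(2)])
  then show ?thesis by (simp add: map_replicate_const)
qed

lemma poly_time_list_all2 [poly_time_intros]:
  assumes "poly_time Q l" and "poly_time Q m"
    and "poly_time Q (\<lambda>z. p (fst z) (fst (snd z)) (snd (snd z)))"
  shows "poly_time Q (\<lambda>x. list_all2 (\<lambda>a b. p a b x) (l x) (m x))"
proof -
  have "list_all2 (\<lambda>a b. p a b x) (l x) (m x) \<longleftrightarrow> length (l x) = length (m x) \<and>
      (\<forall>i\<in>set [0..<length (l x)].
        p (nth_default undefined (l x) i) (nth_default undefined (m x) i) x)" for x
    by (auto simp: list_all2_conv_all_nth nth_default_def)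
  moreover have "poly_time Q (\<lambda>x. length (l x) = length (m x) \<and>
      (\<forall>i\<in>set [0..<length (l x)].
        p (nth_default undefined (l x) i) (nth_default undefined (m x) i) x))"
  proof (intro poly_time_intros assms(1,2))
    have "poly_time Q (\<lambda>z. (nth_default undefined (l (snd z)) (fst z),
        nth_default undefined (m (snd z)) (fst z), snd z))"
      by (intro poly_time_intros poly_time_comp[OF _ assms(1)] poly_time_comp[OF _ assms(2)])
    from poly_time_comp[OF this assms(3)]
    show "poly_time Q (\<lambda>z. p (nth_default undefined (l (snd z)) (fst z))
      (nth_default undefined (m (snd z)) (fst z)) (snd z))" by simp
  qed
  ultimately show ?thesis by simp
qed

lemma poly_time_n_lists [poly_time_intros]:
  assumes "poly_time Q l"
  shows "poly_time Q (\<lambda>x. List.n_lists k (l x))"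
proof (induction k)
  case (Suc k)
  show ?case unfolding n_lists.simps
    by (intro poly_time_intros Suc poly_time_comp[OF _ assms])
qed (simp add: poly_time_const)

lemma poly_time_product [poly_time_intros]:
  assumes "poly_time Q l" and "poly_time Q m"
  shows "poly_time Q (\<lambda>x. List.product (l x) (m x))"
  unfolding product_concat_map
  by (intro poly_time_intros assms(1) poly_time_comp[OF _ assms(2)])

lemma poly_time_sorted_wrt_less [poly_time_intros]:
  fixes l :: "'a::encodable \<Rightarrow> nat list"
  assumes "poly_time Q l"
  shows "poly_time Q (\<lambda>x. sorted_wrt (<) (l x))"
proof -
  have "sorted_wrt (<) S \<longleftrightarrow> (\<forall>i\<in>set [0..<length S - 1]. nth_default 0 S i < nth_default 0 S (Suc i))"
    for S :: "nat list"
    by (auto simp: sorted_wrt_iff_nth_Suc_transp nth_default_def)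
  moreover have "poly_time Q (\<lambda>x. \<forall>i\<in>set [0..<length (l x) - 1].
      nth_default 0 (l x) i < nth_default 0 (l x) (Suc i))"
    by (intro poly_time_intros assms poly_time_comp[OF _ assms])
  ultimately show ?thesis by simp
qed

definition find_default :: "('b \<Rightarrow> bool) \<Rightarrow> 'b \<Rightarrow> 'b list \<Rightarrow> 'b" where
  "find_default p y l = hd (filter p l @ [y])"

lemma find_default_found:
  assumes "e \<in> set l" and "p e"
  shows "find_default p y l \<in> set l" and "p (find_default p y l)"
proof -
  have "filter p l \<noteq> []" using assms by (auto simp: filter_empty_conv)
  then have "find_default p y l \<in> set (filter p l)"
    unfolding find_default_def by (simp add: hd_append del: set_filter)
  then show "find_default p y l \<in> set l" and "p (find_default p y l)" by auto
qed

lemma find_default_in: "find_default p y l \<in> insert y (set l)"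
proof (cases "\<exists>e\<in>set l. p e")
  case True
  then show ?thesis using find_default_found(1)[of _ l p y] by blast
next
  case False
  then show ?thesis by (simp add: find_default_def filter_empty_conv[THEN iffD2])
qed

lemma poly_time_find_default [poly_time_intros]:
  assumes "poly_time Q l" and "poly_time Q (\<lambda>z. p (fst z) (snd z))" and "poly_time Q y"
  shows "poly_time Q (\<lambda>x. find_default (\<lambda>e. p e x) (y x) (l x))"
  unfolding find_default_def by (intro poly_time_intros assms)

lemma poly_time_cofinitely_const:
  fixes g :: "'a::encodable \<Rightarrow> 'b::encodable"
  assumes "finite {z. g z \<noteq> y}" and "poly_time Q h"
  shows "poly_time Q (\<lambda>x. g (h x))"
proof -
  have "poly_time Q g" if "finite S" "{z. g z \<noteq> y} \<subseteq> S" for g :: "'a \<Rightarrow> 'b" and S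
    using that
  proof (induction S arbitrary: g rule: finite_induct)
    case empty
    then have "g = (\<lambda>_. y)" by auto
    then show ?case by (simp add: poly_time_const)
  next
    case (insert a S)
    have "poly_time Q (g(a := y))" by (rule insert.IH) (use insert.prems in auto)
    then have "poly_time Q (\<lambda>x. if x = a then g a else (g(a := y)) x)" by (intro poly_time_intros)
    moreover have "(\<lambda>x. if x = a then g a else (g(a := y)) x) = g" by auto
    ultimately show ?case by simp
  qed
  from poly_time_comp[OF assms(2) this[OF assms(1) subset_refl]] show ?thesis .
qed

lemma poly_time_mem_finite: "finite S \<Longrightarrow> poly_time Q h \<Longrightarrow> poly_time Q (\<lambda>x. h x \<in> S)"
  by (rule poly_time_cofinitely_const[where y = False]) auto

definition table :: "('c \<Rightarrow> 'a) \<Rightarrow> 'c set \<Rightarrow> ('c \<Rightarrow> 'b) \<Rightarrow> 'b \<Rightarrow> 'a \<Rightarrow> 'b" where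
  "table code D out y z = (if z \<in> code ` D then out (inv_into D code z) else y)"

lemma table_code: "inj_on code D \<Longrightarrow> x \<in> D \<Longrightarrow> table code D out y (code x) = out x"
  by (simp add: table_def)

lemma finite_table_neq: "finite D \<Longrightarrow> finite {z. table code D out y z \<noteq> y}"
  by (rule finite_subset[of _ "code ` D"]) (auto simp: table_def)

lemma finite_range_table: "finite D \<Longrightarrow> finite (range (table code D out y))"
  by (rule finite_subset[of _ "insert y (out ` D)"]) (auto simp: table_def inv_into_into)

section \<open>Subalgebras of products\<close>

definition subuniverse :: "'f language \<Rightarrow> ('f, 'a) alg \<Rightarrow> 'a set \<Rightarrow> bool" where
  "subuniverse L A X \<longleftrightarrow>
     (\<forall>f\<in>syms L. \<forall>xs. length xs = arity L f \<and> set xs \<subseteq> X \<longrightarrow> interp A f xs \<in> X)"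

lemma subuniverse_univ: "is_algebra L A \<Longrightarrow> subuniverse L A (univ A)"
  by (simp add: is_algebra_def subuniverse_def)

lemma subuniverse_Sg: "subuniverse L A (Sg L A X)"
  by (auto simp: subuniverse_def intro: Sg.op)

lemma Sg_subset_subuniverse:
  assumes "subuniverse L A Y" and "X \<subseteq> Y"
  shows "Sg L A X \<subseteq> Y"
proof
  fix x assume "x \<in> Sg L A X"
  then show "x \<in> Y"
  proof induction
    case (op f xs)
    then have "set xs \<subseteq> Y" by blast
    then show ?case using op assms(1) by (simp add: subuniverse_def)
  qed (use assms(2) in auto)
qed

lemma eval_in_subuniverse:
  "subuniverse L A X \<Longrightarrow> wf_term L t \<Longrightarrow> (\<And>v. v \<in> vars t \<Longrightarrow> \<sigma> v \<in> X) \<Longrightarrow> eval A \<sigma> t \<in> X"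
proof (induction t)
  case (Fn f ts)
  then have "set (map (eval A \<sigma>) ts) \<subseteq> X" by auto
  then show ?case using Fn.prems unfolding subuniverse_def by simp
qed simp

lemma eval_cong_vars: "(\<And>v. v \<in> vars t \<Longrightarrow> \<sigma> v = \<tau> v) \<Longrightarrow> eval A \<sigma> t = eval A \<tau> t"
proof (induction t)
  case (Fn f ts)
  then have "map (eval A \<sigma>) ts = map (eval A \<tau>) ts" by auto
  then show ?case by (simp only: eval.simps)
qed simp

lemma term_op_in_subuniverse:
  "subuniverse L A X \<Longrightarrow> nary_term L k t \<Longrightarrow> length ts = k \<Longrightarrow> set ts \<subseteq> X \<Longrightarrow> term_op A t ts \<in> X"
  unfolding term_op_def nary_term_def
  by (rule eval_in_subuniverse) (auto intro!: subsetD[OF _ nth_mem])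

lemma interp_prod_nth:
  "i < length As \<Longrightarrow> interp (prod_alg As) f xss ! i = interp (As ! i) f (map (\<lambda>xs. xs ! i) xss)"
  by (simp add: prod_alg_def)

lemma eval_prod_nth:
  "i < length As \<Longrightarrow> eval (prod_alg As) \<sigma> t ! i = eval (As ! i) (\<lambda>v. \<sigma> v ! i) t"
proof (induction t)
  case (Fn f ts)
  then have "map (\<lambda>xs. xs ! i) (map (eval (prod_alg As) \<sigma>) ts) =
      map (eval (As ! i) (\<lambda>v. \<sigma> v ! i)) ts"
    by simp
  then show ?case using Fn.prems by (simp only: eval.simps interp_prod_nth)
qed simp

lemma term_op_prod_nth:
  assumes "nary_term L k t" and "length ts = k" and "i < length As"
  shows "term_op (prod_alg As) t ts ! i = term_op (As ! i) t (map (\<lambda>x. x ! i) ts)"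
  unfolding term_op_def eval_prod_nth[OF assms(3)]
  by (rule eval_cong_vars) (use assms in \<open>auto simp: nary_term_def\<close>)

lemma is_algebra_prod:
  assumes "\<And>A. A \<in> set As \<Longrightarrow> is_algebra L A"
  shows "is_algebra L (prod_alg As)"
proof -
  have "\<exists>a. a \<in> univ (As ! i)" if "i < length As" for i
    using assms[OF nth_mem[OF that]] by (auto simp: is_algebra_def)
  then obtain a where "\<forall>i<length As. a i \<in> univ (As ! i)" by metis
  then have "map a [0..<length As] \<in> univ (prod_alg As)" by (simp add: prod_alg_def)
  moreover have "interp (As ! i) f (map (\<lambda>x. x ! i) xs) \<in> univ (As ! i)"
    if "f \<in> syms L" "length xs = arity L f" "set xs \<subseteq> univ (prod_alg As)" "i < length As" for f xs i
  proof -
    have "set (map (\<lambda>x. x ! i) xs) \<subseteq> univ (As ! i)" using that by (auto simp: prod_alg_def)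
    then show ?thesis using assms[OF nth_mem[OF that(4)]] that by (simp add: is_algebra_def)
  qed
  then have "interp (prod_alg As) f xs \<in> univ (prod_alg As)"
    if "f \<in> syms L" "length xs = arity L f" "set xs \<subseteq> univ (prod_alg As)" for f xs
    using that by (simp add: prod_alg_def)
  ultimately show ?thesis unfolding is_algebra_def by blast
qed

definition select :: "nat list \<Rightarrow> 'b list \<Rightarrow> 'b list" where
  "select js xs = map (\<lambda>j. xs ! j) js"

lemma length_select [simp]: "length (select js xs) = length js"
  by (simp add: select_def)

lemma select_nth [simp]: "i < length js \<Longrightarrow> select js xs ! i = xs ! (js ! i)"
  by (simp add: select_def)

lemma select_append: "select (is @ js) xs = select is xs @ select js xs"
  by (simp add: select_def)

lemma select_upt: "m \<le> length xs \<Longrightarrow> select [0..<m] xs = take m xs"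
  by (rule nth_equalityI) auto

lemma set_select_subset: "set js \<subseteq> {..<length xs} \<Longrightarrow> set (select js xs) \<subseteq> set xs"
  by (auto simp: select_def subset_iff)

lemma select_interp:
  assumes "set js \<subseteq> {..<length As}"
  shows "select js (interp (prod_alg As) f xss) =
    interp (prod_alg (select js As)) f (map (select js) xss)"
proof (rule nth_equalityI)
  fix i assume i: "i < length (select js (interp (prod_alg As) f xss))"
  then have "js ! i < length As" using assms by (auto simp: subset_iff)
  then show "select js (interp (prod_alg As) f xss) ! i =
      interp (prod_alg (select js As)) f (map (select js) xss) ! i"
    using i by (simp add: interp_prod_nth o_def)
qed (simp add: prod_alg_def)

lemma Sg_select:
  assumes "set js \<subseteq> {..<length As}"
  shows "Sg L (prod_alg (select js As)) (select js ` X) = select js ` Sg L (prod_alg As) X"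
proof (rule antisym)
  have "subuniverse L (prod_alg (select js As)) (select js ` Sg L (prod_alg As) X)"
    unfolding subuniverse_def
  proof (intro ballI allI impI)
    fix f xs assume f: "f \<in> syms L"
      and xs: "length xs = arity L f \<and> set xs \<subseteq> select js ` Sg L (prod_alg As) X"
    have "xs \<in> lists (select js ` Sg L (prod_alg As) X)" using xs by (simp add: lists_eq_set)
    then obtain ys where ys: "xs = map (select js) ys" "set ys \<subseteq> Sg L (prod_alg As) X"
      unfolding lists_image by (auto simp: lists_eq_set)
    then have "interp (prod_alg As) f ys \<in> Sg L (prod_alg As) X" using f xs by (intro Sg.op) auto
    then show "interp (prod_alg (select js As)) f xs \<in> select js ` Sg L (prod_alg As) X"
      unfolding ys(1) select_interp[OF assms, symmetric] by blast
  qed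
  then show "Sg L (prod_alg (select js As)) (select js ` X) \<subseteq> select js ` Sg L (prod_alg As) X"
    by (rule Sg_subset_subuniverse) (auto intro: Sg.gen)
  show "select js ` Sg L (prod_alg As) X \<subseteq> Sg L (prod_alg (select js As)) (select js ` X)"
  proof
    fix x assume "x \<in> select js ` Sg L (prod_alg As) X"
    then obtain y where x: "x = select js y" and "y \<in> Sg L (prod_alg As) X" by auto
    from this(2) have "select js y \<in> Sg L (prod_alg (select js As)) (select js ` X)"
    proof induction
      case (op f xs)
      then show ?case unfolding select_interp[OF assms] by (intro Sg.op) auto
    qed (auto intro: Sg.gen)
    then show "x \<in> Sg L (prod_alg (select js As)) (select js ` X)" by (simp add: x)
  qed
qed

lemma select_in_univ:
  assumes "set js \<subseteq> {..<length As}" and "x \<in> univ (prod_alg As)"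
  shows "select js x \<in> univ (prod_alg (select js As))"
proof -
  have "js ! i < length As" if "i < length js" for i
    using that assms by (auto simp: subset_iff)
  then show ?thesis using assms(2) by (auto simp: prod_alg_def)
qed

section \<open>Gluing partial approximations with the parallelogram term\<close>

definition agree_on :: "nat set \<Rightarrow> 'b list \<Rightarrow> 'b list \<Rightarrow> bool" where
  "agree_on J s t \<longleftrightarrow> (\<forall>j\<in>J. s ! j = t ! j)"

lemma agree_on_subset: "agree_on J s t \<Longrightarrow> I \<subseteq> J \<Longrightarrow> agree_on I s t"
  by (auto simp: agree_on_def)

definition remove_nth :: "nat \<Rightarrow> 'b list \<Rightarrow> 'b list" where
  "remove_nth j xs = take j xs @ drop (Suc j) xs"

lemma length_remove_nth: "j < length xs \<Longrightarrow> length (remove_nth j xs) = length xs - 1"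
  by (simp add: remove_nth_def)

lemma set_remove_nth_subset: "set (remove_nth j xs) \<subseteq> set xs"
  using set_take_subset[of j xs] set_drop_subset[of "Suc j" xs] by (auto simp: remove_nth_def)

lemma nth_in_remove_nth:
  assumes "i < length xs" and "i \<noteq> j"
  shows "xs ! i \<in> set (remove_nth j xs)"
proof (cases "i < j")
  case True
  then have "xs ! i = take j xs ! i" "i < length (take j xs)" using assms by simp_all
  then show ?thesis by (metis Un_iff nth_mem remove_nth_def set_append)
next
  case False
  then have "xs ! i = drop (Suc j) xs ! (i - Suc j)" "i - Suc j < length (drop (Suc j) xs)"
    using assms by simp_all
  then show ?thesis by (metis Un_iff nth_mem remove_nth_def set_append)
qed

lemma agree_except_one:
  assumes "length S = k" "0 < k" and i: "i \<in> set S \<union> J"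
    and agree: "\<And>j. j < k \<Longrightarrow> agree_on (set (remove_nth j S) \<union> J) (vs ! j) b"
  obtains j where "j < k" "\<And>j'. j' < k \<Longrightarrow> j' \<noteq> j \<Longrightarrow> vs ! j' ! i = b ! i"
proof (cases "i \<in> set S")
  case True
  then obtain j where "j < k" "i = S ! j" using assms(1) by (auto simp: in_set_conv_nth)
  then show ?thesis
    using nth_in_remove_nth[of j S] assms(1) agree by (intro that[of j]) (auto simp: agree_on_def)
next
  case False
  then show ?thesis using i assms(2) agree by (intro that[of 0]) (auto simp: agree_on_def)
qed

definition glue :: "('b list \<Rightarrow> 'b) \<Rightarrow> 'b \<Rightarrow> 'b \<Rightarrow> 'b \<Rightarrow> 'b list \<Rightarrow> 'b" where
  "glue p c u u' vs = (let v = hd vs; q = (\<lambda>x. p ([x, v, v, x] @ vs)) in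
     p ([q (q c), p ([u', u, v, u'] @ map (\<lambda>_. v) vs), v, c] @ vs))"

lemma glue_hom:
  assumes hom: "\<And>ts. length ts = length vs + 4 \<Longrightarrow> set ts \<subseteq> X \<Longrightarrow> p ts \<in> X \<and> \<phi> (p ts) = q (map \<phi> ts)"
    and X: "{c, u, u'} \<subseteq> X" "set vs \<subseteq> X" "vs \<noteq> []"
  shows "glue p c u u' vs \<in> X \<and> \<phi> (glue p c u u' vs) = glue q (\<phi> c) (\<phi> u) (\<phi> u') (map \<phi> vs)"
proof -
  have v: "hd vs \<in> X" using X(2,3) by (meson hd_in_set subsetD)
  have hom4: "p ([w, x, y, z] @ ts) \<in> X \<and>
      \<phi> (p ([w, x, y, z] @ ts)) = q ([\<phi> w, \<phi> x, \<phi> y, \<phi> z] @ map \<phi> ts)"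
    if "{w, x, y, z} \<subseteq> X" "set ts \<subseteq> X" "length ts = length vs" for w x y z ts
    using hom[of "[w, x, y, z] @ ts"] that by simp
  have const: "set (map (\<lambda>_. hd vs) vs) \<subseteq> X"
    "map \<phi> (map (\<lambda>_. hd vs) vs) = map (\<lambda>_. hd (map \<phi> vs)) (map \<phi> vs)"
    using v X(3) by (auto simp: hd_map)
  let ?q = "\<lambda>x. p ([x, hd vs, hd vs, x] @ vs)"
  have qc: "?q x \<in> X \<and> \<phi> (?q x) = q ([\<phi> x, \<phi> (hd vs), \<phi> (hd vs), \<phi> x] @ map \<phi> vs)" if "x \<in> X" for x
    using hom4[of x "hd vs" "hd vs" x vs] that v X by simp
  show ?thesis
    unfolding glue_def Let_def
    using hom4[of "?q (?q c)" "p ([u', u, hd vs, u'] @ map (\<lambda>_. hd vs) vs)" "hd vs" c vs]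
      hom4[of u' u "hd vs" u' "map (\<lambda>_. hd vs) vs"] qc[of c] qc[of "?q c"] v X const
    by (simp add: hd_map o_def)
qed

locale parallelogram =
  fixes L :: "'f language" and K :: "('f, 'a) alg set" and d :: nat and P :: "'f trm"
  assumes is_algebra: "A \<in> K \<Longrightarrow> is_algebra L A" and d_gt_1: "1 < d"
    and parallelogram_term: "parallelogram_term L K d P"
begin

lemma nary_P: "nary_term L (d + 3) P"
  using parallelogram_term by (simp add: parallelogram_term_def)

lemma parallelogram_first:
  assumes "A \<in> K" "x \<in> univ A" "y \<in> univ A" "z \<in> univ A"
  shows "term_op A P ([x, x, y, z] @ replicate (d - 1) y) = y"
proof -
  have "(replicate d y)[0 := z] = z # replicate (d - 1) y" using d_gt_1 by (cases d) auto
  then show ?thesis using parallelogram_term assms unfolding parallelogram_term_def by force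
qed

lemma parallelogram_rest:
  assumes "A \<in> K" "x \<in> univ A" "y \<in> univ A" "z \<in> univ A" "j < d - 1"
  shows "term_op A P ([y, x, x, y] @ (replicate (d - 1) y)[j := z]) = y"
proof -
  have "(replicate d y)[(j + 2) - 1 := z] = y # (replicate (d - 1) y)[j := z]"
    using d_gt_1 by (cases d) auto
  moreover have "j + 2 \<in> {2..d}" using assms(5) by auto
  ultimately show ?thesis using parallelogram_term assms unfolding parallelogram_term_def
    by (metis append_Cons append_Nil)
qed

lemma pow_op_eq: "pow_op d P A x y = term_op A P ([x, y, y, x] @ replicate (d - 1) y)"
proof -
  have "(replicate d y)[0 := x] = x # replicate (d - 1) y" using d_gt_1 by (cases d) auto
  then show ?thesis by (simp add: pow_op_def p_op_def)
qed

lemma pow_op_in_univ: "A \<in> K \<Longrightarrow> x \<in> univ A \<Longrightarrow> y \<in> univ A \<Longrightarrow> pow_op d P A x y \<in> univ A"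
  unfolding pow_op_eq using d_gt_1
  by (intro term_op_in_subuniverse[OF subuniverse_univ[OF is_algebra] nary_P])
    (auto simp: set_replicate_conv_if)

lemma glue_old_coordinate:
  assumes A: "A \<in> K" "b \<in> univ A" "u \<in> univ A" "z \<in> univ A" and j: "j < d - 1"
  shows "glue (term_op A P) b u u ((replicate (d - 1) b)[j := z]) = b"
proof -
  define vs where "vs = (replicate (d - 1) b)[j := z]"
  have "hd vs = (if j = 0 then z else b)" using j by (cases "d - 1"; cases j) (auto simp: vs_def)
  then have v: "hd vs \<in> univ A" using A by auto
  have "term_op A P ([b, hd vs, hd vs, b] @ vs) = b"
    unfolding vs_def by (rule parallelogram_rest[OF A(1) v[unfolded vs_def] A(2,4) j])
  moreover have "term_op A P ([u, u, hd vs, u] @ map (\<lambda>_. hd vs) vs) = hd vs"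
    using parallelogram_first[OF A(1,3) v A(3)] by (simp add: map_replicate_const vs_def)
  ultimately show ?thesis unfolding vs_def[symmetric] glue_def Let_def by simp
qed

lemma glue_new_coordinate:
  assumes A: "A \<in> K" "\<gamma> \<in> univ A" "\<delta> \<in> univ A"
  shows "glue (term_op A P) \<gamma> \<delta> (pow_op d P A \<gamma> \<delta>) (replicate (d - 1) \<delta>) = \<delta>"
proof -
  have "hd (replicate (d - 1) \<delta>) = \<delta>" using d_gt_1 by (simp add: hd_replicate)
  moreover have "pow_op d P A (pow_op d P A \<gamma> \<delta>) \<delta> \<in> univ A" using A by (intro pow_op_in_univ)
  from parallelogram_first[OF A(1) this A(3,2)] have
    "term_op A P ([pow_op d P A (pow_op d P A \<gamma> \<delta>) \<delta>, pow_op d P A (pow_op d P A \<gamma> \<delta>) \<delta>, \<delta>, \<gamma>] @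
      replicate (d - 1) \<delta>) = \<delta>" .
  ultimately show ?thesis by (simp add: glue_def map_replicate_const pow_op_eq)
qed

end

locale parallelogram_product = parallelogram L K d P
  for L :: "'f language" and K :: "('f, 'a) alg set" and d :: nat and P :: "'f trm" +
  fixes As :: "('f, 'a) alg list"
  assumes factors: "set As \<subseteq> K"
begin

abbreviation n where "n \<equiv> length As"
abbreviation UA where "UA \<equiv> univ (prod_alg As)"
abbreviation opA where "opA \<equiv> term_op (prod_alg As) P"

lemma factor: "i < n \<Longrightarrow> As ! i \<in> K"
  using factors by (meson nth_mem subsetD)

lemma length_UA: "t \<in> UA \<Longrightarrow> length t = n"
  and nth_UA: "t \<in> UA \<Longrightarrow> i < n \<Longrightarrow> t ! i \<in> univ (As ! i)"
  by (auto simp: prod_alg_def)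

lemma set_UA: "t \<in> UA \<Longrightarrow> set t \<subseteq> (\<Union>A\<in>K. univ A)"
  using length_UA nth_UA factor by (fastforce simp: in_set_conv_nth)

lemma subuniverse_UA: "subuniverse L (prod_alg As) UA"
  by (rule subuniverse_univ[OF is_algebra_prod]) (use factors is_algebra in auto)

lemma opA_in_UA: "length ts = d + 3 \<Longrightarrow> set ts \<subseteq> UA \<Longrightarrow> opA ts \<in> UA"
  by (rule term_op_in_subuniverse[OF subuniverse_UA nary_P])

lemma opA_nth:
  "length ts = d + 3 \<Longrightarrow> i < n \<Longrightarrow> opA ts ! i = term_op (As ! i) P (map (\<lambda>x. x ! i) ts)"
  by (rule term_op_prod_nth[OF nary_P])

lemma glue_nth:
  assumes "length vs = d - 1" and "i < n"
  shows "glue opA c u u' vs ! i =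
    glue (term_op (As ! i) P) (c ! i) (u ! i) (u' ! i) (map (\<lambda>x. x ! i) vs)"
proof (rule conjunct2[OF glue_hom[where X = UNIV]])
  fix ts :: "'a list list" assume "length ts = length vs + 4"
  then show "opA ts \<in> UNIV \<and> opA ts ! i = term_op (As ! i) P (map (\<lambda>x. x ! i) ts)"
    using opA_nth[of ts i] assms d_gt_1 by simp
qed (use assms d_gt_1 in auto)

lemma glue_agree_on:
  assumes UA: "{b, c, u, u'} \<subseteq> UA" "set vs \<subseteq> UA" and vs: "length vs = d - 1" and m: "m < n"
    and c: "agree_on {..<m} c b" and u: "agree_on {..<m} u u'"
    and um: "u ! m = b ! m" "u' ! m = pow_op d P (As ! m) (c ! m) (b ! m)"
    and S: "length S = d - 1" "set S \<subseteq> {..<m}" and J: "J \<subseteq> {..<m}"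
    and approx: "\<And>j. j < d - 1 \<Longrightarrow> agree_on (insert m (set (remove_nth j S) \<union> J)) (vs ! j) b"
  shows "agree_on (insert m (set S \<union> J)) (glue opA c u u' vs) b"
  unfolding agree_on_def
proof
  fix i assume i: "i \<in> insert m (set S \<union> J)"
  then have n: "i < n" using S J m by auto
  note coordinate = nth_UA[OF subsetD[OF UA(1)] n]
  show "glue opA c u u' vs ! i = b ! i"
  proof (cases "i = m")
    case True
    have "map (\<lambda>x. x ! m) vs = replicate (d - 1) (b ! m)"
      using approx vs by (intro nth_equalityI) (auto simp: agree_on_def)
    then show ?thesis
      using glue_new_coordinate[OF factor[OF n]] coordinate um True by (simp add: glue_nth[OF vs m])
  next
    case False
    then have im: "i < m" using i S J by auto
    obtain j where j: "j < d - 1" and others: "\<And>k. k < d - 1 \<Longrightarrow> k \<noteq> j \<Longrightarrow> vs ! k ! i = b ! i"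
    proof (rule agree_except_one[OF S(1), of i J vs b])
      show "agree_on (set (remove_nth k S) \<union> J) (vs ! k) b" if "k < d - 1" for k
        using approx[OF that] by (rule agree_on_subset) auto
    qed (use i False d_gt_1 in auto)
    have "map (\<lambda>x. x ! i) vs = (replicate (d - 1) (b ! i))[j := vs ! j ! i]"
      using others vs j by (intro nth_equalityI) (auto simp: nth_list_update)
    moreover have "vs ! j ! i \<in> univ (As ! i)" using UA(2) vs j n by (auto intro!: nth_UA)
    moreover have "c ! i = b ! i" "u ! i = u' ! i" using c u im by (auto simp: agree_on_def)
    ultimately show ?thesis
      using glue_old_coordinate[OF factor[OF n]] coordinate j by (simp add: glue_nth[OF vs n])
  qed
qed

lemma fork_transfer:
  assumes B: "subuniverse L (prod_alg As) B" "B \<subseteq> UA" and "r \<in> B" "b \<in> B" "b' \<in> B"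
    and m: "m < n" and prefix: "take m b = take m b'" and rm: "r ! m = b ! m"
  shows "\<exists>t\<in>B. take m t = take m r \<and> t ! m = pow_op d P (As ! m) (b' ! m) (b ! m)"
proof (intro bexI conjI)
  let ?ts = "[b', b, r, b'] @ replicate (d - 1) r"
  let ?t = "opA ?ts"
  show tB: "?t \<in> B"
    by (rule term_op_in_subuniverse[OF B(1) nary_P])
      (use assms(3-5) d_gt_1 in \<open>auto simp: set_replicate_conv_if\<close>)
  have nth: "?t ! i =
      term_op (As ! i) P ([b' ! i, b ! i, r ! i, b' ! i] @ replicate (d - 1) (r ! i))"
    if "i < n" for i
    using opA_nth[of ?ts i] that d_gt_1 by simp
  have coordinate: "s ! i \<in> univ (As ! i)" if "s \<in> B" "i < n" for s i
    using that B(2) by (auto intro: nth_UA)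
  have "?t ! i = r ! i" if "i < m" for i
  proof -
    have "b' ! i = b ! i" using prefix that by (metis nth_take)
    then show ?thesis
      using nth[of i] parallelogram_first[OF factor] coordinate assms(3-5) that m by simp
  qed
  moreover have "length ?t = n" "length r = n" using tB \<open>r \<in> B\<close> B(2) by (auto intro: length_UA)
  ultimately show "take m ?t = take m r" using m by (intro nth_equalityI) auto
  show "?t ! m = pow_op d P (As ! m) (b' ! m) (b ! m)" using nth[OF m] rm by (simp add: pow_op_eq)
qed

end

section \<open>Standardized representations\<close>

lemma
  assumes "standardized_rep d P As B R r F u"
  shows local_designation_in:
      "(I, c) \<in> local_indices d (length As) B \<Longrightarrow> r (I, c) \<in> B"
    and proj_local_designation:
      "(I, c) \<in> local_indices d (length As) B \<Longrightarrow> proj I (r (I, c)) = c"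
    and fork'_subset_designated:
      "d \<le> m \<Longrightarrow> m \<le> length As \<Longrightarrow> fork' d P As m B \<subseteq> F m"
    and fork_designation_in:
      "(m, g) \<in> fork_indices d (length As) F \<Longrightarrow> fst (u (m, g)) \<in> B \<and> snd (u (m, g)) \<in> B"
    and witnesses_fork_designation:
      "(m, g) \<in> fork_indices d (length As) F \<Longrightarrow> witnesses_fork m (u (m, g)) g"
  using assms unfolding standardized_rep_def by (auto simp: mem_Times_iff)

lemma standardized_repI:
  assumes local:
    "\<And>I c. (I, c) \<in> local_indices d (length As) B \<Longrightarrow> r (I, c) \<in> B \<and> proj I (r (I, c)) = c"
    and fork': "\<And>m. d \<le> m \<Longrightarrow> m \<le> length As \<Longrightarrow> fork' d P As m B \<subseteq> F m"
    and witness: "\<And>m g. (m, g) \<in> fork_indices d (length As) F \<Longrightarrow>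
      fst (u (m, g)) \<in> B \<and> snd (u (m, g)) \<in> B \<and> witnesses_fork m (u (m, g)) g"
    and R: "R = r ` local_indices d (length As) B \<union> (\<lambda>h. fst (u h)) ` fork_indices d (length As) F \<union>
      (\<lambda>h. snd (u h)) ` fork_indices d (length As) F"
  shows "standardized_rep d P As B R r F u"
  unfolding standardized_rep_def
proof (intro conjI)
  show "R \<subseteq> B" using local witness unfolding R by auto
  show "\<forall>(I, c)\<in>local_indices d (length As) B. r (I, c) \<in> R \<and> proj I (r (I, c)) = c"
    using local unfolding R by auto
  have in_R: "u h \<in> R \<times> R" if "h \<in> fork_indices d (length As) F" for h
    using that unfolding R mem_Times_iff by blast
  then show "\<forall>(m, g)\<in>fork_indices d (length As) F. u (m, g) \<in> R \<times> R \<and> witnesses_fork m (u (m, g)) g"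
    using witness by auto
  show "\<forall>m. d \<le> m \<and> m \<le> length As \<longrightarrow> fork' d P As m B \<subseteq> F m \<and> F m \<subseteq> fork m R"
  proof (intro allI impI conjI subsetI)
    fix m g assume "d \<le> m \<and> m \<le> length As" and "g \<in> F m"
    then have g: "(m, g) \<in> fork_indices d (length As) F" by (cases g) (auto simp: fork_indices_def)
    have "witnesses_fork m (fst (u (m, g)), snd (u (m, g))) g" using witness[OF g] by simp
    then show "g \<in> fork m R" using in_R[OF g] unfolding fork_def mem_Times_iff by blast
  qed (use fork' in blast)
  show "\<forall>e\<in>R. (\<exists>l\<in>local_indices d (length As) B. e = r l) \<or>
      (\<exists>h\<in>fork_indices d (length As) F. e = fst (u h) \<or> e = snd (u h))"
    unfolding R by blast
qed

definition positions :: "nat set \<Rightarrow> nat list" where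
  "positions I = map (\<lambda>i. i - 1) (sorted_list_of_set I)"

lemma proj_eq_select: "proj I = select (positions I)"
  by (simp add: fun_eq_iff proj_def select_def positions_def)

lemma set_positions: "I \<subseteq> {1..n} \<Longrightarrow> set (positions I) \<subseteq> {..<n}"
  using finite_subset[of I "{1..n}"] by (fastforce simp: positions_def)

lemma length_positions: "length (positions I) = card I"
  by (simp add: positions_def)

lemma map_Suc_positions: "I \<subseteq> {1..n} \<Longrightarrow> map Suc (positions I) = sorted_list_of_set I"
  using finite_subset[of I "{1..n}"] by (auto simp: positions_def intro!: map_idI)

lemma sorted_list_of_set_Suc_image:
  assumes "sorted_wrt (<) (S :: nat list)"
  shows "sorted_list_of_set (Suc ` set S) = map Suc S"
proof -
  have "sorted_wrt (<) (map Suc S)" using assms by (simp add: sorted_wrt_map)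
  then show ?thesis
    using sorted_list_of_set.idem_if_sorted_distinct[of "map Suc S"]
    by (simp add: strict_sorted_iff)
qed

lemma positions_Suc_image: "sorted_wrt (<) S \<Longrightarrow> positions (Suc ` set S) = S"
  by (simp add: positions_def sorted_list_of_set_Suc_image o_def)

locale extension = parallelogram_product L K d P As
  for L :: "'f language" and K :: "('f, 'a) alg set" and d :: nat and P :: "'f trm"
    and As :: "('f, 'a) alg list" +
  fixes B :: "'a list set" and ext :: "nat list \<Rightarrow> 'a list \<Rightarrow> 'a list"
  assumes subuniverse_B: "subuniverse L (prod_alg As) B" and B_subset_UA: "B \<subseteq> UA"
    and ext_in_B: "set js \<subseteq> {..<n} \<Longrightarrow> c \<in> select js ` B \<Longrightarrow> ext js c \<in> B"
    and select_ext: "set js \<subseteq> {..<n} \<Longrightarrow> c \<in> select js ` B \<Longrightarrow> select js (ext js c) = c"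
begin

definition local_choice :: "nat set \<times> 'a list \<Rightarrow> 'a list" where
  "local_choice = (\<lambda>(I, c). ext (positions I) c)"

definition fork_base :: "nat \<Rightarrow> 'a \<Rightarrow> 'a list" where
  "fork_base m \<gamma> = ext [m] [\<gamma>]"

definition fork_tuple :: "nat \<Rightarrow> 'a \<Rightarrow> 'a \<Rightarrow> 'a list" where
  "fork_tuple m \<gamma> \<delta> = take m (fork_base m \<gamma>) @ [\<delta>]"

definition fork_choices :: "nat \<Rightarrow> ('a \<times> 'a) set" where
  "fork_choices m =
      {(\<gamma>, \<delta>). [\<gamma>] \<in> select [m - 1] ` B \<and> fork_tuple (m - 1) \<gamma> \<delta> \<in> select [0..<m] ` B}"

definition fork_witnesses :: "nat \<times> 'a \<times> 'a \<Rightarrow> 'a list \<times> 'a list" where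
  "fork_witnesses = (\<lambda>(m, \<gamma>, \<delta>). (fork_base (m - 1) \<gamma>, ext [0..<m] (fork_tuple (m - 1) \<gamma> \<delta>)))"

lemma length_B: "s \<in> B \<Longrightarrow> length s = n"
  using B_subset_UA by (auto intro: length_UA)

lemma fork_base:
  assumes "m < n" and "[\<gamma>] \<in> select [m] ` B"
  shows "fork_base m \<gamma> \<in> B" and "fork_base m \<gamma> ! m = \<gamma>"
  using ext_in_B[of "[m]" "[\<gamma>]"] select_ext[of "[m]" "[\<gamma>]"] assms
  by (auto simp: fork_base_def select_def)

lemma fork_witnesses:
  assumes m: "0 < m" "m \<le> n" and g: "(\<gamma>, \<delta>) \<in> fork_choices m"
  shows "fst (fork_witnesses (m, \<gamma>, \<delta>)) \<in> B \<and> snd (fork_witnesses (m, \<gamma>, \<delta>)) \<in> B \<and>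
    witnesses_fork m (fork_witnesses (m, \<gamma>, \<delta>)) (\<gamma>, \<delta>)"
proof -
  obtain k where k: "m = Suc k" "k < n" using m by (cases m) auto
  have base: "fork_base k \<gamma> \<in> B" "fork_base k \<gamma> ! k = \<gamma>"
    using fork_base[OF k(2)] g k(1) by (auto simp: fork_choices_def)
  have js: "set [0..<m] \<subseteq> {..<n}" and tuple: "fork_tuple k \<gamma> \<delta> \<in> select [0..<m] ` B"
    using m g by (auto simp: fork_choices_def k(1))
  let ?s = "ext [0..<m] (fork_tuple k \<gamma> \<delta>)"
  have s: "?s \<in> B" "select [0..<m] ?s = fork_tuple k \<gamma> \<delta>"
    using ext_in_B[OF js tuple] select_ext[OF js tuple] .
  have "take m ?s = take k (fork_base k \<gamma>) @ [\<delta>]"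
    using s m length_B by (simp add: select_upt fork_tuple_def)
  then have "take k ?s @ [?s ! k] = take k (fork_base k \<gamma>) @ [\<delta>]"
    using length_B[OF s(1)] k by (simp add: take_Suc_conv_app_nth)
  then show ?thesis using base s(1) k(1) by (simp add: fork_witnesses_def witnesses_fork_def)
qed

lemma fork'_subset_fork_choices:
  assumes "0 < m" "m \<le> n"
  shows "fork' d P As m B \<subseteq> fork_choices m"
proof
  obtain k where k: "m = Suc k" "k < n" using assms by (cases m) auto
  fix x assume "x \<in> fork' d P As m B"
  then obtain b b' where x: "x = (b ! k, pow_op d P (As ! k) (b' ! k) (b ! k))"
    and b: "b \<in> B" "b' \<in> B"
    and prefix: "take k b = take k b'"
    unfolding fork'_def fork_def witnesses_fork_def by (auto simp: k(1))
  have base_mem: "[b ! k] \<in> select [k] ` B" using b(1) by (auto simp: select_def)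
  note base = fork_base[OF k(2) base_mem]
  obtain t where t: "t \<in> B" "take k t = take k (fork_base k (b ! k))"
    "t ! k = pow_op d P (As ! k) (b' ! k) (b ! k)"
    using fork_transfer[OF subuniverse_B B_subset_UA base(1) b k(2) prefix base(2)] by blast
  have "select [0..<m] t = fork_tuple k (b ! k) (pow_op d P (As ! k) (b' ! k) (b ! k))"
    using t length_B[OF t(1)] k
    by (simp add: select_upt fork_tuple_def take_Suc_conv_app_nth del: upt_Suc)
  then show "x \<in> fork_choices m"
    using base_mem t(1) unfolding x fork_choices_def k(1) by (auto intro!: rev_image_eqI[of t])
qed

lemma local_choice:
  assumes "(I, c) \<in> local_indices d n B"
  shows "local_choice (I, c) \<in> B \<and> proj I (local_choice (I, c)) = c"
proof -
  have I: "set (positions I) \<subseteq> {..<n}" "c \<in> select (positions I) ` B"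
    using assms set_positions unfolding local_indices_def proj_eq_select by auto
  show ?thesis using ext_in_B[OF I] select_ext[OF I] by (simp add: local_choice_def proj_eq_select)
qed

lemma standardized_rep_of_extension:
  "\<exists>R. standardized_rep d P As B R local_choice fork_choices fork_witnesses"
proof (rule exI, rule standardized_repI[OF local_choice _ _ refl])
  show "fork' d P As m B \<subseteq> fork_choices m" if "d \<le> m" "m \<le> n" for m
    using fork'_subset_fork_choices that d_gt_1 by simp
  show "fst (fork_witnesses (m, g)) \<in> B \<and> snd (fork_witnesses (m, g)) \<in> B \<and>
      witnesses_fork m (fork_witnesses (m, g)) g"
    if "(m, g) \<in> fork_indices d n fork_choices" for m g
  proof (cases g)
    case (Pair \<gamma> \<delta>)
    then show ?thesis using fork_witnesses[of m \<gamma> \<delta>] that d_gt_1 by (auto simp: fork_indices_def)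
  qed
qed

end

section \<open>Coded instances and representations\<close>

type_synonym coded_gens = "val list \<times> val list list"

text \<open>The unit components stand for the ends of the lists in which the components of an entry are
  written down.\<close>

type_synonym coded_rep =
  "(nat list \<times> val list \<times> val list \<times> unit) list \<times>
    (nat \<times> val \<times> val \<times> val list \<times> val list \<times> unit) list"

definition coded_gens ::
  "(('f, 'a) alg \<Rightarrow> val) \<Rightarrow> ('a \<Rightarrow> val) \<Rightarrow> ('f, 'a) alg list \<Rightarrow> 'a list list \<Rightarrow> coded_gens" where
  "coded_gens ca ce As as = (map ca As, map (map ce) as)"

definition coded_local ::
  "('a \<Rightarrow> val) \<Rightarrow> (nat set \<times> 'a list \<Rightarrow> 'a list) \<Rightarrow> nat set \<times> 'a list \<Rightarrow>
   nat list \<times> val list \<times> val list \<times> unit" where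
  "coded_local ce r = (\<lambda>(I, c). (sorted_list_of_set I, map ce c, map ce (r (I, c)), ()))"

definition coded_fork ::
  "('a \<Rightarrow> val) \<Rightarrow> (nat \<times> 'a \<times> 'a \<Rightarrow> 'a list \<times> 'a list) \<Rightarrow> nat \<times> 'a \<times> 'a \<Rightarrow>
   nat \<times> val \<times> val \<times> val list \<times> val list \<times> unit" where
  "coded_fork ce u = (\<lambda>(m, \<gamma>, \<delta>). (m, ce \<gamma>, ce \<delta>, map ce (fst (u (m, \<gamma>, \<delta>))),
     map ce (snd (u (m, \<gamma>, \<delta>))), ()))"

lemma encode_tuple: "encode (map ce t) = enc_tuple ce t"
  by (simp add: encode_list enc_tuple_def o_def)

lemma encode_coded_gens: "encode (coded_gens ca ce As as) = enc_gens ca ce As as"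
  by (simp add: coded_gens_def enc_gens_def encode_list enc_tuple_def o_def)

lemma encodes_rep_iff:
  "encodes_rep ce d n B r F u v \<longleftrightarrow> (\<exists>ls fs.
     distinct ls \<and> set ls = local_indices d n B \<and> distinct fs \<and> set fs = fork_indices d n F \<and>
     v = encode (map (coded_local ce r) ls, map (coded_fork ce u) fs))"
proof -
  have "encode (map (coded_local ce r) ls) = enc_list (map (\<lambda>(I, c). enc_list
      [enc_list (map enc_nat (sorted_list_of_set I)), enc_tuple ce c, enc_tuple ce (r (I, c))]) ls)"
    for ls
    by (induction ls)
      (auto simp: coded_local_def encode_tuple encode_list[where 'a = nat] encode_nat o_def)
  moreover have "encode (map (coded_fork ce u) fs) = enc_list (map (\<lambda>(m, \<gamma>, \<delta>). enc_list
      [enc_nat m, ce \<gamma>, ce \<delta>, enc_tuple ce (fst (u (m, \<gamma>, \<delta>))),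
          enc_tuple ce (snd (u (m, \<gamma>, \<delta>)))]) fs)"
    for fs
    by (induction fs) (auto simp: coded_fork_def encode_tuple encode_nat)
  ultimately show ?thesis unfolding encodes_rep_def encode_Pair by simp
qed

locale coded = parallelogram L K d P
  for L :: "'f language" and K :: "('f, 'a) alg set" and d :: nat and P :: "'f trm" +
  fixes ca :: "('f, 'a) alg \<Rightarrow> val" and ce :: "'a \<Rightarrow> val"
  assumes finite_K: "finite K" and finite_univ: "A \<in> K \<Longrightarrow> finite (univ A)"
    and inj_ca: "inj_on ca K" and inj_ce: "inj_on ce (\<Union>A\<in>K. univ A)"
begin

abbreviation carriers where "carriers \<equiv> \<Union>A\<in>K. univ A"

lemma finite_carriers: "finite carriers"
  using finite_K finite_univ by auto

lemma ce_eq_iff: "a \<in> carriers \<Longrightarrow> a' \<in> carriers \<Longrightarrow> ce a = ce a' \<longleftrightarrow> a = a'"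
  using inj_ce by (rule inj_on_eq_iff)

lemma map_ce_eq_iff: "set s \<subseteq> carriers \<Longrightarrow> set t \<subseteq> carriers \<Longrightarrow> map ce s = map ce t \<longleftrightarrow> s = t"
  using inj_on_map_eq_map[OF inj_on_subset[OF inj_ce, of "set s \<union> set t"]] by simp

definition op_domain :: "(('f, 'a) alg \<times> 'a list) set" where
  "op_domain = (SIGMA A:K. {ts. set ts \<subseteq> univ A \<and> length ts = d + 3})"

definition coded_op :: "val \<times> val list \<Rightarrow> val" where
  "coded_op = table (\<lambda>(A, ts). (ca A, map ce ts)) op_domain (\<lambda>(A, ts). ce (term_op A P ts)) Leaf"

lemma finite_op_domain: "finite op_domain"
  unfolding op_domain_def by (intro finite_SigmaI finite_K finite_lists_length_eq finite_univ)

lemma poly_time_coded_op: "poly_time Q g \<Longrightarrow> poly_time Q (\<lambda>x. coded_op (g x))"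
  unfolding coded_op_def
  by (rule poly_time_cofinitely_const[OF finite_table_neq[OF finite_op_domain]])

lemma coded_op_eq:
  assumes "A \<in> K" "set ts \<subseteq> univ A" "length ts = d + 3"
  shows "coded_op (ca A, map ce ts) = ce (term_op A P ts)"
proof -
  have "inj_on (\<lambda>(A, ts). (ca A, map ce ts)) op_domain"
  proof (rule inj_onI)
    fix x y assume xy: "x \<in> op_domain" "y \<in> op_domain"
      "(case x of (A, ts) \<Rightarrow> (ca A, map ce ts)) = (case y of (A, ts) \<Rightarrow> (ca A, map ce ts))"
    obtain A ts A' ts' where [simp]: "x = (A, ts)" "y = (A', ts')" by (cases x, cases y)
    have K: "A \<in> K" "A' \<in> K" "set ts \<subseteq> univ A" "set ts' \<subseteq> univ A'"
      using xy by (auto simp: op_domain_def)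
    then have "A = A'" using xy(3) inj_on_eq_iff[OF inj_ca] by simp
    moreover have "ts = ts'" using K xy(3) map_ce_eq_iff[of ts ts'] by auto
    ultimately show "x = y" by simp
  qed
  then show ?thesis
    using table_code[of _ op_domain "(A, ts)" "\<lambda>(A, ts). ce (term_op A P ts)" Leaf] assms
    by (force simp: coded_op_def op_domain_def)
qed

definition coded_term_op :: "val list \<Rightarrow> val list list \<Rightarrow> val list" where
  "coded_term_op cs ts =
     map (\<lambda>i. coded_op (nth_default Leaf cs i, map (\<lambda>t. nth_default Leaf t i) ts)) [0..<length cs]"

lemma poly_time_coded_term_op:
  assumes "poly_time Q cs" "poly_time Q ts"
  shows "poly_time Q (\<lambda>x. coded_term_op (cs x) (ts x))"
  unfolding coded_term_op_def
  by (intro poly_time_intros poly_time_coded_op assms[THEN poly_time_comp[rotated]])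

definition op_size :: nat where
  "op_size = Max (range (\<lambda>z. vsize (coded_op z)))"

lemma vsize_coded_op_le: "vsize (coded_op z) \<le> op_size"
proof -
  have "finite (vsize ` range coded_op)"
    unfolding coded_op_def by (intro finite_imageI finite_range_table finite_op_domain)
  then show ?thesis unfolding op_size_def by (intro Max_ge) (auto simp: image_image)
qed

lemma esize_coded_term_op_le: "esize (coded_term_op cs ts) \<le> esize cs * (op_size + 1) + 1"
  by (rule esize_list_le)
    (auto simp: coded_term_op_def vsize_coded_op_le length_less_esize less_imp_le)

definition code_size :: nat where
  "code_size = Max (insert 0 ((\<lambda>a. vsize (ce a)) ` carriers))"

definition tuple_size :: "nat \<Rightarrow> nat" where
  "tuple_size k = k * (code_size + 1) + 1"

lemma vsize_ce_le: "a \<in> carriers \<Longrightarrow> vsize (ce a) \<le> code_size"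
  unfolding code_size_def using finite_carriers by (intro Max_ge) auto

lemma esize_map_ce_le: "set t \<subseteq> carriers \<Longrightarrow> esize (map ce t) \<le> tuple_size (length t)"
  unfolding tuple_size_def
  by (rule esize_list_le) (auto simp: subset_iff simp del: UN_iff intro!: vsize_ce_le)

definition rep_size :: "nat \<Rightarrow> nat" where
  "rep_size n =
     n ^ (d - 1) * card carriers ^ (d - 1) *
         ((d - 1) * (2 * n + 2) + tuple_size (d - 1) + tuple_size n + 6) +
     (n + 1) * card carriers ^ 2 * (2 * n + 2 * code_size + 2 * tuple_size n + 8) + 3"

lemma rep_size_mono: "m \<le> n \<Longrightarrow> rep_size m \<le> rep_size n"
  unfolding rep_size_def tuple_size_def by (intro add_mono mult_mono power_mono) auto

lemma poly_bounded_rep_size: "poly_bounded B \<Longrightarrow> poly_bounded (\<lambda>x. rep_size (B x))"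
  unfolding rep_size_def tuple_size_def by (intro poly_bounded_intros)

end

locale coded_instance = coded L K d P ca ce
  for L :: "'f language" and K :: "('f, 'a) alg set" and d :: nat and P :: "'f trm"
    and ca :: "('f, 'a) alg \<Rightarrow> val" and ce :: "'a \<Rightarrow> val" +
  fixes As :: "('f, 'a) alg list" and as :: "'a list list"
  assumes valid: "valid_gens K As as"
begin

sublocale parallelogram_product L K d P As
  by unfold_locales (use valid in \<open>simp add: valid_gens_def\<close>)

abbreviation B where "B \<equiv> Sg L (prod_alg As) (set as)"

lemma As_nonempty: "As \<noteq> []" and as_nonempty: "as \<noteq> []" and as_UA: "set as \<subseteq> UA"
  using valid by (auto simp: valid_gens_def)

lemma B_subset_UA: "B \<subseteq> UA"
  by (rule Sg_subset_subuniverse[OF subuniverse_UA as_UA])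

lemma length_B: "t \<in> B \<Longrightarrow> length t = n"
  using B_subset_UA by (auto intro: length_UA)

lemma nth_carriers: "t \<in> UA \<Longrightarrow> i < n \<Longrightarrow> t ! i \<in> carriers"
  using nth_UA factor by blast

lemma map_ce_UA_eq_iff: "s \<in> UA \<Longrightarrow> t \<in> UA \<Longrightarrow> map ce s = map ce t \<longleftrightarrow> s = t"
  using map_ce_eq_iff set_UA by blast

lemma coded_term_op_eq:
  assumes "length ts = d + 3" "set ts \<subseteq> UA"
  shows "coded_term_op (map ca As) (map (map ce) ts) = map ce (opA ts)"
proof (rule nth_equalityI)
  have len: "length (opA ts) = n" using length_UA[OF opA_in_UA[OF assms]] .
  then show "length (coded_term_op (map ca As) (map (map ce) ts)) = length (map ce (opA ts))"
    by (simp add: coded_term_op_def)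
  fix i assume "i < length (coded_term_op (map ca As) (map (map ce) ts))"
  then have i: "i < n" by (simp add: coded_term_op_def)
  have "map (\<lambda>t. nth_default Leaf t i) (map (map ce) ts) = map ce (map (\<lambda>t. t ! i) ts)"
    using assms(2) i length_UA by (auto simp: nth_default_nth subset_iff)
  moreover have "coded_op (ca (As ! i), map ce (map (\<lambda>t. t ! i) ts)) =
      ce (term_op (As ! i) P (map (\<lambda>t. t ! i) ts))"
    using assms nth_UA i by (intro coded_op_eq factor) (auto simp: subset_iff)
  ultimately show "coded_term_op (map ca As) (map (map ce) ts) ! i = map ce (opA ts) ! i"
    using i len opA_nth[OF assms(1) i] by (simp add: coded_term_op_def nth_default_nth del: map_map)
qed

lemma glue_coded:
  assumes "{c, u, u'} \<subseteq> B" "set vs \<subseteq> B" "length vs = d - 1"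
  shows "glue opA c u u' vs \<in> B" (is ?in)
    and "glue (coded_term_op (map ca As)) (map ce c) (map ce u) (map ce u') (map (map ce) vs) =
      map ce (glue opA c u u' vs)" (is ?coded)
proof -
  have nonempty: "vs \<noteq> []" using assms(3) d_gt_1 by auto
  have "opA ts \<in> B \<and> map ce (opA ts) = coded_term_op (map ca As) (map (map ce) ts)"
    if "length ts = length vs + 4" "set ts \<subseteq> B" for ts
  proof -
    have "length ts = d + 3" "set ts \<subseteq> UA" using that assms(3) d_gt_1 B_subset_UA by auto
    then show ?thesis
      using term_op_in_subuniverse[OF subuniverse_Sg nary_P _ that(2)] coded_term_op_eq by simp
  qed
  from glue_hom[where p = opA and q = "coded_term_op (map ca As)" and \<phi> = "map ce",
      OF this assms(1,2) nonempty]
  show ?in ?coded by auto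
qed

lemma proj_B:
  assumes "I \<subseteq> {1..n}" and "c \<in> proj I ` B"
  shows "set c \<subseteq> carriers" and "length c = card I"
proof -
  obtain t where t: "t \<in> B" "c = select (positions I) t"
    using assms(2) by (auto simp: proj_eq_select)
  have "set (positions I) \<subseteq> {..<length t}"
    using set_positions[OF assms(1)] length_B[OF t(1)] by simp
  from set_select_subset[OF this] show "set c \<subseteq> carriers"
    using set_UA[of t] t B_subset_UA by blast
  show "length c = card I" using t(2) by (simp add: length_positions)
qed

lemma card_local_indices_le: "card (local_indices d n B) \<le> n ^ (d - 1) * card carriers ^ (d - 1)"
proof -
  let ?S = "{l. set l \<subseteq> {1..n} \<and> length l = d - 1} \<times> {c. set c \<subseteq> carriers \<and> length c = d - 1}"
  have fin: "finite ?S"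
    by (intro finite_cartesian_product finite_lists_length_eq finite_carriers) simp
  have "local_indices d n B \<subseteq> (\<lambda>(l, c). (set l, c)) ` ?S"
  proof
    fix x assume "x \<in> local_indices d n B"
    then obtain I c where x: "x = (I, c)" and I: "I \<subseteq> {1..n}" "card I = d - 1" "c \<in> proj I ` B"
      by (auto simp: local_indices_def)
    have "finite I" using I(1) finite_subset by blast
    then show "x \<in> (\<lambda>(l, c). (set l, c)) ` ?S"
      using I proj_B[OF I(1,3)]
      by (intro image_eqI[of _ _ "(sorted_list_of_set I, c)"]) (auto simp: x)
  qed
  from surj_card_le[OF fin this] show ?thesis
    by (simp add: card_cartesian_product card_lists_length_eq finite_carriers)
qed

context
  fixes R r F u
  assumes rep: "standardized_rep d P As B R r F u"
begin

lemma fork_indices_subset: "fork_indices d n F \<subseteq> {..n} \<times> carriers \<times> carriers"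
proof
  fix x assume x: "x \<in> fork_indices d n F"
  then obtain m \<gamma> \<delta> where x_eq: "x = (m, \<gamma>, \<delta>)" and m: "d \<le> m" "m \<le> n"
    by (auto simp: fork_indices_def)
  have "fst (u x) ! (m - 1) = \<gamma>" "snd (u x) ! (m - 1) = \<delta>"
    using witnesses_fork_designation[OF rep] x by (auto simp: x_eq witnesses_fork_def)
  moreover have "fst (u x) \<in> UA" "snd (u x) \<in> UA"
    using fork_designation_in[OF rep] x B_subset_UA by (auto simp: x_eq)
  ultimately show "x \<in> {..n} \<times> carriers \<times> carriers"
    using nth_carriers[of _ "m - 1"] m d_gt_1 unfolding x_eq by fastforce
qed

lemma card_fork_indices_le: "card (fork_indices d n F) \<le> (n + 1) * card carriers ^ 2"
proof -
  have "card (fork_indices d n F) \<le> card ({..n} \<times> carriers \<times> carriers)"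
    by (intro card_mono fork_indices_subset finite_cartesian_product finite_carriers) simp
  then show ?thesis by (simp add: card_cartesian_product power2_eq_square)
qed

lemma esize_B_le: "t \<in> B \<Longrightarrow> esize (map ce t) \<le> tuple_size n"
  using esize_map_ce_le[of t] set_UA[of t] length_B[of t] B_subset_UA by auto

lemma esize_coded_local_le:
  assumes "(I, c) \<in> local_indices d n B"
  shows "esize (coded_local ce r (I, c)) \<le>
    (d - 1) * (2 * n + 2) + tuple_size (d - 1) + tuple_size n + 5"
proof -
  have I: "I \<subseteq> {1..n}" "card I = d - 1" "c \<in> proj I ` B"
    using assms by (auto simp: local_indices_def)
  have "finite I" using I(1) finite_subset by blast
  then have "esize (sorted_list_of_set I) \<le> (d - 1) * ((2 * n + 1) + 1) + 1"
    by (intro esize_list_le) (use I in auto)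
  moreover have "esize (map ce c) \<le> tuple_size (d - 1)"
    using esize_map_ce_le[OF proj_B(1)[OF I(1,3)]] proj_B(2)[OF I(1,3)] I(2) by simp
  moreover have "esize (map ce (r (I, c))) \<le> tuple_size n"
    by (intro esize_B_le local_designation_in[OF rep] assms)
  ultimately show ?thesis by (simp add: coded_local_def)
qed

lemma esize_coded_fork_le:
  assumes "h \<in> fork_indices d n F"
  shows "esize (coded_fork ce u h) \<le> 2 * n + 2 * code_size + 2 * tuple_size n + 7"
proof (cases h)
  case (fields m \<gamma> \<delta>)
  then have "m \<le> n" "vsize (ce \<gamma>) \<le> code_size" "vsize (ce \<delta>) \<le> code_size"
    using subsetD[OF fork_indices_subset assms] by (auto intro: vsize_ce_le)
  moreover have "esize (map ce (fst (u h))) \<le> tuple_size n"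
    "esize (map ce (snd (u h))) \<le> tuple_size n"
    using fork_designation_in[OF rep] assms fields by (auto intro!: esize_B_le)
  ultimately show ?thesis by (simp add: coded_fork_def fields)
qed

lemma encodes_rep_vsize_le:
  assumes "encodes_rep ce d n B r F u v"
  shows "vsize v \<le> rep_size n"
proof -
  obtain ls fs where ls: "distinct ls" "set ls = local_indices d n B"
    and fs: "distinct fs" "set fs = fork_indices d n F"
    and v: "v = encode (map (coded_local ce r) ls, map (coded_fork ce u) fs)"
    using assms unfolding encodes_rep_iff by blast
  have "esize (map (coded_local ce r) ls) \<le> n ^ (d - 1) * card carriers ^ (d - 1) *
      ((d - 1) * (2 * n + 2) + tuple_size (d - 1) + tuple_size n + 5 + 1) + 1"
    using ls esize_coded_local_le card_local_indices_le distinct_card[OF ls(1)]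
    by (intro esize_list_le) auto
  moreover have "esize (map (coded_fork ce u) fs) \<le>
      (n + 1) * card carriers ^ 2 * (2 * n + 2 * code_size + 2 * tuple_size n + 7 + 1) + 1"
    using fs esize_coded_fork_le card_fork_indices_le distinct_card[OF fs(1)]
    by (intro esize_list_le) auto
  ultimately show ?thesis unfolding v rep_size_def by (simp add: algebra_simps)
qed

end

end

context coded
begin

lemma coded_instanceI: "valid_gens K As as \<Longrightarrow> coded_instance L K d P ca ce As as"
  by unfold_locales

lemma coded_gens_inject:
  assumes "valid_gens K As as" "valid_gens K As' as'"
    "coded_gens ca ce As as = coded_gens ca ce As' as'"
  shows "As = As'" and "as = as'"
proof -
  interpret i: coded_instance L K d P ca ce As as by (rule coded_instanceI) fact
  interpret i': coded_instance L K d P ca ce As' as' by (rule coded_instanceI) fact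
  have "inj_on ca (set As \<union> set As')"
    by (rule inj_on_subset[OF inj_ca]) (use i.factors i'.factors in auto)
  then show "As = As'" using assms(3) unfolding coded_gens_def by (auto dest: inj_on_map_eq_map)
  have "inj_on (map ce) (set as \<union> set as')"
  proof (rule inj_onI)
    fix s t assume "s \<in> set as \<union> set as'" "t \<in> set as \<union> set as'" "map ce s = map ce t"
    moreover have "set s \<subseteq> carriers" if "s \<in> set as \<union> set as'" for s
      using that i.set_UA[of s] i'.set_UA[of s] i.as_UA i'.as_UA by blast
    ultimately show "s = t" using map_ce_eq_iff by blast
  qed
  then show "as = as'" using assms(3) unfolding coded_gens_def by (auto dest: inj_on_map_eq_map)
qed

lemma CompactRep_solution_size:
  "\<exists>q :: nat poly. \<forall>x\<in>instances (CompactRep d P L K ca ce).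
     \<forall>y\<in>solutions (CompactRep d P L K ca ce) x. vsize y \<le> poly q (vsize x)"
proof -
  have "poly_bounded (\<lambda>x :: val. rep_size (vsize x))"
    using poly_bounded_rep_size[OF poly_bounded_esize[where 'a = val]] by simp
  then obtain q where q: "\<And>x. rep_size (vsize x) \<le> poly q (vsize x)"
    unfolding poly_bounded_def by auto
  show ?thesis
  proof (intro exI[of _ q] ballI)
    fix x y assume "y \<in> solutions (CompactRep d P L K ca ce) x"
    then obtain As as R r F u where x: "x = enc_gens ca ce As as" and valid: "valid_gens K As as"
      and rep: "standardized_rep d P As (Sg L (prod_alg As) (set as)) R r F u"
      and enc: "encodes_rep ce d (length As) (Sg L (prod_alg As) (set as)) r F u y"
      unfolding CompactRep_def by auto
    interpret coded_instance L K d P ca ce As as by (rule coded_instanceI[OF valid])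
    have "vsize y \<le> rep_size n" by (rule encodes_rep_vsize_le[OF rep enc])
    also have "\<dots> \<le> rep_size (vsize x)"
    proof (rule rep_size_mono)
      have "n < esize (map ca As)" using length_less_esize[of "map ca As"] by simp
      also have "\<dots> \<le> vsize x" by (simp add: x coded_gens_def flip: encode_coded_gens)
      finally show "n \<le> vsize x" by simp
    qed
    also note q
    finally show "vsize y \<le> poly q (vsize x)" .
  qed
qed

end

section \<open>Deciding membership with a standardized representation\<close>

lemma foldl_upt_induct [consumes 1, case_names base step]:
  assumes "k \<le> n" and "I k a" and "\<And>i a. k \<le> i \<Longrightarrow> i < n \<Longrightarrow> I i a \<Longrightarrow> I (Suc i) (f a i)"
  shows "I n (foldl f a [k..<n])"
  using assms by (induction n rule: dec_induct) auto

lemma foldl_rev_upt_induct [case_names base step]: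
  assumes "I n a" and "\<And>i a. i < n \<Longrightarrow> I (Suc i) a \<Longrightarrow> I i (f a i)"
  shows "I 0 (foldl f a (rev [0..<n]))"
  using assms by (induction n arbitrary: a) auto

type_synonym decision_input = "(coded_gens \<times> val list) \<times> coded_rep"

abbreviation factor_codes :: "decision_input \<Rightarrow> val list" where
  "factor_codes z \<equiv> fst (fst (fst z))"

abbreviation target :: "decision_input \<Rightarrow> val list" where
  "target z \<equiv> snd (fst z)"

abbreviation "fst_witness e \<equiv> fst (snd (snd (snd e)))"
abbreviation "snd_witness e \<equiv> fst (snd (snd (snd (snd e))))"

definition default_tuple :: "decision_input \<Rightarrow> val list" where
  "default_tuple z = hd (snd (fst (fst z)) @ [[]])"

definition local_tuples :: "decision_input \<Rightarrow> val list list" where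
  "local_tuples z = map (\<lambda>e. fst (snd (snd e))) (fst (snd z))"

text \<open>Falling back on a generator keeps all computed tuples in the subalgebra, whether or not the
  target belongs to it.\<close>

definition lookup :: "decision_input \<Rightarrow> nat list \<Rightarrow> val list list \<Rightarrow> val list" where
  "lookup z J T = find_default
     (\<lambda>t. \<forall>j\<in>set J. nth_default Leaf t j = nth_default Leaf (target z) j) (default_tuple z) T"

lemma poly_time_default_tuple: "poly_time Q z \<Longrightarrow> poly_time Q (\<lambda>x. default_tuple (z x))"
  unfolding default_tuple_def by (intro poly_time_intros)

lemma poly_time_local_tuples: "poly_time Q z \<Longrightarrow> poly_time Q (\<lambda>x. local_tuples (z x))"
  unfolding local_tuples_def by (intro poly_time_intros)

lemma poly_time_lookup:
  assumes "poly_time Q z" "poly_time Q J" "poly_time Q T"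
  shows "poly_time Q (\<lambda>x. lookup (z x) (J x) (T x))"
  unfolding lookup_def
  by (intro poly_time_intros poly_time_default_tuple assms[THEN poly_time_comp[rotated]])

lemma lookup_in: "lookup z J T \<in> insert (default_tuple z) (set T)"
  unfolding lookup_def by (rule find_default_in)

context coded
begin

definition coded_pow :: "val \<Rightarrow> val \<Rightarrow> val \<Rightarrow> val" where
  "coded_pow A x y = coded_op (A, [x, y, y, x] @ replicate (d - 1) y)"

lemma coded_pow_eq:
  assumes "A \<in> K" "x \<in> univ A" "y \<in> univ A"
  shows "coded_pow (ca A) (ce x) (ce y) = ce (pow_op d P A x y)"
  using coded_op_eq[OF assms(1), of "[x, y, y, x] @ replicate (d - 1) y"] assms d_gt_1
  by (simp add: coded_pow_def pow_op_eq set_replicate_conv_if)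

definition approximants ::
  "decision_input \<Rightarrow> nat list \<Rightarrow> val list list \<Rightarrow> nat list \<Rightarrow> val list list" where
  "approximants z J T S = map (\<lambda>j. lookup z (remove_nth j S @ J) T) [0..<d - 1]"

definition fork_entry ::
  "decision_input \<Rightarrow> val list \<Rightarrow> nat \<Rightarrow> nat \<times> val \<times> val \<times> val list \<times> val list \<times> unit" where
  "fork_entry z c m = find_default
     (\<lambda>e. fst e = Suc m \<and> fst (snd e) = nth_default Leaf (target z) m \<and>
       fst (snd (snd e)) = coded_pow (nth_default Leaf (factor_codes z) m)
         (nth_default Leaf c m) (nth_default Leaf (target z) m))
     (0, Leaf, Leaf, default_tuple z, default_tuple z, ()) (snd (snd z))"

definition refine :: "decision_input \<Rightarrow> val list \<Rightarrow> nat \<Rightarrow> val list list \<Rightarrow> nat \<Rightarrow> val list list" where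
  "refine z c m T i = map (\<lambda>S. glue (coded_term_op (factor_codes z)) c
       (fst_witness (fork_entry z c m)) (snd_witness (fork_entry z c m))
       (approximants z [Suc i..<Suc m] T (i # S)))
     (List.n_lists (d - 2) [0..<length (factor_codes z)])"

definition sweep :: "decision_input \<Rightarrow> val list \<Rightarrow> nat \<Rightarrow> val list list" where
  "sweep z c m = foldl (\<lambda>T i. refine z c m T i) (local_tuples z) (rev [0..<m])"

definition advance :: "decision_input \<Rightarrow> val list \<Rightarrow> nat \<Rightarrow> val list" where
  "advance z c m = lookup z [0..<Suc m] (sweep z c m)"

definition approach :: "decision_input \<Rightarrow> val list" where
  "approach z = foldl (\<lambda>c m. advance z c m) (lookup z [0..<d - 1] (local_tuples z))
     [d - 1..<length (factor_codes z)]"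

definition decide :: "decision_input \<Rightarrow> bool" where
  "decide z \<longleftrightarrow> approach z = target z"

lemma poly_time_coded_pow:
  assumes "poly_time Q A" "poly_time Q a" "poly_time Q b"
  shows "poly_time Q (\<lambda>x. coded_pow (A x) (a x) (b x))"
  unfolding coded_pow_def by (intro poly_time_intros poly_time_coded_op assms)

lemma poly_time_approximants:
  assumes "poly_time Q z" "poly_time Q J" "poly_time Q T" "poly_time Q S"
  shows "poly_time Q (\<lambda>x. approximants (z x) (J x) (T x) (S x))"
  unfolding approximants_def remove_nth_def
  by (intro poly_time_intros poly_time_lookup assms[THEN poly_time_comp[rotated]])

lemma approximants_nonempty: "approximants z J T S \<noteq> []"
  using d_gt_1 by (simp add: approximants_def)

lemma poly_time_fork_entry:
  assumes "poly_time Q z" "poly_time Q c" "poly_time Q m"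
  shows "poly_time Q (\<lambda>x. fork_entry (z x) (c x) (m x))"
  unfolding fork_entry_def
  by (intro poly_time_intros poly_time_default_tuple poly_time_coded_pow
      assms[THEN poly_time_comp[rotated]])

lemma poly_time_glue:
  assumes "poly_time Q cs" "poly_time Q c" "poly_time Q u" "poly_time Q u'" "poly_time Q vs"
    and "\<And>x. vs x \<noteq> []"
  shows "poly_time Q (\<lambda>x. glue (coded_term_op (cs x)) (c x) (u x) (u' x) (vs x))"
  unfolding glue_def Let_def
  by (intro poly_time_intros poly_time_coded_term_op poly_time_hd assms
      assms(5)[THEN poly_time_comp[rotated]])

lemma poly_time_refine:
  assumes "poly_time Q z" "poly_time Q c" "poly_time Q m" "poly_time Q T" "poly_time Q i"
  shows "poly_time Q (\<lambda>x. refine (z x) (c x) (m x) (T x) (i x))"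
  unfolding refine_def
  by (intro poly_time_intros poly_time_glue poly_time_fork_entry poly_time_approximants
      approximants_nonempty assms[THEN poly_time_comp[rotated]])

lemma glue_in_range: "glue p c u u' vs \<in> range p"
  by (simp add: glue_def Let_def)

lemma refine_subset_range: "set (refine z c m T i) \<subseteq> range (coded_term_op (factor_codes z))"
  unfolding refine_def by (auto intro: glue_in_range)

lemma esize_refine_le:
  "esize (refine z c m T i) \<le>
     esize (factor_codes z) ^ (d - 2) * (esize (factor_codes z) * (op_size + 1) + 1 + 1) + 1"
proof (rule esize_list_le)
  fix t assume "t \<in> set (refine z c m T i)"
  then have "t \<in> range (coded_term_op (factor_codes z))" using refine_subset_range by blast
  then show "esize t \<le> esize (factor_codes z) * (op_size + 1) + 1"
    using esize_coded_term_op_le by auto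
next
  show "length (refine z c m T i) \<le> esize (factor_codes z) ^ (d - 2)"
    using length_less_esize[of "factor_codes z"]
    by (auto simp: refine_def length_n_lists intro!: power_mono)
qed

lemma poly_time_sweep:
  assumes z: "poly_time Q z" and c: "poly_time Q c" and m: "poly_time Q m"
  shows "poly_time Q (\<lambda>x. sweep (z x) (c x) (m x))"
  unfolding sweep_def
proof (rule poly_time_foldl_additive)
  show "poly_time Q (\<lambda>y. refine (z (snd (snd y))) (c (snd (snd y))) (m (snd (snd y)))
      (fst y) (fst (snd y)))"
    by (intro poly_time_intros poly_time_refine assms[THEN poly_time_comp[rotated]])
  have "poly_time Q (\<lambda>x. factor_codes (z x))" by (intro poly_time_intros z)
  from poly_bounded_poly_time[OF this]
  show "poly_bounded (\<lambda>x. esize (factor_codes (z x)) ^ (d - 2) *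
      (esize (factor_codes (z x)) * (op_size + 1) + 1 + 1) + 1)"
    by (intro poly_bounded_intros)
  show "esize (refine (z x) (c x) (m x) T i) \<le> esize T + (esize (factor_codes (z x)) ^ (d - 2) *
      (esize (factor_codes (z x)) * (op_size + 1) + 1 + 1) + 1)" for x T i
    using esize_refine_le by (rule trans_le_add2)
qed (intro poly_time_intros poly_time_local_tuples assms)+

lemma sweep_subset:
  "set (sweep z c m) \<subseteq> set (local_tuples z) \<union> range (coded_term_op (factor_codes z))"
  unfolding sweep_def
proof (induction rule: foldl_rev_upt_induct)
  case (step i T)
  show ?case using refine_subset_range by (rule order_trans) blast
qed auto

lemma esize_advance_le:
  "esize (advance z c m) \<le> esize (default_tuple z) + esize (local_tuples z) +
     (esize (factor_codes z) * (op_size + 1) + 1)"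
proof -
  have "advance z c m \<in>
      insert (default_tuple z) (set (local_tuples z) \<union> range (coded_term_op (factor_codes z)))"
    using lookup_in sweep_subset unfolding advance_def by blast
  then consider (fallback) "advance z c m = default_tuple z"
    | (designated) "advance z c m \<in> set (local_tuples z)"
    | (computed) ts where "advance z c m = coded_term_op (factor_codes z) ts" by auto
  then show ?thesis
  proof cases
    case designated
    then show ?thesis using esize_elem_less[of "advance z c m" "local_tuples z"] by simp
  next
    case computed
    then show ?thesis using esize_coded_term_op_le[of "factor_codes z" ts] by simp
  qed simp
qed

lemma poly_time_advance:
  assumes "poly_time Q z" "poly_time Q c" "poly_time Q m"
  shows "poly_time Q (\<lambda>x. advance (z x) (c x) (m x))"
  unfolding advance_def by (intro poly_time_intros poly_time_lookup poly_time_sweep assms)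

lemma poly_time_approach: "poly_time Q approach"
  unfolding approach_def
proof (rule poly_time_foldl_additive)
  show "poly_time Q (\<lambda>y. advance (snd (snd y)) (fst y) (fst (snd y)))"
    by (intro poly_time_intros poly_time_advance)
  show "poly_bounded (\<lambda>z :: decision_input. esize (default_tuple z) + esize (local_tuples z) +
      (esize (factor_codes z) * (op_size + 1) + 1))"
    by (intro poly_bounded_intros poly_bounded_poly_time[where Q = Q] poly_time_intros
        poly_time_default_tuple poly_time_local_tuples)
  show "esize (advance z c m) \<le> esize c + (esize (default_tuple z) + esize (local_tuples z) +
      (esize (factor_codes z) * (op_size + 1) + 1))" for z c m
    using esize_advance_le by (rule trans_le_add2)
qed (intro poly_time_intros poly_time_lookup poly_time_local_tuples)+

lemma poly_time_decide: "poly_time Q decide"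
  unfolding decide_def by (intro poly_time_intros poly_time_approach)

end

locale decision_instance = coded_instance L K d P ca ce As as
  for L :: "'f language" and K :: "('f, 'a) alg set" and d :: nat and P :: "'f trm"
    and ca :: "('f, 'a) alg \<Rightarrow> val" and ce :: "'a \<Rightarrow> val"
    and As :: "('f, 'a) alg list" and as :: "'a list list" +
  fixes R :: "'a list set" and r :: "nat set \<times> 'a list \<Rightarrow> 'a list" and F :: "nat \<Rightarrow> ('a \<times> 'a) set"
    and u :: "nat \<times> 'a \<times> 'a \<Rightarrow> 'a list \<times> 'a list"
    and ls :: "(nat set \<times> 'a list) list" and fs :: "(nat \<times> 'a \<times> 'a) list" and b :: "'a list"
  assumes rep: "standardized_rep d P As B R r F u"
    and set_ls: "set ls = local_indices d n B" and set_fs: "set fs = fork_indices d n F"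
    and b_UA: "b \<in> UA" and d_le_n: "d \<le> n"
begin

abbreviation z :: decision_input where
  "z \<equiv> ((coded_gens ca ce As as, map ce b), (map (coded_local ce r) ls, map (coded_fork ce u) fs))"

abbreviation coded_B where "coded_B \<equiv> map ce ` B"

lemma factor_codes_z: "factor_codes z = map ca As"
  by (simp add: coded_gens_def)

lemma default_tuple_in: "default_tuple z \<in> coded_B"
  using as_nonempty by (cases as) (auto simp: default_tuple_def coded_gens_def intro: Sg.gen)

lemma local_tuples_subset: "set (local_tuples z) \<subseteq> coded_B"
  using local_designation_in[OF rep] set_ls by (auto simp: local_tuples_def coded_local_def)

lemma lookup_in_B: "set T \<subseteq> coded_B \<Longrightarrow> lookup z J T \<in> coded_B"
  by (rule subsetD[OF _ lookup_in]) (simp add: default_tuple_in)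

lemma witnesses_in:
  "fst_witness (fork_entry z c m) \<in> coded_B" "snd_witness (fork_entry z c m) \<in> coded_B"
proof -
  have "fork_entry z c m \<in>
      insert (0, Leaf, Leaf, default_tuple z, default_tuple z, ()) (set (map (coded_fork ce u) fs))"
    unfolding fork_entry_def snd_conv by (rule find_default_in)
  then have "fst_witness (fork_entry z c m) \<in> coded_B \<and> snd_witness (fork_entry z c m) \<in> coded_B"
    using default_tuple_in fork_designation_in[OF rep] set_fs by (auto simp: coded_fork_def)
  then show "fst_witness (fork_entry z c m) \<in> coded_B" "snd_witness (fork_entry z c m) \<in> coded_B"
    by auto
qed

lemma approximants_decode:
  assumes "set T \<subseteq> coded_B"
  obtains vs where "approximants z J T S = map (map ce) vs" "set vs \<subseteq> B" "length vs = d - 1"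
proof -
  have len: "length (approximants z J T S) = d - 1" by (simp add: approximants_def)
  have "approximants z J T S \<in> lists coded_B"
    using lookup_in_B[OF assms] by (auto simp: approximants_def)
  then obtain vs where vs: "approximants z J T S = map (map ce) vs" "set vs \<subseteq> B"
    unfolding lists_image by (auto simp: lists_eq_set)
  moreover have "length vs = d - 1" using len unfolding vs(1) by simp
  ultimately show ?thesis by (rule that)
qed

lemma refine_subset:
  assumes c: "c \<in> coded_B" and T: "set T \<subseteq> coded_B"
  shows "set (refine z c m T i) \<subseteq> coded_B"
proof
  fix t assume "t \<in> set (refine z c m T i)"
  then obtain S where t: "t = glue (coded_term_op (map ca As)) c (fst_witness (fork_entry z c m))
      (snd_witness (fork_entry z c m)) (approximants z [Suc i..<Suc m] T (i # S))"
    unfolding refine_def factor_codes_z by auto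
  obtain c' w w' where "c = map ce c'" "fst_witness (fork_entry z c m) = map ce w"
    "snd_witness (fork_entry z c m) = map ce w'" "{c', w, w'} \<subseteq> B"
    using c witnesses_in[of c m] by blast
  moreover obtain vs where "approximants z [Suc i..<Suc m] T (i # S) = map (map ce) vs"
    "set vs \<subseteq> B" "length vs = d - 1" by (rule approximants_decode[OF T])
  ultimately show "t \<in> coded_B" unfolding t using glue_coded by auto
qed

lemma sweep_subset_B:
  assumes "c \<in> coded_B"
  shows "set (sweep z c m) \<subseteq> coded_B"
  unfolding sweep_def
  by (induction rule: foldl_rev_upt_induct)
    (use local_tuples_subset refine_subset[OF assms] in auto)

lemma pred_d_le_n: "d - 1 \<le> n"
  using d_le_n by simp

lemma approach_in: "approach z \<in> coded_B"
  unfolding approach_def factor_codes_z length_map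
  using pred_d_le_n
proof (induction rule: foldl_upt_induct)
  case base
  show ?case by (rule lookup_in_B[OF local_tuples_subset])
next
  case (step m c)
  then show ?case unfolding advance_def by (intro lookup_in_B sweep_subset_B)
qed

lemma lookup_agrees:
  assumes "t \<in> B" "map ce t \<in> set T" "agree_on (set J) t b" and J: "set J \<subseteq> {..<n}"
    and T: "set T \<subseteq> coded_B"
  obtains s where "s \<in> B" "map ce s \<in> set T" "lookup z J T = map ce s" "agree_on (set J) s b"
proof -
  have agree: "(\<forall>j\<in>set J. nth_default Leaf (map ce s) j = nth_default Leaf (map ce b) j) \<longleftrightarrow>
      agree_on (set J) s b" if "s \<in> B" for s
  proof -
    have "nth_default Leaf (map ce s) j = nth_default Leaf (map ce b) j \<longleftrightarrow> s ! j = b ! j"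
      if "j \<in> set J" for j
      using J that \<open>s \<in> B\<close> B_subset_UA b_UA length_UA
        ce_eq_iff[OF nth_carriers nth_carriers, of s j b j]
      by (auto simp: nth_default_nth subset_iff)
    then show ?thesis by (simp add: agree_on_def)
  qed
  let ?p = "\<lambda>t. \<forall>j\<in>set J. nth_default Leaf t j = nth_default Leaf (map ce b) j"
  have "?p (map ce t)" using agree assms(1,3) by simp
  from find_default_found[of _ T ?p, OF assms(2) this, of "default_tuple z"]
  have found: "lookup z J T \<in> set T" "?p (lookup z J T)"
    unfolding lookup_def fst_conv snd_conv .
  then obtain s where "s \<in> B" "lookup z J T = map ce s" using T by blast
  then show ?thesis using found agree by (intro that) auto
qed

context
  assumes b_in_B: "b \<in> B"
begin

lemma local_tuples_agree:
  assumes "J \<subseteq> {..<n}" and "card J \<le> d - 1"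
  shows "\<exists>t\<in>B. map ce t \<in> set (local_tuples z) \<and> agree_on J t b"
proof -
  obtain I where I: "J \<subseteq> I" "I \<subseteq> {..<n}" "card I = d - 1"
    using exists_subset_between[OF assms(2) _ assms(1)] pred_d_le_n by auto
  let ?I = "Suc ` I" and ?t = "r (Suc ` I, proj (Suc ` I) b)"
  have local: "(?I, proj ?I b) \<in> local_indices d n B"
    using I b_in_B by (auto simp: local_indices_def card_image)
  then have "map ce ?t \<in> set (local_tuples z)"
    using set_ls by (force simp: local_tuples_def coded_local_def)
  moreover have "select (positions ?I) ?t = select (positions ?I) b"
    using proj_local_designation[OF rep local] by (simp add: proj_eq_select)
  moreover have "set (positions ?I) = I"
    using finite_subset[OF I(2)] by (simp add: positions_def image_image)
  ultimately show ?thesis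
    using local_designation_in[OF rep local] I(1) by (auto simp: select_def agree_on_def)
qed

lemma designated_fork:
  assumes c: "c \<in> B" "agree_on {..<m} c b" and m: "d - 1 \<le> m" "m < n"
  shows "(Suc m, b ! m, pow_op d P (As ! m) (c ! m) (b ! m)) \<in> fork_indices d n F"
proof -
  have dm: "d \<le> Suc m" "Suc m \<le> n" using m by auto
  have "take m b = take m c"
    using c(2) length_B[OF b_in_B] length_B[OF c(1)] m
    by (intro nth_equalityI) (auto simp: agree_on_def)
  then have "(b ! m, c ! m) \<in> fork (Suc m) B"
    using b_in_B c(1) unfolding fork_def witnesses_fork_def by auto
  then have "(b ! m, pow_op d P (As ! m) (c ! m) (b ! m)) \<in> F (Suc m)"
    using fork'_subset_designated[OF rep dm] unfolding fork'_def by auto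
  then show ?thesis using dm by (auto simp: fork_indices_def)
qed

lemma fork_entry_eq:
  assumes c: "c \<in> B" "agree_on {..<m} c b" and m: "d - 1 \<le> m" "m < n"
  shows "fork_entry z (map ce c) m =
    coded_fork ce u (Suc m, b ! m, pow_op d P (As ! m) (c ! m) (b ! m))"
proof -
  let ?\<epsilon> = "pow_op d P (As ! m) (c ! m) (b ! m)"
  let ?e = "fork_entry z (map ce c) m"
  have bm: "b ! m \<in> univ (As ! m)" and cm: "c ! m \<in> univ (As ! m)"
    using b_UA c(1) B_subset_UA m(2) by (auto intro: nth_UA)
  define p where "p e \<longleftrightarrow> fst e = Suc m \<and> fst (snd e) = ce (b ! m) \<and> fst (snd (snd e)) = ce ?\<epsilon>"
    for e :: "nat \<times> val \<times> val \<times> val list \<times> val list \<times> unit"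
  have e: "?e = find_default p (0, Leaf, Leaf, default_tuple z, default_tuple z, ())
      (map (coded_fork ce u) fs)"
    unfolding fork_entry_def factor_codes_z fst_conv snd_conv
    using coded_pow_eq[OF factor[OF m(2)] cm bm] m length_B[OF b_in_B] length_B[OF c(1)]
    by (simp add: nth_default_nth p_def[abs_def] coded_gens_def)
  have "coded_fork ce u (Suc m, b ! m, ?\<epsilon>) \<in> set (map (coded_fork ce u) fs)"
    using designated_fork[OF assms] set_fs by simp
  moreover have "p (coded_fork ce u (Suc m, b ! m, ?\<epsilon>))" by (simp add: p_def coded_fork_def)
  ultimately have "?e \<in> set (map (coded_fork ce u) fs)" "p ?e"
    unfolding e by (rule find_default_found)+
  then obtain \<gamma> \<delta> where h: "(Suc m, \<gamma>, \<delta>) \<in> fork_indices d n F" "?e = coded_fork ce u (Suc m, \<gamma>, \<delta>)"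
    and codes: "ce \<gamma> = ce (b ! m)" "ce \<delta> = ce ?\<epsilon>"
    using set_fs by (auto simp: coded_fork_def p_def)
  have "\<gamma> \<in> carriers" "\<delta> \<in> carriers" using subsetD[OF fork_indices_subset[OF rep] h(1)] by auto
  moreover have "b ! m \<in> carriers" "?\<epsilon> \<in> carriers"
    using bm pow_op_in_univ[OF factor[OF m(2)] cm bm] factor[OF m(2)] by blast+
  ultimately have "\<gamma> = b ! m" "\<delta> = ?\<epsilon>" using codes ce_eq_iff by blast+
  then show ?thesis using h(2) by simp
qed

lemma fork_entry_witnesses:
  assumes c: "c \<in> B" "agree_on {..<m} c b" and m: "d - 1 \<le> m" "m < n"
  obtains w w' where "w \<in> B" "w' \<in> B" "agree_on {..<m} w w'" "w ! m = b ! m"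
    "w' ! m = pow_op d P (As ! m) (c ! m) (b ! m)"
    "fst_witness (fork_entry z (map ce c) m) = map ce w"
    "snd_witness (fork_entry z (map ce c) m) = map ce w'"
proof -
  let ?\<epsilon> = "pow_op d P (As ! m) (c ! m) (b ! m)"
  let ?w = "u (Suc m, b ! m, ?\<epsilon>)"
  have w: "fst ?w \<in> B" "snd ?w \<in> B" and fork: "witnesses_fork (Suc m) ?w (b ! m, ?\<epsilon>)"
    using designated_fork[OF assms] fork_designation_in[OF rep] witnesses_fork_designation[OF rep]
    by blast+
  have "take m (fst ?w) = take m (snd ?w)" and at_m: "fst ?w ! m = b ! m" "snd ?w ! m = ?\<epsilon>"
    using fork by (simp_all add: witnesses_fork_def)
  then have agree: "agree_on {..<m} (fst ?w) (snd ?w)"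
    unfolding agree_on_def by (metis lessThan_iff nth_take)
  show ?thesis
    by (rule that[OF w agree at_m]; unfold fork_entry_eq[OF assms]) (simp_all add: coded_fork_def)
qed

definition covers :: "nat \<Rightarrow> nat \<Rightarrow> val list list \<Rightarrow> bool" where
  "covers m i T \<longleftrightarrow> (\<forall>S. length S = d - 2 \<and> set S \<subseteq> {..<m} \<longrightarrow>
     (\<exists>t\<in>B. map ce t \<in> set T \<and> agree_on (set S \<union> {i..m}) t b))"

lemma approximants_agree:
  assumes T: "set T \<subseteq> coded_B" "covers m (Suc i) T" and S: "length S = d - 1" "set S \<subseteq> {..<m}"
    and m: "m < n"
  obtains vs where "approximants z [Suc i..<Suc m] T S = map (map ce) vs" "set vs \<subseteq> B"
    "length vs = d - 1"
    "\<And>j. j < d - 1 \<Longrightarrow> agree_on (set (remove_nth j S) \<union> {Suc i..m}) (vs ! j) b"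
proof -
  obtain vs where vs: "approximants z [Suc i..<Suc m] T S = map (map ce) vs" "set vs \<subseteq> B"
    "length vs = d - 1"
    by (rule approximants_decode[OF T(1)])
  have "agree_on (set (remove_nth j S) \<union> {Suc i..m}) (vs ! j) b" if j: "j < d - 1" for j
  proof -
    let ?J = "remove_nth j S @ [Suc i..<Suc m]"
    have J: "set ?J = set (remove_nth j S) \<union> {Suc i..m}" by auto
    have "length (remove_nth j S) = d - 2" "set (remove_nth j S) \<subseteq> {..<m}"
      using length_remove_nth[of j S] set_remove_nth_subset[of j S] S j by auto
    then obtain t where "t \<in> B" "map ce t \<in> set T" "agree_on (set ?J) t b"
      using T(2) unfolding covers_def J by blast
    moreover have "set ?J \<subseteq> {..<n}" using \<open>set (remove_nth j S) \<subseteq> {..<m}\<close> m unfolding J by auto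
    ultimately obtain s where s: "s \<in> B" "lookup z ?J T = map ce s" "agree_on (set ?J) s b"
      using lookup_agrees T(1) by metis
    have "map (map ce) vs ! j = lookup z ?J T"
      using j unfolding vs(1)[symmetric] approximants_def by simp
    then have "map ce (vs ! j) = map ce s" using vs(3) j s(2) by simp
    moreover have "vs ! j \<in> B" using vs(2,3) j by auto
    ultimately have "vs ! j = s" using map_ce_UA_eq_iff s(1) B_subset_UA by blast
    then show ?thesis using s(3) J by simp
  qed
  then show ?thesis using vs by (rule that[rotated 3])
qed

lemma refine_covers:
  assumes c: "c \<in> B" "agree_on {..<m} c b" and m: "d - 1 \<le> m" "m < n" and i: "i < m"
    and T: "set T \<subseteq> coded_B" "covers m (Suc i) T"
  shows "covers m i (refine z (map ce c) m T i)"
  unfolding covers_def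
proof (intro allI impI)
  fix S assume S: "length S = d - 2 \<and> set S \<subseteq> {..<m}"
  have iS: "length (i # S) = d - 1" "set (i # S) \<subseteq> {..<m}" using S i d_gt_1 by auto
  obtain vs where vs: "approximants z [Suc i..<Suc m] T (i # S) = map (map ce) vs" "set vs \<subseteq> B"
      "length vs = d - 1"
    and vs_agree: "\<And>j. j < d - 1 \<Longrightarrow> agree_on (set (remove_nth j (i # S)) \<union> {Suc i..m}) (vs ! j) b"
    by (rule approximants_agree[OF T iS m(2)]) blast
  obtain w w' where w: "w \<in> B" "w' \<in> B" "agree_on {..<m} w w'" "w ! m = b ! m"
      "w' ! m = pow_op d P (As ! m) (c ! m) (b ! m)"
    and coded_w: "fst_witness (fork_entry z (map ce c) m) = map ce w"
      "snd_witness (fork_entry z (map ce c) m) = map ce w'"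
    by (rule fork_entry_witnesses[OF c m])
  let ?g = "glue opA c w w' vs"
  have cww: "{c, w, w'} \<subseteq> B" using c w by simp
  note g = glue_coded[OF cww vs(2,3)]
  have "S \<in> set (List.n_lists (d - 2) [0..<length (factor_codes z)])"
    using S m by (auto simp: set_n_lists coded_gens_def)
  then have "map ce ?g \<in> set (refine z (map ce c) m T i)"
    unfolding refine_def g(2)[symmetric] coded_w factor_codes_z vs(1)[symmetric] by auto
  moreover have "agree_on (insert m (set (i # S) \<union> {Suc i..<m})) ?g b"
  proof (rule glue_agree_on[OF _ _ vs(3) m(2) c(2) w(3-5) iS])
    show "{b, c, w, w'} \<subseteq> UA" "set vs \<subseteq> UA" using b_in_B cww vs(2) B_subset_UA by auto
    show "agree_on (insert m (set (remove_nth j (i # S)) \<union> {Suc i..<m})) (vs ! j) b"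
      if "j < d - 1" for j
      using vs_agree[OF that] by (rule agree_on_subset) (use i in auto)
  qed auto
  then have "agree_on (set S \<union> {i..m}) ?g b" by (rule agree_on_subset) auto
  ultimately show "\<exists>t\<in>B. map ce t \<in> set (refine z (map ce c) m T i) \<and> agree_on (set S \<union> {i..m}) t b"
    using g(1) by blast
qed

lemma sweep_covers:
  assumes c: "c \<in> B" "agree_on {..<m} c b" and m: "d - 1 \<le> m" "m < n"
  shows "covers m 0 (sweep z (map ce c) m)"
proof -
  have "set T \<subseteq> coded_B \<and> covers m 0 T" if "T = sweep z (map ce c) m" for T
    unfolding that sweep_def
  proof (induction rule: foldl_rev_upt_induct)
    case base
    have "\<exists>t\<in>B. map ce t \<in> set (local_tuples z) \<and> agree_on (set S \<union> {m..m}) t b"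
      if "length S = d - 2" "set S \<subseteq> {..<m}" for S
    proof (rule local_tuples_agree)
      show "card (set S \<union> {m..m}) \<le> d - 1"
        using card_Un_le[of "set S" "{m..m}"] card_length[of S] that(1) d_gt_1 by simp
    qed (use that m in auto)
    then show ?case using local_tuples_subset by (simp add: covers_def)
  next
    case (step i T)
    then show ?case using refine_covers[OF c m] refine_subset c(1) by simp
  qed
  then show ?thesis by blast
qed

lemma advance_agrees:
  assumes c: "c \<in> B" "agree_on {..<m} c b" and m: "d - 1 \<le> m" "m < n"
  obtains c' where "c' \<in> B" "advance z (map ce c) m = map ce c'" "agree_on {..<Suc m} c' b"
proof -
  have "set (replicate (d - 2) 0) \<subseteq> {..<m}" using m d_gt_1 by (auto simp: set_replicate_conv_if)
  then obtain t where t: "t \<in> B" "map ce t \<in> set (sweep z (map ce c) m)"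
    "agree_on (set (replicate (d - 2) 0) \<union> {0..m}) t b"
    using sweep_covers[OF assms] unfolding covers_def by (meson length_replicate)
  have "agree_on (set [0..<Suc m]) t b" using t(3) by (rule agree_on_subset) auto
  moreover have "set [0..<Suc m] \<subseteq> {..<n}" using m by auto
  moreover have "set (sweep z (map ce c) m) \<subseteq> coded_B" using c(1) by (intro sweep_subset_B) simp
  ultimately obtain s where "s \<in> B" "lookup z [0..<Suc m] (sweep z (map ce c) m) = map ce s"
    "agree_on (set [0..<Suc m]) s b"
    by (rule lookup_agrees[OF t(1,2)])
  then show ?thesis
    by (intro that[of s]) (auto simp: advance_def atLeast0LessThan lessThan_Suc)
qed

lemma approach_complete: "approach z = map ce b"
proof -
  have "\<exists>c\<in>B. approach z = map ce c \<and> agree_on {..<n} c b"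
    unfolding approach_def factor_codes_z length_map
    using pred_d_le_n
  proof (induction rule: foldl_upt_induct)
    case base
    have J: "set [0..<d - 1] \<subseteq> {..<n}" using d_le_n by auto
    then obtain t where t: "t \<in> B" "map ce t \<in> set (local_tuples z)"
      "agree_on (set [0..<d - 1]) t b"
      using local_tuples_agree[of "set [0..<d - 1]"] by auto
    show ?case
      by (rule lookup_agrees[OF t J local_tuples_subset]) (auto simp: atLeast0LessThan)
  next
    case (step m c)
    then show ?case using advance_agrees by metis
  qed
  then obtain c where c: "c \<in> B" "approach z = map ce c" "agree_on {..<n} c b" by blast
  moreover have "c = b" using c b_in_B length_B by (intro nth_equalityI) (auto simp: agree_on_def)
  ultimately show ?thesis by simp
qed

end

lemma decide_iff: "decide z \<longleftrightarrow> b \<in> B"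
proof
  assume "decide z"
  then obtain c where "c \<in> B" "map ce c = map ce b" using approach_in by (auto simp: decide_def)
  then show "b \<in> B" using map_ce_UA_eq_iff b_UA B_subset_UA by blast
qed (simp add: decide_def approach_complete)

end

context coded
begin

abbreviation "SMP_K \<equiv> SMP L K ca ce"
abbreviation "CR_K \<equiv> CompactRep d P L K ca ce"

lemma SMP_instanceE:
  assumes "v \<in> instances SMP_K"
  obtains As as b where "v = encode (coded_gens ca ce As as, map ce b)" "valid_gens K As as"
    "b \<in> univ (prod_alg As)"
  using assms unfolding SMP_from_def by (auto simp: encode_coded_gens encode_tuple)

lemma SMP_instanceI:
  "valid_gens K As as \<Longrightarrow> b \<in> univ (prod_alg As) \<Longrightarrow>
   encode (coded_gens ca ce As as, map ce b) \<in> instances SMP_K"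
  unfolding SMP_from_def
  by (auto simp: encode_coded_gens encode_tuple valid_gens_def Suc_le_eq)

lemma SMP_solutionI:
  "valid_gens K As as \<Longrightarrow> b \<in> univ (prod_alg As) \<Longrightarrow>
   encode (b \<in> Sg L (prod_alg As) (set as)) \<in> solutions SMP_K
       (encode (coded_gens ca ce As as, map ce b))"
  unfolding SMP_from_def encode_Pair encode_coded_gens encode_tuple encode_bool
  by (auto simp: valid_gens_def Suc_le_eq)

lemma decide_CompactRep_solution:
  assumes valid: "valid_gens K As as" and b: "b \<in> univ (prod_alg As)" and d: "d \<le> length As"
    and v: "v \<in> solutions CR_K (enc_gens ca ce As as)"
  obtains rep where "v = encode rep"
    "decide ((coded_gens ca ce As as, map ce b), rep) \<longleftrightarrow> b \<in> Sg L (prod_alg As) (set as)"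
proof -
  obtain As' as' R r F u where gens: "enc_gens ca ce As as = enc_gens ca ce As' as'"
    and valid': "valid_gens K As' as'"
    and rep: "standardized_rep d P As' (Sg L (prod_alg As') (set as')) R r F u"
    and enc: "encodes_rep ce d (length As') (Sg L (prod_alg As') (set as')) r F u v"
    using v unfolding CompactRep_def by auto
  have "coded_gens ca ce As as = coded_gens ca ce As' as'"
    using gens unfolding encode_coded_gens[symmetric] by (rule encode_inject[THEN iffD1])
  then have [simp]: "As' = As" "as' = as" using coded_gens_inject[OF valid valid'] by auto
  obtain ls fs where ls: "set ls = local_indices d (length As) (Sg L (prod_alg As) (set as))"
    and fs: "set fs = fork_indices d (length As) F"
    and v_eq: "v = encode (map (coded_local ce r) ls, map (coded_fork ce u) fs)"
    using enc unfolding encodes_rep_iff by auto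
  interpret coded_instance L K d P ca ce As as by (rule coded_instanceI[OF valid])
  interpret decision_instance L K d P ca ce As as R r F u ls fs b
    by unfold_locales (use rep ls fs b d in auto)
  show ?thesis using that[OF v_eq decide_iff] .
qed

definition pad :: "val list \<Rightarrow> val list" where
  "pad t = replicate d (hd (t @ [Leaf])) @ t"

definition pad_input :: "coded_gens \<times> val list \<Rightarrow> coded_gens \<times> val list" where
  "pad_input x = ((pad (fst (fst x)), map pad (snd (fst x))), pad (snd x))"

lemma poly_time_pad_input: "poly_time Q g \<Longrightarrow> poly_time Q (\<lambda>x. pad_input (g x))"
  unfolding pad_input_def pad_def by (intro poly_time_intros)

end

context coded_instance
begin

abbreviation gens :: coded_gens where
  "gens \<equiv> coded_gens ca ce As as"

lemma valid_gens_select: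
  assumes "js \<noteq> []" "set js \<subseteq> {..<n}"
  shows "valid_gens K (select js As) (map (select js) as)"
  using assms as_nonempty as_UA select_in_univ[OF assms(2)] factor factors
    set_select_subset[OF assms(2)]
  unfolding valid_gens_def by (auto simp: select_def)

lemma Sg_select_B:
  "set js \<subseteq> {..<n} \<Longrightarrow> Sg L (prod_alg (select js As)) (set (map (select js) as)) = select js ` B"
  using Sg_select[of js As L "set as"] by simp

definition padding :: "nat list" where
  "padding = replicate d 0 @ [0..<n]"

lemma set_padding: "set padding \<subseteq> {..<n}" and padding_nonempty: "padding \<noteq> []"
  using As_nonempty by (auto simp: padding_def)

lemma pad_map:
  assumes "length xs = n"
  shows "pad (map f xs) = map f (select padding xs)"
proof -
  have "select padding xs = replicate d (xs ! 0) @ xs"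
    using select_upt[of n xs] assms by (simp add: padding_def select_append) (simp add: select_def)
  moreover have "hd (map f xs @ [Leaf]) = f (xs ! 0)" using assms As_nonempty by (cases xs) auto
  ultimately show ?thesis by (simp add: pad_def)
qed

lemma pad_input_eq:
  assumes "b \<in> UA"
  shows "pad_input (gens, map ce b) =
    (coded_gens ca ce (select padding As) (map (select padding) as), map ce (select padding b))"
proof -
  have "pad (map ce t) = map ce (select padding t)" if "t \<in> UA" for t
    by (rule pad_map[OF length_UA[OF that]])
  then show ?thesis using pad_map[of As ca] as_UA assms by (auto simp: pad_input_def coded_gens_def)
qed

lemma select_padding_in_iff:
  assumes "b \<in> UA"
  shows "select padding b \<in> select padding ` B \<longleftrightarrow> b \<in> B"
proof -
  have drop: "drop d (select padding t) = t" if "length t = n" for t :: "'a list"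
    using select_upt[of n t] that by (simp add: padding_def select_append)
  show ?thesis
  proof
    assume "select padding b \<in> select padding ` B"
    then obtain t where t: "t \<in> B" "select padding b = select padding t" by blast
    have "b = drop d (select padding b)" by (rule drop[OF length_UA[OF assms], symmetric])
    also have "\<dots> = t" unfolding t(2) by (rule drop[OF length_B[OF t(1)]])
    finally show "b \<in> B" using t(1) by simp
  qed (rule imageI)
qed

lemma padded_instance:
  assumes "b \<in> UA"
  shows "encode (fst (pad_input (gens, map ce b))) \<in> instances CR_K"
proof -
  have "d \<le> length (select padding As)" by (simp add: padding_def)
  then show ?thesis
    using valid_gens_select[OF padding_nonempty set_padding]
    unfolding CompactRep_def pad_input_eq[OF assms] fst_conv encode_coded_gens problem.select_convs
    by blast
qed

lemma decide_padded:
  assumes b: "b \<in> UA" and v: "v \<in> solutions CR_K (encode (fst (pad_input (gens, map ce b))))"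
  obtains rep where "v = encode rep" "decide (pad_input (gens, map ce b), rep) \<longleftrightarrow> b \<in> B"
proof -
  have "d \<le> length (select padding As)" by (simp add: padding_def)
  from decide_CompactRep_solution[OF valid_gens_select[OF padding_nonempty set_padding]
      select_in_univ[OF set_padding b] this
      v[unfolded pad_input_eq[OF b] fst_conv encode_coded_gens]]
  show ?thesis
    using that
    unfolding pad_input_eq[OF b] Sg_select_B[OF set_padding] select_padding_in_iff[OF b] .
qed

end

context coded
begin

theorem SMP_by_one_call: "poly_time_solvable_with_calls {1} SMP_K CR_K"
proof -
  obtain q :: "nat poly" where q: "\<And>x y. x \<in> instances CR_K \<Longrightarrow> y \<in> solutions CR_K x \<Longrightarrow>
      vsize y \<le> poly q (vsize x)"
    using CompactRep_solution_size by blast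
  show ?thesis
  proof (rule poly_time_solvable_with_one_call[where pre = "\<lambda>x. fst (pad_input x)"
        and post = "\<lambda>y. decide (pad_input (fst y), snd y)", OF _ _ _ _ q])
    show "poly_time trivial_problem (\<lambda>x. fst (pad_input x))"
      by (intro poly_time_intros poly_time_pad_input)
    show "poly_time trivial_problem (\<lambda>y :: decision_input. decide (pad_input (fst y), snd y))"
      by (intro poly_time_intros poly_time_comp[OF _ poly_time_decide] poly_time_pad_input)
  next
    fix v assume "v \<in> instances SMP_K"
    then obtain As as b where v: "v = encode (coded_gens ca ce As as, map ce b)"
      and valid: "valid_gens K As as" and b: "b \<in> univ (prod_alg As)"
      by (rule SMP_instanceE)
    interpret coded_instance L K d P ca ce As as by (rule coded_instanceI[OF valid])
    show "\<exists>x. v = encode x \<and> encode (fst (pad_input x)) \<in> instances CR_K"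
      using v padded_instance[OF b] by blast
  next
    fix x v assume "encode x \<in> instances SMP_K"
      and v: "v \<in> solutions CR_K (encode (fst (pad_input x)))"
    then obtain As as b where "encode x = encode (coded_gens ca ce As as, map ce b)"
      and valid: "valid_gens K As as" and b: "b \<in> univ (prod_alg As)"
      by (blast elim: SMP_instanceE)
    then have x: "x = (coded_gens ca ce As as, map ce b)" unfolding encode_inject by simp
    interpret coded_instance L K d P ca ce As as by (rule coded_instanceI[OF valid])
    obtain rep where "v = encode rep" "decide (pad_input x, rep) \<longleftrightarrow> b \<in> B"
      using decide_padded[OF b] v unfolding x by blast
    then show "\<exists>y. v = encode y \<and>
        encode (decide (pad_input (fst (x, y)), snd (x, y))) \<in> solutions SMP_K (encode x)"
      using SMP_solutionI[OF valid b] unfolding x[symmetric] by auto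
  qed auto
qed

theorem SMP_from_by_one_call: "poly_time_solvable_with_calls {1} (SMP_from d L K ca ce) CR_K"
proof (rule poly_time_solvable_with_calls_mono[OF SMP_by_one_call subset_refl])
  show "instances (SMP_from d L K ca ce) \<subseteq> instances SMP_K"
    using d_gt_1 by (fastforce simp: SMP_from_def)
  fix v assume "v \<in> instances (SMP_from d L K ca ce)"
  then obtain As as b where v: "v = Node (enc_gens ca ce As as) (enc_tuple ce b)"
    and valid: "valid_gens K As as" and d: "d \<le> length As"
    unfolding SMP_from_def by auto
  have "length As' = length As"
    if "enc_gens ca ce As as = enc_gens ca ce As' as'" "valid_gens K As' as'" for As' as'
    using that coded_gens_inject(1)[OF valid, of As' as'] by (simp flip: encode_coded_gens)
  then show "solutions SMP_K v \<subseteq> solutions (SMP_from d L K ca ce) v"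
    unfolding v SMP_from_def using d by fastforce
qed

end

section \<open>Computing a standardized representation with membership queries\<close>

definition coded_select :: "nat list \<Rightarrow> val list \<Rightarrow> val list" where
  "coded_select js t = map (\<lambda>j. nth_default Leaf t j) js"

lemma coded_select_map:
  "set js \<subseteq> {..<length xs} \<Longrightarrow> coded_select js (map f xs) = map f (select js xs)"
  by (auto simp: coded_select_def select_def nth_default_nth subset_iff)

lemma n_lists_map: "List.n_lists k (map f xs) = map (map f) (List.n_lists k xs)"
  by (induction k) (auto simp: map_concat o_def)

lemma product_map: "List.product (map f xs) (map g ys) = map (map_prod f g) (List.product xs ys)"
  by (induction xs) (auto simp: o_def)

lemma map_filter_map:
  assumes "\<And>x. x \<in> set l \<Longrightarrow> p (f x) \<longleftrightarrow> q x" and "\<And>x. x \<in> set l \<Longrightarrow> q x \<Longrightarrow> h (f x) = g x"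
  shows "map h (filter p (map f l)) = map g (filter q l)"
  using assms by (induction l) auto

context coded
begin

definition element_codes :: "(val \<times> val) set" where
  "element_codes = (\<lambda>(A, a). (ca A, ce a)) ` (SIGMA A:K. univ A)"

lemma finite_element_codes: "finite element_codes"
  unfolding element_codes_def by (intro finite_imageI finite_SigmaI finite_K finite_univ)

lemma element_codes_iff: "A \<in> K \<Longrightarrow> (ca A, v) \<in> element_codes \<longleftrightarrow> v \<in> ce ` univ A"
  using inj_on_eq_iff[OF inj_ca] by (auto simp: element_codes_def image_iff Bex_def)

lemma list_all2_element_codes:
  assumes "set As \<subseteq> K"
  shows "list_all2 (\<lambda>A a. (A, a) \<in> element_codes) (map ca As) t \<longleftrightarrow> t \<in> map ce ` univ (prod_alg As)"
proof
  assume codes: "list_all2 (\<lambda>A a. (A, a) \<in> element_codes) (map ca As) t"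
  then have len: "length t = length As" by (auto dest: list_all2_lengthD)
  have "\<exists>a\<in>univ (As ! i). t ! i = ce a" if "i < length As" for i
    using list_all2_nthD[OF codes, of i] element_codes_iff[of "As ! i"] that assms
    by (auto dest: subsetD[OF _ nth_mem])
  then obtain a where a: "\<And>i. i < length As \<Longrightarrow> a i \<in> univ (As ! i) \<and> t ! i = ce (a i)" by metis
  have "t = map ce (map a [0..<length As])" using a len by (intro nth_equalityI) auto
  moreover have "map a [0..<length As] \<in> univ (prod_alg As)" using a by (simp add: prod_alg_def)
  ultimately show "t \<in> map ce ` univ (prod_alg As)" by blast
next
  assume "t \<in> map ce ` univ (prod_alg As)"
  then show "list_all2 (\<lambda>A a. (A, a) \<in> element_codes) (map ca As) t"
    using assms by (auto simp: list_all2_conv_all_nth element_codes_iff prod_alg_def subset_iff)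
qed

definition valid_input :: "coded_gens \<times> val list \<Rightarrow> bool" where
  "valid_input x \<longleftrightarrow> fst (fst x) \<noteq> [] \<and> snd (fst x) \<noteq> [] \<and> (\<forall>A\<in>set (fst (fst x)). A \<in> ca ` K) \<and>
     (\<forall>t\<in>set (snd x # snd (fst x)). list_all2 (\<lambda>A a. (A, a) \<in> element_codes) (fst (fst x)) t)"

lemma valid_input_iff:
  "valid_input x \<longleftrightarrow> (\<exists>As as b. x = (coded_gens ca ce As as, map ce b) \<and> valid_gens K As as \<and>
     b \<in> univ (prod_alg As))"
proof
  assume x: "valid_input x"
  then have "fst (fst x) \<in> lists (ca ` K)" by (auto simp: valid_input_def)
  then obtain As where As: "fst (fst x) = map ca As" "set As \<subseteq> K"
    unfolding lists_image by (auto simp: lists_eq_set)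
  have tuples: "snd x # snd (fst x) \<in> lists (map ce ` univ (prod_alg As))"
    using x list_all2_element_codes[OF As(2)] by (auto simp: valid_input_def As(1))
  then obtain b as where "snd x = map ce b" "snd (fst x) = map (map ce) as"
    "b \<in> univ (prod_alg As)" "set as \<subseteq> univ (prod_alg As)"
    unfolding lists_image by (auto simp: lists_eq_set)
  then show "\<exists>As as b. x = (coded_gens ca ce As as, map ce b) \<and> valid_gens K As as \<and>
      b \<in> univ (prod_alg As)"
    using x As by (cases x) (force simp: valid_input_def coded_gens_def valid_gens_def)
next
  assume "\<exists>As as b. x = (coded_gens ca ce As as, map ce b) \<and> valid_gens K As as \<and>
    b \<in> univ (prod_alg As)"
  then obtain As as b where x: "x = (coded_gens ca ce As as, map ce b)"
    and valid: "valid_gens K As as" and b: "b \<in> univ (prod_alg As)" by blast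
  have "set As \<subseteq> K" "set as \<subseteq> univ (prod_alg As)" using valid by (auto simp: valid_gens_def)
  then show "valid_input x"
    using list_all2_element_codes[of As] valid b
    by (auto simp: valid_input_def coded_gens_def valid_gens_def x dest: subsetD)
qed

lemma encode_in_instances_iff: "encode x \<in> instances SMP_K \<longleftrightarrow> valid_input x"
proof
  assume "encode x \<in> instances SMP_K"
  then obtain As as b where "encode x = encode (coded_gens ca ce As as, map ce b)"
    "valid_gens K As as" "b \<in> univ (prod_alg As)"
    by (rule SMP_instanceE)
  then show "valid_input x" unfolding encode_inject valid_input_iff by blast
next
  assume "valid_input x"
  then show "encode x \<in> instances SMP_K" using SMP_instanceI unfolding valid_input_iff by blast
qed

lemma poly_time_valid_input: "poly_time Q valid_input"
  unfolding valid_input_def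
  by (intro poly_time_intros poly_time_mem_finite finite_element_codes finite_imageI finite_K)

definition yes_inputs :: "(coded_gens \<times> val list) set" where
  "yes_inputs = {(coded_gens ca ce As as, map ce b) | As as b.
     valid_gens K As as \<and> b \<in> Sg L (prod_alg As) (set as)}"

lemma yes_inputs_iff:
  assumes "valid_gens K As as"
  shows "(coded_gens ca ce As as, t) \<in> yes_inputs \<longleftrightarrow> t \<in> map ce ` Sg L (prod_alg As) (set as)"
  using assms coded_gens_inject[OF assms] unfolding yes_inputs_def by blast

lemma yes_inputs_valid:
  assumes "x \<in> yes_inputs"
  shows "valid_input x"
proof -
  obtain As as b where x: "x = (coded_gens ca ce As as, map ce b)"
    and valid: "valid_gens K As as" and b: "b \<in> Sg L (prod_alg As) (set as)"
    using assms unfolding yes_inputs_def by blast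
  interpret coded_instance L K d P ca ce As as by (rule coded_instanceI[OF valid])
  show "valid_input x" unfolding valid_input_iff using x valid b B_subset_UA by blast
qed

lemma poly_time_yes_inputs: "poly_time SMP_K (\<lambda>x. x \<in> yes_inputs)"
proof -
  have "poly_time SMP_K (\<lambda>x. if encode x \<in> instances SMP_K then x \<in> yes_inputs else False)"
  proof (rule poly_time_query)
    show "poly_time SMP_K (\<lambda>x :: coded_gens \<times> val list. encode x \<in> instances SMP_K)"
      unfolding encode_in_instances_iff by (rule poly_time_valid_input)
    have "esize (x \<in> yes_inputs) \<le> 3" for x unfolding encode_bool by (rule vsize_enc_bool_le)
    then show "poly_bounded (\<lambda>x. esize (x \<in> yes_inputs))"
      by (rule poly_bounded_le[OF poly_bounded_const])
    fix f and x :: "coded_gens \<times> val list" assume f: "solves f SMP_K"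
      and inst: "encode x \<in> instances SMP_K"
    then have "f (encode x) \<in> solutions SMP_K (encode x)" by (simp add: solves_def)
    then obtain As as b where answer: "f (encode x) = encode (b \<in> Sg L (prod_alg As) (set as))"
      and x: "encode x = encode (coded_gens ca ce As as, map ce b)"
      and valid: "valid_gens K As as" and b: "b \<in> univ (prod_alg As)"
      by (auto simp: SMP_from_def encode_coded_gens encode_tuple encode_bool)
    interpret coded_instance L K d P ca ce As as by (rule coded_instanceI[OF valid])
    have "x \<in> yes_inputs \<longleftrightarrow> map ce b \<in> map ce ` B"
      using x yes_inputs_iff[OF valid] unfolding encode_inject by simp
    also have "\<dots> \<longleftrightarrow> b \<in> B" using map_ce_UA_eq_iff[OF b] B_subset_UA by blast
    finally show "f (encode x) = encode (x \<in> yes_inputs)" using answer by simp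
  qed
  moreover have "(if encode x \<in> instances SMP_K then x \<in> yes_inputs else False) \<longleftrightarrow> x \<in> yes_inputs"
    for x :: "coded_gens \<times> val list"
    using yes_inputs_valid[of x] encode_in_instances_iff[of x] by metis
  ultimately show ?thesis by simp
qed

definition member_at :: "coded_gens \<Rightarrow> nat list \<Rightarrow> val list \<Rightarrow> bool" where
  "member_at x js t \<longleftrightarrow> ((coded_select js (fst x), map (coded_select js) (snd x)), t) \<in> yes_inputs"

lemma poly_time_member_at:
  assumes "poly_time SMP_K x" "poly_time SMP_K js" "poly_time SMP_K t"
  shows "poly_time SMP_K (\<lambda>y. member_at (x y) (js y) (t y))"
  unfolding member_at_def coded_select_def
  by (intro poly_time_intros poly_time_comp[OF _ poly_time_yes_inputs]
      assms[THEN poly_time_comp[rotated]])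

definition elements :: "'a list" where
  "elements = (SOME l. set l = carriers \<and> distinct l)"

lemma elements: "set elements = carriers" "distinct elements"
  using someI_ex[OF finite_distinct_list[OF finite_carriers]] unfolding elements_def by auto

definition extend :: "coded_gens \<Rightarrow> nat list \<Rightarrow> val list \<Rightarrow> val list" where
  "extend x js t = take (length (fst x)) (foldl
     (\<lambda>t i. find_default (\<lambda>e. member_at x ([i..<length (fst x)] @ js) (e # t)) Leaf
         (map ce elements) # t)
     t (rev [0..<length (fst x)]))"

lemma poly_time_extend:
  assumes "poly_time SMP_K x" "poly_time SMP_K js" "poly_time SMP_K t"
  shows "poly_time SMP_K (\<lambda>y. extend (x y) (js y) (t y))"
proof -
  let ?h = "\<lambda>(t :: val list) i y.
    find_default (\<lambda>e. member_at (x y) ([i..<length (fst (x y))] @ js y) (e # t)) Leaf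
        (map ce elements) # t"
  have "poly_time SMP_K (\<lambda>y. foldl (\<lambda>t i. ?h t i y) (t y) (rev [0..<length (fst (x y))]))"
  proof (rule poly_time_foldl_additive)
    show "poly_time SMP_K (\<lambda>z. ?h (fst z) (fst (snd z)) (snd (snd z)))"
      by (intro poly_time_intros poly_time_member_at assms[THEN poly_time_comp[rotated]])
    fix y t i
    let ?e = "find_default (\<lambda>e. member_at (x y) ([i..<length (fst (x y))] @ js y) (e # t)) Leaf
        (map ce elements)"
    have "?e \<in> set (Leaf # map ce elements)" using find_default_in by fastforce
    from esize_elem_less[OF this]
    show "esize (?h t i y) \<le> esize t + (esize (Leaf # map ce elements) + 1)" by simp
  qed (intro poly_time_intros poly_bounded_intros assms)+
  then show ?thesis unfolding extend_def by (intro poly_time_intros assms)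
qed

definition local_entries :: "coded_gens \<Rightarrow> (nat list \<times> val list \<times> val list \<times> unit) list" where
  "local_entries x = map (\<lambda>e. (map Suc (fst e), snd e, extend x (fst e) (snd e), ()))
     (filter (\<lambda>e. member_at x (fst e) (snd e))
       (List.product (filter (sorted_wrt (<)) (List.n_lists (d - 1) [0..<length (fst x)]))
         (List.n_lists (d - 1) (map ce elements))))"

definition coded_fork_tuple :: "coded_gens \<Rightarrow> nat \<Rightarrow> val \<Rightarrow> val \<Rightarrow> val list" where
  "coded_fork_tuple x m g h = take m (extend x [m] [g]) @ [h]"

definition has_fork :: "coded_gens \<Rightarrow> nat \<Rightarrow> val \<Rightarrow> val \<Rightarrow> bool" where
  "has_fork x m g h \<longleftrightarrow> member_at x [m] [g] \<and> member_at x [0..<Suc m] (coded_fork_tuple x m g h)"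

definition witnessed_fork ::
  "coded_gens \<Rightarrow> nat \<Rightarrow> val \<Rightarrow> val \<Rightarrow> nat \<times> val \<times> val \<times> val list \<times> val list \<times> unit" where
  "witnessed_fork x m g h =
     (Suc m, g, h, extend x [m] [g], extend x [0..<Suc m] (coded_fork_tuple x m g h), ())"

definition fork_entries :: "coded_gens \<Rightarrow> (nat \<times> val \<times> val \<times> val list \<times> val list \<times> unit) list" where
  "fork_entries x = map (\<lambda>e. witnessed_fork x (fst e) (fst (snd e)) (snd (snd e)))
     (filter (\<lambda>e. has_fork x (fst e) (fst (snd e)) (snd (snd e)))
       (List.product [d - 1..<length (fst x)] (List.product (map ce elements) (map ce elements))))"

definition compact :: "coded_gens \<Rightarrow> coded_rep" where
  "compact x = (local_entries x, fork_entries x)"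

lemma poly_time_coded_fork_tuple:
  assumes "poly_time SMP_K x" "poly_time SMP_K m" "poly_time SMP_K g" "poly_time SMP_K h"
  shows "poly_time SMP_K (\<lambda>y. coded_fork_tuple (x y) (m y) (g y) (h y))"
  unfolding coded_fork_tuple_def by (intro poly_time_intros poly_time_extend assms)

lemma poly_time_compact: "poly_time SMP_K compact"
  unfolding compact_def local_entries_def fork_entries_def witnessed_fork_def has_fork_def
  by (intro poly_time_intros poly_time_extend poly_time_member_at poly_time_coded_fork_tuple)

end

context coded_instance
begin

lemma length_fst_gens: "length (fst gens) = n"
  by (simp add: coded_gens_def)

lemma member_at_iff:
  assumes js: "js \<noteq> []" "set js \<subseteq> {..<n}"
  shows "member_at gens js t \<longleftrightarrow> t \<in> map ce ` select js ` B"
proof -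
  have "coded_select js (fst gens) = map ca (select js As)"
    using js(2) by (simp add: coded_gens_def coded_select_map)
  moreover have "map (coded_select js) (snd gens) = map (map ce) (map (select js) as)"
    using js(2) as_UA length_UA by (auto simp: coded_gens_def coded_select_map subset_iff)
  ultimately have "(coded_select js (fst gens), map (coded_select js) (snd gens)) =
      coded_gens ca ce (select js As) (map (select js) as)"
    by (simp only: coded_gens_def)
  then show ?thesis
    unfolding member_at_def
    using yes_inputs_iff[OF valid_gens_select[OF js]] Sg_select_B[OF js(2)] by simp
qed

lemma select_B_subset_carriers:
  assumes "set js \<subseteq> {..<n}" and "c \<in> select js ` B"
  shows "set c \<subseteq> carriers"
proof -
  obtain s where s: "s \<in> B" "c = select js s" using assms(2) by blast
  have "set c \<subseteq> set s"
    unfolding s(2) by (rule set_select_subset) (simp add: length_B[OF s(1)] assms(1))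
  also have "set s \<subseteq> carriers" using s(1) B_subset_UA by (intro set_UA) auto
  finally show ?thesis .
qed

lemma member_at_map_ce:
  assumes "js \<noteq> []" "set js \<subseteq> {..<n}" and "set c \<subseteq> carriers"
  shows "member_at gens js (map ce c) \<longleftrightarrow> c \<in> select js ` B"
  unfolding member_at_iff[OF assms(1,2)]
  using map_ce_eq_iff[OF assms(3)] select_B_subset_carriers[OF assms(2)] by blast

lemma extend_step:
  assumes js: "set js \<subseteq> {..<n}" and i: "i < n" and c: "c \<in> select ([Suc i..<n] @ js) ` B"
  obtains a where
    "find_default (\<lambda>e. member_at gens ([i..<n] @ js) (e # map ce c)) Leaf (map ce elements) = ce a"
    "a # c \<in> select ([i..<n] @ js) ` B"
proof -
  let ?p = "\<lambda>e. member_at gens ([i..<n] @ js) (e # map ce c)"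
  have sub: "[i..<n] @ js \<noteq> []" "set ([i..<n] @ js) \<subseteq> {..<n}" "set ([Suc i..<n] @ js) \<subseteq> {..<n}"
    using i js by auto
  have c_carriers: "set c \<subseteq> carriers" by (rule select_B_subset_carriers[OF sub(3) c])
  have p_iff: "?p (ce a) \<longleftrightarrow> a # c \<in> select ([i..<n] @ js) ` B" if "a \<in> carriers" for a
    using member_at_map_ce[OF sub(1,2), of "a # c"] c_carriers that by simp
  obtain s where s: "s \<in> B" "c = select ([Suc i..<n] @ js) s" using c by blast
  have "s ! i \<in> carriers" by (rule nth_carriers[OF subsetD[OF B_subset_UA s(1)] i])
  moreover have "s ! i # c = select ([i..<n] @ js) s"
    using i s(2) by (simp add: select_def upt_conv_Cons)
  then have "s ! i # c \<in> select ([i..<n] @ js) ` B" using s(1) by blast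
  ultimately have "ce (s ! i) \<in> set (map ce elements)" "?p (ce (s ! i))"
    using elements(1) p_iff by auto
  note found = find_default_found[of _ _ ?p, OF this, of Leaf]
  then obtain a where "find_default ?p Leaf (map ce elements) = ce a" "a \<in> carriers"
    using elements(1) by auto
  then show ?thesis using found(2) p_iff by (intro that) auto
qed

lemma extend_eq:
  assumes js: "set js \<subseteq> {..<n}" and c: "c \<in> select js ` B"
  obtains s where "s \<in> B" "extend gens js (map ce c) = map ce s" "select js s = c"
proof -
  let ?f = "\<lambda>t i.
      find_default (\<lambda>e. member_at gens ([i..<n] @ js) (e # t)) Leaf (map ce elements) # t"
  have "\<exists>ys. length ys = n - 0 \<and> foldl ?f (map ce c) (rev [0..<n]) = map ce (ys @ c) \<and>
      ys @ c \<in> select ([0..<n] @ js) ` B"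
  proof (induction rule: foldl_rev_upt_induct)
    case base
    show ?case using c by (intro exI[of _ "[]"]) simp
  next
    case (step i t)
    then obtain ys where ys: "length ys = n - Suc i" "t = map ce (ys @ c)"
      "ys @ c \<in> select ([Suc i..<n] @ js) ` B"
      by blast
    obtain a where
      "find_default (\<lambda>e. member_at gens ([i..<n] @ js) (e # map ce (ys @ c))) Leaf
        (map ce elements) = ce a"
      "a # ys @ c \<in> select ([i..<n] @ js) ` B"
      by (rule extend_step[OF js step(1) ys(3)])
    then show ?case using ys(1,2) step(1) by (intro exI[of _ "a # ys"]) simp
  qed
  then obtain ys s where ys: "length ys = n" "foldl ?f (map ce c) (rev [0..<n]) = map ce (ys @ c)"
    and s: "s \<in> B" "ys @ c = select ([0..<n] @ js) s"
    unfolding diff_zero by blast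
  have "ys @ c = s @ select js s" using s length_B[OF s(1)] by (simp add: select_append select_upt)
  then have "ys = s" "c = select js s" using ys(1) length_B[OF s(1)] by auto
  then show ?thesis
    using ys s(1) by (intro that[of s]) (simp_all add: extend_def length_fst_gens)
qed

definition ext :: "nat list \<Rightarrow> 'a list \<Rightarrow> 'a list" where
  "ext js c = inv_into B (map ce) (extend gens js (map ce c))"

lemma ext:
  assumes "set js \<subseteq> {..<n}" and "c \<in> select js ` B"
  shows "ext js c \<in> B" and "select js (ext js c) = c"
    and "extend gens js (map ce c) = map ce (ext js c)"
proof -
  obtain s where s: "s \<in> B" "extend gens js (map ce c) = map ce s" "select js s = c"
    by (rule extend_eq[OF assms])
  have "inj_on (map ce) B" using map_ce_UA_eq_iff B_subset_UA by (auto intro!: inj_onI)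
  then have "ext js c = s" using s by (simp add: ext_def)
  then show "ext js c \<in> B" "select js (ext js c) = c"
    "extend gens js (map ce c) = map ce (ext js c)"
    using s by simp_all
qed

sublocale extension L K d P As B ext
  by unfold_locales (use subuniverse_Sg B_subset_UA ext in auto)

definition local_list :: "(nat set \<times> 'a list) list" where
  "local_list = map (\<lambda>e. (Suc ` set (fst e), snd e)) (filter (\<lambda>e. snd e \<in> select (fst e) ` B)
     (List.product (filter (sorted_wrt (<)) (List.n_lists (d - 1) [0..<n]))
         (List.n_lists (d - 1) elements)))"

lemma set_local_list: "set local_list = local_indices d n B"
proof (intro equalityI subsetI)
  fix x assume "x \<in> set local_list"
  then obtain S c where S: "sorted_wrt (<) S" "set S \<subseteq> {..<n}" "length S = d - 1"
    and c: "c \<in> select S ` B" and x: "x = (Suc ` set S, c)"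
    unfolding local_list_def by (auto simp: set_n_lists atLeast0LessThan)
  have "card (Suc ` set S) = d - 1"
    using S(1,3) by (simp add: card_image distinct_card strict_sorted_iff)
  moreover have "c \<in> proj (Suc ` set S) ` B"
    using c by (simp add: proj_eq_select positions_Suc_image[OF S(1)])
  ultimately show "x \<in> local_indices d n B" using S(2) unfolding local_indices_def x by auto
next
  fix x assume "x \<in> local_indices d n B"
  then obtain I c where x: "x = (I, c)" and I: "I \<subseteq> {1..n}" "card I = d - 1" and c: "c \<in> proj I ` B"
    unfolding local_indices_def by auto
  have "finite I" using I(1) finite_subset by blast
  then have I_eq: "I = Suc ` set (positions I)"
    using arg_cong[OF map_Suc_positions[OF I(1)], of set] by simp
  have "sorted_wrt (<) (map Suc (positions I))"
    unfolding map_Suc_positions[OF I(1)] by (rule strict_sorted_list_of_set)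
  then have "positions I \<in> set (filter (sorted_wrt (<)) (List.n_lists (d - 1) [0..<n]))"
    using set_positions[OF I(1)] I(2) by (auto simp: sorted_wrt_map set_n_lists length_positions)
  moreover have "c \<in> set (List.n_lists (d - 1) elements)"
    using proj_B[OF I(1) c] I(2) elements(1) by (simp add: set_n_lists)
  ultimately show "x \<in> set local_list"
    using c I_eq unfolding local_list_def x proj_eq_select
    by (auto intro!: image_eqI[of _ _ "(positions I, c)"])
qed

lemma distinct_local_list: "distinct local_list"
proof -
  have "S = T" if "Suc ` set S = Suc ` set T" "sorted_wrt (<) S" "sorted_wrt (<) T" for S T
    using positions_Suc_image that by metis
  then have "inj_on (\<lambda>e. (Suc ` set (fst e), snd e)) {e. sorted_wrt (<) (fst e)}"
    by (auto intro!: inj_onI simp: prod_eq_iff)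
  moreover have "distinct (List.product (filter (sorted_wrt (<)) (List.n_lists (d - 1) [0..<n]))
      (List.n_lists (d - 1) elements))"
    by (intro distinct_product distinct_filter distinct_n_lists distinct_upt elements(2))
  ultimately show ?thesis
    unfolding local_list_def distinct_map by (auto elim!: inj_on_subset)
qed

lemma local_entries_eq: "local_entries gens = map (coded_local ce local_choice) local_list"
proof -
  let ?Ss = "filter (sorted_wrt (<)) (List.n_lists (d - 1) [0..<n])"
  let ?cs = "List.n_lists (d - 1) elements"
  have product: "List.product ?Ss (List.n_lists (d - 1) (map ce elements)) =
      map (map_prod id (map ce)) (List.product ?Ss ?cs)"
    using product_map[of id ?Ss "map ce" ?cs] by (simp add: n_lists_map)
  show ?thesis
    unfolding local_entries_def length_fst_gens product local_list_def map_map
  proof (rule map_filter_map)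
    fix e assume e_in: "e \<in> set (List.product ?Ss ?cs)"
    obtain S c where e: "e = (S, c)" by (cases e)
    have S: "sorted_wrt (<) S" "set S \<subseteq> {..<n}" "S \<noteq> []" and c: "set c \<subseteq> carriers"
      using e_in d_gt_1 by (auto simp: e set_n_lists elements(1) simp del: UN_iff)
    then show "member_at gens (fst (map_prod id (map ce) e)) (snd (map_prod id (map ce) e)) \<longleftrightarrow>
        snd e \<in> select (fst e) ` B"
      by (simp add: member_at_map_ce e)
    assume "snd e \<in> select (fst e) ` B"
    then show "(map Suc (fst (map_prod id (map ce) e)), snd (map_prod id (map ce) e),
        extend gens (fst (map_prod id (map ce) e)) (snd (map_prod id (map ce) e)), ()) =
      (coded_local ce local_choice \<circ> (\<lambda>e. (Suc ` set (fst e), snd e))) e"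
      using ext(3)[OF S(2)] by (simp add: e coded_local_def local_choice_def
          sorted_list_of_set_Suc_image[OF S(1)] positions_Suc_image[OF S(1)])
  qed
qed

definition fork_list :: "(nat \<times> 'a \<times> 'a) list" where
  "fork_list = map (\<lambda>e. (Suc (fst e), snd e)) (filter (\<lambda>e. snd e \<in> fork_choices (Suc (fst e)))
     (List.product [d - 1..<n] (List.product elements elements)))"

lemma fork_choices_subset_carriers:
  assumes "0 < m" "m \<le> n" and "(\<gamma>, \<delta>) \<in> fork_choices m"
  shows "\<gamma> \<in> carriers" and "\<delta> \<in> carriers"
proof -
  have js: "set [m - 1] \<subseteq> {..<n}" "set [0..<m] \<subseteq> {..<n}" using assms(1,2) by auto
  have "[\<gamma>] \<in> select [m - 1] ` B" "fork_tuple (m - 1) \<gamma> \<delta> \<in> select [0..<m] ` B"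
    using assms(3) by (simp_all add: fork_choices_def)
  then have "set [\<gamma>] \<subseteq> carriers" "set (fork_tuple (m - 1) \<gamma> \<delta>) \<subseteq> carriers"
    using select_B_subset_carriers js by metis+
  then show "\<gamma> \<in> carriers" "\<delta> \<in> carriers" by (auto simp: fork_tuple_def)
qed

lemma set_fork_list: "set fork_list = fork_indices d n fork_choices"
proof (intro equalityI subsetI)
  fix x assume "x \<in> set fork_list"
  then show "x \<in> fork_indices d n fork_choices"
    using d_gt_1 by (auto simp: fork_list_def fork_indices_def)
next
  fix x assume "x \<in> fork_indices d n fork_choices"
  then obtain m \<gamma> \<delta> where x: "x = (m, \<gamma>, \<delta>)" "d \<le> m" "m \<le> n" "(\<gamma>, \<delta>) \<in> fork_choices m"
    by (auto simp: fork_indices_def)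
  then have "(m - 1, \<gamma>, \<delta>) \<in> set (List.product [d - 1..<n] (List.product elements elements))"
    using fork_choices_subset_carriers[of m \<gamma> \<delta>] d_gt_1 by (auto simp: elements(1))
  then show "x \<in> set fork_list"
    using x d_gt_1 unfolding fork_list_def by (auto intro!: image_eqI[of _ _ "(m - 1, \<gamma>, \<delta>)"])
qed

lemma distinct_fork_list: "distinct fork_list"
  unfolding fork_list_def
  by (auto simp: distinct_map elements(2) intro!: distinct_product distinct_filter inj_onI)

lemma extend_fork_base:
  assumes "m < n" "[\<gamma>] \<in> select [m] ` B"
  shows "extend gens [m] [ce \<gamma>] = map ce (fork_base m \<gamma>)"
  using ext(3)[of "[m]" "[\<gamma>]"] assms by (simp add: fork_base_def)

lemma coded_fork_tuple_eq:
  assumes "m < n" "[\<gamma>] \<in> select [m] ` B"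
  shows "coded_fork_tuple gens m (ce \<gamma>) (ce \<delta>) = map ce (fork_tuple m \<gamma> \<delta>)"
  by (simp add: coded_fork_tuple_def fork_tuple_def extend_fork_base[OF assms] take_map)

lemma has_fork_iff:
  assumes m: "m < n" and carriers: "\<gamma> \<in> carriers" "\<delta> \<in> carriers"
  shows "has_fork gens m (ce \<gamma>) (ce \<delta>) \<longleftrightarrow> (\<gamma>, \<delta>) \<in> fork_choices (Suc m)"
proof -
  have js: "set [m] \<subseteq> {..<n}" "set [0..<Suc m] \<subseteq> {..<n}" using m by auto
  have base: "member_at gens [m] [ce \<gamma>] \<longleftrightarrow> [\<gamma>] \<in> select [m] ` B"
    using member_at_map_ce[OF _ js(1), of "[\<gamma>]"] carriers by simp
  have tuple: "member_at gens [0..<Suc m] (coded_fork_tuple gens m (ce \<gamma>) (ce \<delta>)) \<longleftrightarrow>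
      fork_tuple m \<gamma> \<delta> \<in> select [0..<Suc m] ` B" if \<gamma>: "[\<gamma>] \<in> select [m] ` B"
  proof -
    have "set (fork_base m \<gamma>) \<subseteq> carriers"
      by (rule set_UA[OF subsetD[OF B_subset_UA fork_base(1)[OF m \<gamma>]]])
    then have "set (fork_tuple m \<gamma> \<delta>) \<subseteq> carriers"
      using carriers set_take_subset[of m "fork_base m \<gamma>"]
      by (auto simp: fork_tuple_def simp del: UN_iff)
    then show ?thesis unfolding coded_fork_tuple_eq[OF m \<gamma>] by (intro member_at_map_ce js) simp
  qed
  show ?thesis using base tuple by (auto simp: has_fork_def fork_choices_def simp del: upt_Suc)
qed

lemma witnessed_fork_eq:
  assumes m: "m < n" and fork: "(\<gamma>, \<delta>) \<in> fork_choices (Suc m)"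
  shows "witnessed_fork gens m (ce \<gamma>) (ce \<delta>) = coded_fork ce fork_witnesses (Suc m, \<gamma>, \<delta>)"
proof -
  have \<gamma>: "[\<gamma>] \<in> select [m] ` B" and tuple: "fork_tuple m \<gamma> \<delta> \<in> select [0..<Suc m] ` B"
    using fork by (simp_all add: fork_choices_def)
  have js: "set [0..<Suc m] \<subseteq> {..<n}" using m by auto
  show ?thesis
    using ext(3)[OF js tuple] extend_fork_base[OF m \<gamma>] coded_fork_tuple_eq[OF m \<gamma>]
    by (simp add: witnessed_fork_def coded_fork_def fork_witnesses_def del: upt_Suc)
qed

lemma fork_entries_eq: "fork_entries gens = map (coded_fork ce fork_witnesses) fork_list"
proof -
  let ?l = "List.product [d - 1..<n] (List.product elements elements)"
  let ?c = "map_prod id (map_prod ce ce)"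
  have product:
    "List.product [d - 1..<n] (List.product (map ce elements) (map ce elements)) = map ?c ?l"
    using product_map[of id "[d - 1..<n]" "map_prod ce ce" "List.product elements elements"]
    by (simp add: product_map)
  show ?thesis
    unfolding fork_entries_def length_fst_gens product fork_list_def map_map
  proof (rule map_filter_map)
    fix e assume e_in: "e \<in> set ?l"
    obtain m \<gamma> \<delta> where e: "e = (m, \<gamma>, \<delta>)" by (cases e)
    have m: "m < n" and carriers: "\<gamma> \<in> carriers" "\<delta> \<in> carriers"
      using e_in by (auto simp: e elements(1) simp del: UN_iff)
    show "has_fork gens (fst (?c e)) (fst (snd (?c e))) (snd (snd (?c e))) \<longleftrightarrow>
        snd e \<in> fork_choices (Suc (fst e))"
      using has_fork_iff[OF m carriers] by (simp add: e)
    assume "snd e \<in> fork_choices (Suc (fst e))"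
    then show "witnessed_fork gens (fst (?c e)) (fst (snd (?c e))) (snd (snd (?c e))) =
        (coded_fork ce fork_witnesses \<circ> (\<lambda>e. (Suc (fst e), snd e))) e"
      using witnessed_fork_eq[OF m] by (simp add: e)
  qed
qed

lemma compact_solution:
  assumes "d \<le> n"
  shows "encode (compact gens) \<in> solutions CR_K (enc_gens ca ce As as)"
proof -
  obtain R where R: "standardized_rep d P As B R local_choice fork_choices fork_witnesses"
    using standardized_rep_of_extension by blast
  have "encodes_rep ce d n B local_choice fork_choices fork_witnesses (encode (compact gens))"
    unfolding encodes_rep_iff compact_def local_entries_eq fork_entries_eq
    using distinct_local_list set_local_list distinct_fork_list set_fork_list by blast
  then show ?thesis
    using R valid assms unfolding CompactRep_def problem.select_convs mem_Collect_eq by blast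
qed

end

context coded
begin

theorem CompactRep_reducible_to_SMP: "poly_time_reducible CR_K SMP_K"
proof (rule poly_time_solvableI[OF poly_time_compact])
  fix v assume "v \<in> instances CR_K"
  then obtain As as where v: "v = enc_gens ca ce As as" and valid: "valid_gens K As as"
    and d: "d \<le> length As"
    unfolding CompactRep_def by auto
  interpret coded_instance L K d P ca ce As as by (rule coded_instanceI[OF valid])
  show "\<exists>x. v = encode x \<and> encode (compact x) \<in> solutions CR_K v"
    using compact_solution[OF d] encode_coded_gens v by metis
qed

end

lemma parallelogram_term_subset: "parallelogram_term L V d P \<Longrightarrow> K \<subseteq> V \<Longrightarrow> parallelogram_term L K d P"
  unfolding parallelogram_term_def by blast

lemma variety_is_algebra: "variety L V \<Longrightarrow> A \<in> V \<Longrightarrow> is_algebra L A"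
  unfolding variety_def by blast

theorem theorem4p16:
  fixes L :: "'f language"
    and V :: "('f, 'a) alg set"
    and K :: "('f, 'a) alg set"
    and d :: nat
    and P :: "'f trm"
    and ca :: "('f, 'a) alg \<Rightarrow> val"
    and ce :: "'a \<Rightarrow> val"
  assumes "finite (syms L)"
    and "variety L V"
    and "d > 1"
    and "\<exists>t. cube_term L V d t"
    and "parallelogram_term L V d P"
    and "finite K"
    and "K \<subseteq> V"
    and "\<forall>A\<in>K. finite (univ A)"
    and "inj_on ca K"
    and "inj_on ce (\<Union>A\<in>K. univ A)"
  shows "poly_time_reducible (SMP L K ca ce) (CompactRep d P L K ca ce) \<and>
         poly_time_reducible (CompactRep d P L K ca ce) (SMP L K ca ce) \<and>
         poly_time_solvable_with_calls {1} (SMP_from d L K ca ce) (CompactRep d P L K ca ce)"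
proof -
  interpret coded L K d P ca ce
    using assms by unfold_locales (auto intro: variety_is_algebra parallelogram_term_subset)
  have "poly_time_reducible (SMP L K ca ce) (CompactRep d P L K ca ce)"
    by (rule poly_time_solvable_with_calls_mono[OF SMP_by_one_call]) simp_all
  then show ?thesis using CompactRep_reducible_to_SMP SMP_from_by_one_call by blast
qed

end
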